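(* Let $W=(W_t)_{t\ge0}$ be a standard Brownian motion. Let $f\in L^2_s(\mathbb{R}_+^2)$ with $0\leq \mathrm{rank}(f)<\infty$, let $\mu_0\in\mathbb{R}$ and let $N\sim\mathcal{N}(0,\mu_0^2)$ be independent of $W$. Assume that $|\mu_0|+\|f\|_{L^2(\mathbb{R}_+^2)}>0$ and set $$Q(x)=x^{2(1+\mathbf{1}_{\{\mu_0\neq 0\}})}\prod_{\lambda\in E(f)}(x-\lambda)^2 .$$ Let $\{F_n\}_{n\geq 1}$ be a sequence of double Wiener–Itô integrals with respect to $W$ (i.e. $F_n=I_2^W(f_n)$ with $f_n\in L^2_s(\mathbb{R}_+^2)$). Then, as $n\to\infty$, we have (i) $F_n\overset{\rm law}{\to} N+I_2^W(f)$ if and only if all the following are satisfied: (ii-a) $\kappa_2(F_n)\to \kappa_2(N+I_2^W(f))=\mu_0^2+2\|f\|^2_{L^2(\mathbb{R}_+^2)}$; (ii-b) $\displaystyle\sum_{r=3}^{\deg Q} \frac{Q^{(r)}(0)}{r!}\,\frac{\kappa_r(F_n)}{(r-1)!\,2^{r-1}} \to \sum_{r=3}^{\deg Q} \frac{Q^{(r)}(0)}{r!}\,\frac{\kappa_r(I_2^W(f))}{(r-1)!\,2^{r-1}}$; (ii-c) $\kappa_r(F_n)\to \kappa_r(I_2^W(f))$ for $a(f)$ consecutive values of $r$, with $r\geq 2(1+\mathbf{1}_{\{\mu_0\neq 0\}})$ (i.e. for $r=r_0,r_0+1,\dots,r_0+a(f)-1$ for some integer $r_0\ge 2(1+\mathbf{1}_{\{\mu_0\neq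 0\}})$; the condition is void if $a(f)=0$).
   Context: $L^2_s(\mathbb{R}_+^2)$ denotes the set of real-valued square-integrable functions $f$ on $\mathbb{R}_+^2$ with $f(x,y)=f(y,x)$ a.e. For $f\in L^2_s(\mathbb{R}_+^2)$, $T_f:L^2(\mathbb{R}_+)\to L^2(\mathbb{R}_+)$, $g\mapsto\int_0^\infty f(\cdot,y)g(y)\,dy$, is the associated self-adjoint Hilbert–Schmidt operator; $\mathrm{rank}(f)$ is the rank of $T_f$; $E(f)$ is the set of distinct non-zero eigenvalues of $T_f$; and $a(f)$ is the cardinality of $E(f)$. $W=(W_t)_{t\ge0}$ is a standard Brownian motion on a probability space $(\Omega,\mathcal{F},P)$. For $f\in L^2_s(\mathbb{R}_+^2)$, $I_2^W(f)$ is the double Wiener–Itô integral of $f$: the unique continuous linear map $L^2_s(\mathbb{R}_+^2)\to L^2(\Omega)$ with $I_2^W(h\otimes h)=\left(\int_0^\infty h\,dW\right)^2-\int_0^\infty h^2(t)\,dt$ for $h\in L^2(\mathbb{R}_+)$, where $(h\otimes h)(x,y)=h(x)h(y)$; it satisfies $E[I_2^W(f)^2]=2\|f\|^2_{L^2(\mathbb{R}_+^2)}$. $\kappa_r(X)$ denotes the $r$th cumulant of a random variable $X$. $\mathcal{N}(0,0)$ is the Dirac mass at $0$; an empty product equals $1$. $N$ may live on an enlargement of the probability space. *)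

theory Defs
  imports "HOL-Probability.Probability" "HOL-Computational_Algebra.Polynomial"
    "HOL-Library.Extended_Nat"
begin

section \<open>Square-integrable functions\<close>

text \<open>Elements of $L^2$ are represented by functions rather than by classes of functions:
  all notions below identify functions that agree almost everywhere.\<close>

definition L2 :: "'a measure \<Rightarrow> ('a \<Rightarrow> real) set" where
  "L2 M = {f \<in> borel_measurable M. integrable M (\<lambda>x. (f x)\<^sup>2)}"

definition L2_norm :: "'a measure \<Rightarrow> ('a \<Rightarrow> real) \<Rightarrow> real" where
  "L2_norm M f = sqrt (\<integral>x. (f x)\<^sup>2 \<partial>M)"

definition Rplus :: "real measure" where
  "Rplus = restrict_space lborel {0..}"

abbreviation Rplus2 :: "(real \<times> real) measure" where
  "Rplus2 \<equiv> Rplus \<Otimes>\<^sub>M Rplus"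

definition L2_sym :: "(real \<times> real \<Rightarrow> real) set" where
  "L2_sym = {f \<in> L2 Rplus2. AE (x, y) in Rplus2. f (x, y) = f (y, x)}"

definition continuous_linear_L2 ::
    "('a \<Rightarrow> real) set \<Rightarrow> 'a measure \<Rightarrow> 'b measure \<Rightarrow> (('a \<Rightarrow> real) \<Rightarrow> 'b \<Rightarrow> real) \<Rightarrow> bool" where
  "continuous_linear_L2 S A B I \<longleftrightarrow>
     (\<forall>f\<in>S. I f \<in> L2 B) \<and>
     (\<forall>f\<in>S. \<forall>g\<in>S. \<forall>a b. AE \<omega> in B. I (\<lambda>x. a * f x + b * g x) \<omega> = a * I f \<omega> + b * I g \<omega>) \<and>
     (\<forall>u f. (\<forall>n. u n \<in> S) \<longrightarrow> f \<in> S \<longrightarrow>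
        (\<lambda>n. L2_norm A (\<lambda>x. u n x - f x)) \<longlonglongrightarrow> 0 \<longrightarrow>
        (\<lambda>n. L2_norm B (\<lambda>\<omega>. I (u n) \<omega> - I f \<omega>)) \<longlonglongrightarrow> 0)"


section \<open>The Hilbert--Schmidt operator of a kernel\<close>

definition HS_op :: "(real \<times> real \<Rightarrow> real) \<Rightarrow> (real \<Rightarrow> real) \<Rightarrow> real \<Rightarrow> real" where
  "HS_op f g x = (\<integral>y. f (x, y) * g y \<partial>Rplus)"

definition lin_indep_AE :: "'a measure \<Rightarrow> nat \<Rightarrow> (nat \<Rightarrow> 'a \<Rightarrow> real) \<Rightarrow> bool" where
  "lin_indep_AE M n g \<longleftrightarrow>
     (\<forall>c. (AE x in M. (\<Sum>i<n. c i * g i x) = 0) \<longrightarrow> (\<forall>i<n. c i = 0))"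

text \<open>The dimension of the range of the operator, as the supremum of the sizes of the
  linearly independent families in it.\<close>

definition kernel_rank :: "(real \<times> real \<Rightarrow> real) \<Rightarrow> enat" where
  "kernel_rank f = Sup {enat n | n. \<exists>g. (\<forall>i<n. g i \<in> L2 Rplus) \<and>
     lin_indep_AE Rplus n (\<lambda>i. HS_op f (g i))}"

definition nonzero_eigenvalues :: "(real \<times> real \<Rightarrow> real) \<Rightarrow> real set" where
  "nonzero_eigenvalues f = {l. l \<noteq> 0 \<and>
     (\<exists>g\<in>L2 Rplus. \<not> (AE x in Rplus. g x = 0) \<and> (AE x in Rplus. HS_op f g x = l * g x))}"


section \<open>Random variables\<close>

text \<open>The normal law with mean \<open>m\<close> and variance \<open>v\<close>; the library's \<open>normal_density\<close> is
  not a probability density for \<open>v = 0\<close>, where the law is a Dirac mass.\<close>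

definition normal_law :: "real \<Rightarrow> real \<Rightarrow> real measure" where
  "normal_law m v =
     (if v = 0 then return borel m else density lborel (normal_density m (sqrt v)))"

text \<open>$\kappa_r(X) = (-i)^r \frac{d^r}{dt^r} \log E[e^{itX}]$ at $t = 0$. This number is real
  when \<open>X\<close> has moments of all orders, and then \<open>Re\<close> only changes its type.\<close>

definition cumulant :: "'a measure \<Rightarrow> ('a \<Rightarrow> real) \<Rightarrow> nat \<Rightarrow> real" where
  "cumulant M X r = Re ((- \<i>) ^ r *
     ((\<lambda>g t. vector_derivative g (at t)) ^^ r) (\<lambda>t. Ln (char (distr M borel X) t)) 0)"

text \<open>Only the values \<open>W t\<close> with \<open>t \<ge> 0\<close> are meaningful.\<close>

definition brownian_motion :: "'a measure \<Rightarrow> (real \<Rightarrow> 'a \<Rightarrow> real) \<Rightarrow> bool" where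
  "brownian_motion M W \<longleftrightarrow>
     prob_space M \<and>
     (\<forall>t\<ge>0. W t \<in> borel_measurable M) \<and>
     (AE \<omega> in M. W 0 \<omega> = 0) \<and>
     (\<forall>s t. 0 \<le> s \<longrightarrow> s < t \<longrightarrow> distr M borel (\<lambda>\<omega>. W t \<omega> - W s \<omega>) = normal_law 0 (t - s)) \<and>
     (\<forall>(n::nat) t. 0 \<le> t 0 \<longrightarrow> mono t \<longrightarrow>
        prob_space.indep_vars M (\<lambda>_. borel) (\<lambda>i \<omega>. W (t (Suc i)) \<omega> - W (t i) \<omega>) {..<n}) \<and>
     (AE \<omega> in M. continuous_on {0..} (\<lambda>t. W t \<omega>))"

text \<open>Independence of a real random variable from a process indexed by \<open>{0..}\<close>, i.e. from the
  sigma-algebra generated by the whole process. (The library's \<open>indep_var\<close> requires two random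
  variables with values in the same type.)\<close>

definition indep_of_process :: "'a measure \<Rightarrow> ('a \<Rightarrow> real) \<Rightarrow> (real \<Rightarrow> 'a \<Rightarrow> real) \<Rightarrow> bool" where
  "indep_of_process M X W \<longleftrightarrow>
     prob_space.indep_set M
       (sets (vimage_algebra (space M) X borel))
       (sets (vimage_algebra (space M) (\<lambda>\<omega>. \<lambda>t\<in>{0..}. W t \<omega>) (\<Pi>\<^sub>M t\<in>{0..}. borel)))"


section \<open>Wiener integrals\<close>

text \<open>The maps chosen below are unique only up to almost sure equality of their values, hence
  \<open>SOME\<close> instead of \<open>THE\<close>. The first one, $h \mapsto \int_0^\infty h\,dW$, is the continuous linear
  extension of $1_{[0,t]} \mapsto W_t$.\<close>

definition wiener_integral :: "'a measure \<Rightarrow> (real \<Rightarrow> 'a \<Rightarrow> real) \<Rightarrow> (real \<Rightarrow> real) \<Rightarrow> 'a \<Rightarrow> real" where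
  "wiener_integral M W = (SOME J. continuous_linear_L2 (L2 Rplus) Rplus M J \<and>
     (\<forall>t\<ge>0. AE \<omega> in M. J (indicator {0..t}) \<omega> = W t \<omega>))"

definition double_wiener_integral ::
    "'a measure \<Rightarrow> (real \<Rightarrow> 'a \<Rightarrow> real) \<Rightarrow> (real \<times> real \<Rightarrow> real) \<Rightarrow> 'a \<Rightarrow> real" where
  "double_wiener_integral M W = (SOME I. continuous_linear_L2 L2_sym Rplus2 M I \<and>
     (\<forall>h\<in>L2 Rplus. AE \<omega> in M.
        I (\<lambda>(x, y). h x * h y) \<omega> = (wiener_integral M W h \<omega>)\<^sup>2 - (\<integral>t. (h t)\<^sup>2 \<partial>Rplus)))"


section \<open>The polynomial of the criterion\<close>

definition Q_poly :: "(real \<times> real \<Rightarrow> real) \<Rightarrow> real \<Rightarrow> real poly" where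
  "Q_poly f \<mu>\<^sub>0 = [:0, 1:] ^ (2 * (1 + of_bool (\<mu>\<^sub>0 \<noteq> 0))) *
     (\<Prod>l\<in>nonzero_eigenvalues f. [:- l, 1:]\<^sup>2)"

end

theory Submission
  imports Defs
begin

text \<open>A symmetric kernel of finite rank is \<open>f = \<Sum> l\<^sub>i u\<^sub>i \<otimes> u\<^sub>i\<close> with \<open>u\<^sub>i\<close> orthonormal, so its double
  integral is \<open>\<Sum> l\<^sub>i (\<xi>\<^sub>i\<^sup>2 - 1)\<close> with independent standard normal \<open>\<xi>\<^sub>i\<close>. Its characteristic function
  is an explicit product, and its cumulants are, up to constants, the power sums \<open>p\<^sub>r = \<Sum> l\<^sub>i\<^sup>r\<close>. An
  arbitrary kernel is approximated by kernels of finite rank, so that everything is about power sums.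

  If the characteristic functions converge, then \<open>|\<phi>(1)|\<^sup>-\<^sup>4 = \<Prod> (1 + 4 l\<^sub>i\<^sup>2)\<close> bounds \<open>p\<^sub>2\<close>; the logarithms
  are then power series with uniformly bounded coefficients near \<open>0\<close>, and their coefficients converge.
  Conversely, (ii-a) and (ii-b) say that \<open>\<Sum> Q(l\<^sub>i) \<longrightarrow> 0\<close>. As \<open>Q\<close> is the square of
  \<open>x\<^sup>e \<Prod> (x - \<lambda>)\<close>, the Cauchy--Schwarz inequality turns this into an asymptotic linear recurrence for
  the power sums, so that (ii-c) forces all of them to converge. The measures
  \<open>\<Sum> l\<^sub>i\<^sup>2 \<delta>\<close>, with point masses at the \<open>l\<^sub>i\<close>, therefore converge weakly, and the logarithms of the
  characteristic functions are integrals of fixed continuous functions against them.\<close>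

section \<open>Square-integrable functions\<close>

text \<open>It is replaced by a finite list that matches its characteristic function at t up to
  \<open>\<bar>t\<bar> / (n + 1)\<close> and its cumulants of orders 2 to n up to
  \<open>1 / (n + 1)\<close>. Convergence in law and convergence of each cumulant are both
  insensitive to this change.

  The factor of \<open>Q\<close> at 0 decides how (ii-a) enters. Without Gaussian part it is
  \<open>x\<^sup>2\<close>, and the term of order 2 missing from (ii-b) is supplied by (ii-a). With
  Gaussian part it is \<open>x ^ 4\<close>: the variance of \<open>N\<close> shifts the limit of the
  second power sum and of no other, and that power sum no longer occurs.

  Both integrals are arbitrary choices among almost surely equal maps. All that is known of them is
  linearity, continuity and the values on generators, so isometry, normality and independence have
  to be transported from generators by L2 limits. The squares of several Wiener integrals are
  handled through their joint characteristic function, which is why Kac's theorem appears.\<close>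

definition L2_inner :: "'a measure \<Rightarrow> ('a \<Rightarrow> real) \<Rightarrow> ('a \<Rightarrow> real) \<Rightarrow> real" where
  "L2_inner M f g = (\<integral>x. f x * g x \<partial>M)"

lemma L2_measurable [measurable_dest]: "f \<in> L2 M \<Longrightarrow> f \<in> borel_measurable M"
  by (simp add: L2_def)

lemma L2_integrable_square: "f \<in> L2 M \<Longrightarrow> integrable M (\<lambda>x. (f x)\<^sup>2)"
  by (simp add: L2_def)

lemma L2I: "f \<in> borel_measurable M \<Longrightarrow> integrable M (\<lambda>x. (f x)\<^sup>2) \<Longrightarrow> f \<in> L2 M"
  by (simp add: L2_def)

lemma L2_integrable_mult:
  assumes "f \<in> L2 M" "g \<in> L2 M"
  shows "integrable M (\<lambda>x. f x * g x)"
proof (rule Bochner_Integration.integrable_bound)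
  show "integrable M (\<lambda>x. (f x)\<^sup>2 + (g x)\<^sup>2)"
    using assms by (intro Bochner_Integration.integrable_add L2_integrable_square)
  show "(\<lambda>x. f x * g x) \<in> borel_measurable M"
    using assms[THEN L2_measurable] by measurable
  show "AE x in M. norm (f x * g x) \<le> norm ((f x)\<^sup>2 + (g x)\<^sup>2)"
  proof (rule AE_I2)
    fix x
    have "2 * (\<bar>f x\<bar> * \<bar>g x\<bar>) \<le> (f x)\<^sup>2 + (g x)\<^sup>2"
      using sum_squares_bound[of "\<bar>f x\<bar>" "\<bar>g x\<bar>"] by simp
    moreover have "0 \<le> \<bar>f x\<bar> * \<bar>g x\<bar>" by simp
    ultimately show "norm (f x * g x) \<le> norm ((f x)\<^sup>2 + (g x)\<^sup>2)"
      unfolding real_norm_def abs_mult by linarith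
  qed
qed

lemma L2_lincomb:
  assumes "f \<in> L2 M" "g \<in> L2 M"
  shows "(\<lambda>x. a * f x + b * g x) \<in> L2 M"
proof (rule L2I)
  show "(\<lambda>x. a * f x + b * g x) \<in> borel_measurable M"
    using assms[THEN L2_measurable] by measurable
  have "integrable M (\<lambda>x. a\<^sup>2 * (f x)\<^sup>2 + b\<^sup>2 * (g x)\<^sup>2 + 2 * a * b * (f x * g x))"
    using assms L2_integrable_mult[OF assms] by (intro Bochner_Integration.integrable_add integrable_mult_right L2_integrable_square)
  then show "integrable M (\<lambda>x. (a * f x + b * g x)\<^sup>2)"
    by (simp add: power2_eq_square algebra_simps)
qed

lemma L2_zero [simp]: "(\<lambda>x. 0) \<in> L2 M"
  by (simp add: L2_def)

lemma L2_add: "f \<in> L2 M \<Longrightarrow> g \<in> L2 M \<Longrightarrow> (\<lambda>x. f x + g x) \<in> L2 M"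
  using L2_lincomb[of f M g 1 1] by simp

lemma L2_diff: "f \<in> L2 M \<Longrightarrow> g \<in> L2 M \<Longrightarrow> (\<lambda>x. f x - g x) \<in> L2 M"
  using L2_lincomb[of f M g 1 "-1"] by simp

lemma L2_scale: "f \<in> L2 M \<Longrightarrow> (\<lambda>x. c * f x) \<in> L2 M"
  using L2_lincomb[of f M f c 0] by simp

lemma L2_sum: "(\<And>i. i \<in> I \<Longrightarrow> f i \<in> L2 M) \<Longrightarrow> (\<lambda>x. \<Sum>i\<in>I. f i x) \<in> L2 M"
  by (induction I rule: infinite_finite_induct) (auto intro: L2_add)

lemma L2_inner_commute: "L2_inner M f g = L2_inner M g f"
  by (simp add: L2_inner_def mult.commute)

lemma L2_inner_lincomb_left:
  assumes "f \<in> L2 M" "g \<in> L2 M" "h \<in> L2 M"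
  shows "L2_inner M (\<lambda>x. a * f x + b * g x) h = a * L2_inner M f h + b * L2_inner M g h"
proof -
  have "L2_inner M (\<lambda>x. a * f x + b * g x) h = (\<integral>x. a * (f x * h x) + b * (g x * h x) \<partial>M)"
    by (simp add: L2_inner_def algebra_simps)
  also have "\<dots> = a * L2_inner M f h + b * L2_inner M g h"
    using L2_integrable_mult[OF assms(1,3)] L2_integrable_mult[OF assms(2,3)]
    by (simp add: L2_inner_def)
  finally show ?thesis .
qed

lemma L2_inner_lincomb_right:
  assumes "f \<in> L2 M" "g \<in> L2 M" "h \<in> L2 M"
  shows "L2_inner M h (\<lambda>x. a * f x + b * g x) = a * L2_inner M h f + b * L2_inner M h g"
  using L2_inner_lincomb_left[OF assms] by (simp add: L2_inner_commute)

lemma L2_inner_sum_left: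
  assumes "\<And>i. i \<in> I \<Longrightarrow> f i \<in> L2 M" "h \<in> L2 M"
  shows "L2_inner M (\<lambda>x. \<Sum>i\<in>I. c i * f i x) h = (\<Sum>i\<in>I. c i * L2_inner M (f i) h)"
  using assms(1)
proof (induction I rule: infinite_finite_induct)
  case (insert i I)
  have "(\<lambda>x. \<Sum>i\<in>I. c i * f i x) \<in> L2 M" using insert by (intro L2_sum L2_scale) auto
  then show ?case
    using L2_inner_lincomb_left[of "f i" M "\<lambda>x. \<Sum>i\<in>I. c i * f i x" h "c i" 1] insert assms(2)
    by simp
qed (simp_all add: L2_inner_def)

lemma L2_inner_sum_right:
  assumes "\<And>i. i \<in> I \<Longrightarrow> f i \<in> L2 M" "h \<in> L2 M"
  shows "L2_inner M h (\<lambda>x. \<Sum>i\<in>I. c i * f i x) = (\<Sum>i\<in>I. c i * L2_inner M h (f i))"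
  using L2_inner_sum_left[OF assms] by (simp add: L2_inner_commute)

lemma L2_norm_nonneg [simp]: "0 \<le> L2_norm M f"
  by (simp add: L2_norm_def)

lemma L2_norm_sq: "(L2_norm M f)\<^sup>2 = L2_inner M f f"
  by (simp add: L2_norm_def L2_inner_def power2_eq_square)

lemma L2_norm_eq_sqrt_inner: "L2_norm M f = sqrt (L2_inner M f f)"
  by (simp add: L2_norm_def L2_inner_def power2_eq_square)

lemma L2_norm_zero [simp]: "L2_norm M (\<lambda>x. 0) = 0"
  by (simp add: L2_norm_def)

lemma L2_norm_scale: "L2_norm M (\<lambda>x. c * f x) = \<bar>c\<bar> * L2_norm M f"
  by (simp add: L2_norm_def power_mult_distrib real_sqrt_mult)

lemma L2_norm_minus_commute: "L2_norm M (\<lambda>x. f x - g x) = L2_norm M (\<lambda>x. g x - f x)"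
  by (simp add: L2_norm_def power2_commute)

lemma L2_norm_sq_lincomb:
  assumes "f \<in> L2 M" "g \<in> L2 M"
  shows "(L2_norm M (\<lambda>x. a * f x + b * g x))\<^sup>2 =
    a\<^sup>2 * (L2_norm M f)\<^sup>2 + 2 * a * b * L2_inner M f g + b\<^sup>2 * (L2_norm M g)\<^sup>2"
  unfolding L2_norm_sq using assms L2_lincomb[OF assms]
  by (simp add: L2_inner_lincomb_left L2_inner_lincomb_right L2_inner_commute[of M g f]
      power2_eq_square algebra_simps)

lemma L2_inner_cong_AE:
  assumes "f \<in> borel_measurable M" "f' \<in> borel_measurable M"
    "g \<in> borel_measurable M" "g' \<in> borel_measurable M"
    "AE x in M. f x = f' x" "AE x in M. g x = g' x"
  shows "L2_inner M f g = L2_inner M f' g'"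
  unfolding L2_inner_def using assms(1-4)
  by (intro integral_cong_AE) (use assms in auto)

lemma L2_norm_cong_AE:
  assumes "f \<in> borel_measurable M" "g \<in> borel_measurable M" "AE x in M. f x = g x"
  shows "L2_norm M f = L2_norm M g"
  unfolding L2_norm_eq_sqrt_inner using assms by (subst L2_inner_cong_AE[of f M g f g]) auto

lemma L2_norm_eq_0_iff:
  assumes "f \<in> L2 M"
  shows "L2_norm M f = 0 \<longleftrightarrow> (AE x in M. f x = 0)"
  using integral_nonneg_eq_0_iff_AE[OF L2_integrable_square[OF assms]] by (simp add: L2_norm_def)

lemma L2_Cauchy_Schwarz:
  assumes "f \<in> L2 M" "g \<in> L2 M"
  shows "\<bar>L2_inner M f g\<bar> \<le> L2_norm M f * L2_norm M g"
proof -
  let ?a = "(L2_norm M f)\<^sup>2" and ?b = "L2_inner M f g" and ?c = "(L2_norm M g)\<^sup>2"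
  have 1: "0 \<le> a\<^sup>2 * ?a + 2 * a * b * ?b + b\<^sup>2 * ?c" for a b
    using L2_norm_sq_lincomb[OF assms, of a b] by (metis zero_le_power2)
  have "?b\<^sup>2 \<le> ?a * ?c"
  proof (cases "?c = 0")
    case True
    have "?b = 0"
    proof (rule ccontr)
      assume "?b \<noteq> 0"
      \<comment> \<open>With \<open>?c = 0\<close> the quadratic form is affine in \<open>b\<close>;
        this \<open>b\<close> gives it the value -1.\<close>
      have "0 \<le> ?a + 2 * (- (?a + 1) / (2 * ?b)) * ?b"
        using 1[of 1 "- (?a + 1) / (2 * ?b)"] True by simp
      then show False using \<open>?b \<noteq> 0\<close> by (simp add: field_simps)
    qed
    then show ?thesis by simp
  next
    case False
    then have "0 < ?c" by (simp add: zero_less_power2)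
    \<comment> \<open>At the pair (\<open>?c\<close>, \<open>- ?b\<close>) the form is
      \<open>?c\<close> times the defect of the inequality.\<close>
    have "0 \<le> ?c * (?c * ?a - ?b\<^sup>2)"
      using 1[of ?c "- ?b"] by (simp add: power2_eq_square algebra_simps)
    then have "0 \<le> ?c * ?a - ?b\<^sup>2" using \<open>0 < ?c\<close> by (simp add: zero_le_mult_iff)
    then show ?thesis by (simp add: mult.commute)
  qed
  then have "\<bar>?b\<bar>\<^sup>2 \<le> (L2_norm M f * L2_norm M g)\<^sup>2" by (simp add: power_mult_distrib)
  then show ?thesis by (rule power2_le_imp_le) simp
qed

lemma L2_norm_triangle:
  assumes "f \<in> L2 M" "g \<in> L2 M"
  shows "L2_norm M (\<lambda>x. f x + g x) \<le> L2_norm M f + L2_norm M g"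
proof (rule power2_le_imp_le)
  show "(L2_norm M (\<lambda>x. f x + g x))\<^sup>2 \<le> (L2_norm M f + L2_norm M g)\<^sup>2"
    using L2_norm_sq_lincomb[OF assms, of 1 1] L2_Cauchy_Schwarz[OF assms]
    by (simp add: power2_sum) 
qed simp

lemma L2_norm_triangle_diff:
  assumes "f \<in> L2 M" "g \<in> L2 M" "h \<in> L2 M"
  shows "L2_norm M (\<lambda>x. f x - h x) \<le> L2_norm M (\<lambda>x. f x - g x) + L2_norm M (\<lambda>x. g x - h x)"
  using L2_norm_triangle[OF L2_diff[OF assms(1,2)] L2_diff[OF assms(2,3)]] by simp

lemma L2_norm_lincomb_le:
  assumes "f \<in> L2 M" "g \<in> L2 M"
  shows "L2_norm M (\<lambda>x. a * f x + b * g x) \<le> \<bar>a\<bar> * L2_norm M f + \<bar>b\<bar> * L2_norm M g"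
  using L2_norm_triangle[OF L2_scale[OF assms(1), of a] L2_scale[OF assms(2), of b]]
  by (simp add: L2_norm_scale)

lemma L2_norm_diff_le:
  assumes "f \<in> L2 M" "g \<in> L2 M"
  shows "\<bar>L2_norm M f - L2_norm M g\<bar> \<le> L2_norm M (\<lambda>x. f x - g x)"
  using L2_norm_triangle_diff[OF assms L2_zero] L2_norm_triangle_diff[OF assms(2,1) L2_zero]
  by (simp add: L2_norm_minus_commute[of M g f])

lemma L2_norm_dominated_limit:
  assumes "f \<in> borel_measurable M" "\<And>n. u n \<in> borel_measurable M" "w \<in> L2 M"
    and "AE x in M. (\<lambda>n. u n x) \<longlonglongrightarrow> f x"
    and "\<And>n. AE x in M. \<bar>u n x - f x\<bar> \<le> w x"
  shows "(\<lambda>n. L2_norm M (\<lambda>x. u n x - f x)) \<longlonglongrightarrow> 0"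
proof -
  have "(\<lambda>n. \<integral>x. (u n x - f x)\<^sup>2 \<partial>M) \<longlonglongrightarrow> (\<integral>x. 0 \<partial>M)"
  proof (rule integral_dominated_convergence[where w = "\<lambda>x. (w x)\<^sup>2"])
    show "(\<lambda>x. (u i x - f x)\<^sup>2) \<in> borel_measurable M" for i using assms(1,2) by measurable
    show "integrable M (\<lambda>x. (w x)\<^sup>2)" using assms(3) by (rule L2_integrable_square)
    show "AE x in M. (\<lambda>i. (u i x - f x)\<^sup>2) \<longlonglongrightarrow> 0" using assms(4)
    proof eventually_elim
      case (elim x)
      have "(\<lambda>i. (u i x - f x)\<^sup>2) \<longlonglongrightarrow> (f x - f x)\<^sup>2" by (intro tendsto_intros elim)
      then show ?case by simp
    qed
    show "AE x in M. norm ((u i x - f x)\<^sup>2) \<le> (w x)\<^sup>2" for i using assms(5)[of i]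
    proof eventually_elim
      case (elim x)
      then show ?case using power_mono[of "\<bar>u i x - f x\<bar>" "w x" 2] by simp
    qed
  qed simp
  then have "(\<lambda>n. sqrt (\<integral>x. (u n x - f x)\<^sup>2 \<partial>M)) \<longlonglongrightarrow> sqrt 0"
    by (intro tendsto_real_sqrt) simp
  then show ?thesis by (simp add: L2_norm_def)
qed

text \<open>Riesz--Fischer, for sequences that converge fast enough: the pointwise sum of the increments
  dominates the sequence.\<close>

lemma L2_complete_fast:
  assumes u: "\<And>n. u n \<in> L2 M" and fast: "\<And>n. L2_norm M (\<lambda>x. u (Suc n) x - u n x) \<le> (1/2) ^ n"
  shows "\<exists>f\<in>L2 M. (\<lambda>n. L2_norm M (\<lambda>x. u n x - f x)) \<longlonglongrightarrow> 0"
proof -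
  have um [measurable]: "u n \<in> borel_measurable M" for n using u by (rule L2_measurable)
  define d where "d k x = \<bar>u (Suc k) x - u k x\<bar>" for k x
  define s where "s n x = (\<Sum>k<n. d k x)" for n x
  have dm [measurable]: "d k \<in> borel_measurable M" for k unfolding d_def by measurable
  have dL: "d k \<in> L2 M" for k
    using L2_diff[OF u u] by (auto simp: L2_def d_def)
  have dn: "L2_norm M (d k) \<le> (1/2)^k" for k
    using fast[of k] by (simp add: L2_norm_def d_def)
  have sL: "s n \<in> L2 M" for n unfolding s_def using dL by (intro L2_sum)
  have sm [measurable]: "s n \<in> borel_measurable M" for n using sL by (rule L2_measurable)
  have sn: "L2_norm M (s n) \<le> (\<Sum>k<n. (1/2)^k)" for n
  proof (induction n)
    case 0 then show ?case by (simp add: s_def)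
  next
    case (Suc n)
    have "s (Suc n) = (\<lambda>x. s n x + d n x)" by (simp add: s_def fun_eq_iff)
    then have "L2_norm M (s (Suc n)) \<le> L2_norm M (s n) + L2_norm M (d n)"
      using L2_norm_triangle[OF sL dL, of n n] by simp
    then show ?case using Suc dn[of n] by simp
  qed
  have sn2: "L2_norm M (s n) \<le> 2" for n
  proof -
    have "(\<Sum>k<n. (1/2::real)^k) \<le> 2"
      by (subst geometric_sum) (simp_all add: field_simps)
    then show ?thesis using sn[of n] by linarith
  qed
  have "(\<integral>\<^sup>+x. ennreal ((s n x)\<^sup>2) \<partial>M) \<le> 4" for n
  proof -
    have "(\<integral>\<^sup>+x. ennreal ((s n x)\<^sup>2) \<partial>M) = ennreal (\<integral>x. (s n x)\<^sup>2 \<partial>M)"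
      by (rule nn_integral_eq_integral[OF L2_integrable_square[OF sL]]) simp
    also have "(\<integral>x. (s n x)\<^sup>2 \<partial>M) = (L2_norm M (s n))\<^sup>2" by (simp add: L2_norm_def)
    also have "\<dots> \<le> 2\<^sup>2" using sn2 by (intro power_mono) auto
    finally show ?thesis by (simp add: ennreal_leI)
  qed
  moreover have "(\<integral>\<^sup>+x. (SUP n. ennreal ((s n x)\<^sup>2)) \<partial>M) = (SUP n. (\<integral>\<^sup>+x. ennreal ((s n x)\<^sup>2) \<partial>M))"
  proof (rule nn_integral_monotone_convergence_SUP)
    show "incseq (\<lambda>n x. ennreal ((s n x)\<^sup>2))"
    proof (rule incseq_SucI, rule le_funI, rule ennreal_leI, rule power_mono)
      show "s n x \<le> s (Suc n) x" for n x by (simp add: s_def d_def)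
      show "0 \<le> s n x" for n x by (simp add: s_def d_def sum_nonneg)
    qed
  qed measurable
  ultimately have fin: "(\<integral>\<^sup>+x. (SUP n. ennreal ((s n x)\<^sup>2)) \<partial>M) \<le> 4"
    by (simp add: SUP_le_iff)
  then have "(\<integral>\<^sup>+x. (SUP n. ennreal ((s n x)\<^sup>2)) \<partial>M) \<noteq> \<infinity>" 
    using order.strict_trans1[OF fin, of top] by auto
  then have AEfin: "AE x in M. (SUP n. ennreal ((s n x)\<^sup>2)) \<noteq> \<infinity>"
    by (intro nn_integral_PInf_AE) measurable
  \<comment> \<open>The absolute value makes \<open>w\<close> nonnegative also on the null set where
    the series diverges; elsewhere it changes nothing.\<close>
  define w where "w x = \<bar>\<Sum>k. d k x\<bar>" for x
  have summ: "AE x in M. summable (\<lambda>k. d k x)"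
    using AEfin
  proof eventually_elim
    case (elim x)
    then obtain b where b: "0 \<le> b" "(SUP n. ennreal ((s n x)\<^sup>2)) = ennreal b"
      by (metis ennreal_cases infinity_ennreal_def)
    show ?case
    proof (rule summableI_nonneg_bounded)
      show "0 \<le> d k x" for k by (simp add: d_def)
      show "(\<Sum>k<n. d k x) \<le> sqrt b" for n
      proof -
        have "ennreal ((s n x)\<^sup>2) \<le> ennreal b" unfolding b(2)[symmetric] by (rule SUP_upper) simp
        then have "(s n x)\<^sup>2 \<le> b" using b(1) by simp
        then show ?thesis unfolding s_def by (rule real_le_rsqrt)
      qed
    qed
  qed
  have wm [measurable]: "w \<in> borel_measurable M" unfolding w_def by measurable
  have w0: "0 \<le> w x" for x by (simp add: w_def)
  have w_eq: "w x = (\<Sum>k. d k x)" if "summable (\<lambda>k. d k x)" for x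
    unfolding w_def by (rule abs_of_nonneg, rule suminf_nonneg[OF that]) (simp add: d_def)
  have lim_s: "(\<lambda>n. s n x) \<longlonglongrightarrow> w x" if "summable (\<lambda>k. d k x)" for x
    using summable_LIMSEQ[OF that] unfolding w_eq[OF that] s_def .
  have wL: "w \<in> L2 M"
  proof (rule L2I[OF wm], rule integrableI_bounded)
    have "(\<integral>\<^sup>+x. ennreal (norm ((w x)\<^sup>2)) \<partial>M) \<le> (\<integral>\<^sup>+x. (SUP n. ennreal ((s n x)\<^sup>2)) \<partial>M)"
    proof (rule nn_integral_mono_AE, use summ in eventually_elim)
      case (elim x)
      have "(\<lambda>n. ennreal ((s n x)\<^sup>2)) \<longlonglongrightarrow> ennreal ((w x)\<^sup>2)"
        by (intro tendsto_intros lim_s elim)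
      then have "ennreal ((w x)\<^sup>2) \<le> (SUP n. ennreal ((s n x)\<^sup>2))"
      proof (rule LIMSEQ_le_const2)
        have up: "ennreal ((s n x)\<^sup>2) \<le> (SUP n. ennreal ((s n x)\<^sup>2))" for n
          by (rule SUP_upper) (rule UNIV_I)
        show "\<exists>N. \<forall>n\<ge>N. ennreal ((s n x)\<^sup>2) \<le> (SUP n. ennreal ((s n x)\<^sup>2))"
          by (rule exI[of _ 0], rule allI, rule impI, rule up)
      qed
      then show ?case unfolding real_norm_def abs_power2 .
    qed
    also have "\<dots> < \<infinity>" using order.strict_trans1[OF fin, of top] by simp
    finally show "(\<integral>\<^sup>+x. ennreal (norm ((w x)\<^sup>2)) \<partial>M) < \<infinity>" .
  qed measurable
  define f where "f x = lim (\<lambda>n. u n x)" for x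
  have fm [measurable]: "f \<in> borel_measurable M" unfolding f_def by measurable
  have tele: "u n x = u 0 x + (\<Sum>k<n. u (Suc k) x - u k x)" for n x
    using sum_lessThan_telescope[of "\<lambda>k. u k x" n] by simp
  have conv: "(\<lambda>n. u n x) \<longlonglongrightarrow> f x" if "summable (\<lambda>k. d k x)" for x
  proof -
    have "summable (\<lambda>k. u (Suc k) x - u k x)"
      using that unfolding d_def by (rule summable_rabs_cancel)
    then have "convergent (\<lambda>n. \<Sum>k<n. u (Suc k) x - u k x)"
      by (simp add: summable_iff_convergent)
    then have "convergent (\<lambda>n. u 0 x + (\<Sum>k<n. u (Suc k) x - u k x))"
      using convergent_add convergent_const by blast
    then have "convergent (\<lambda>n. u n x)" unfolding tele[symmetric] .
    then show ?thesis by (simp add: f_def convergent_LIMSEQ_iff)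
  qed
  have bnd: "\<bar>u n x - f x\<bar> \<le> w x" if sx: "summable (\<lambda>k. d k x)" for n x
  proof (rule LIMSEQ_le_const2)
    show "(\<lambda>m. \<bar>u n x - u m x\<bar>) \<longlonglongrightarrow> \<bar>u n x - f x\<bar>"
      by (intro tendsto_intros conv[OF sx])
    have "\<bar>u n x - u m x\<bar> \<le> w x" if "n \<le> m" for m
    proof -
      have "u m x - u n x = (\<Sum>k=n..<m. u (Suc k) x - u k x)"
        using that by (rule sum_Suc_diff'[symmetric])
      then have "\<bar>u n x - u m x\<bar> \<le> (\<Sum>k=n..<m. d k x)"
        unfolding d_def by (metis abs_minus_commute sum_abs)
      also have "\<dots> \<le> (\<Sum>k<m. d k x)" by (intro sum_mono2) (auto simp: d_def)
      also have "\<dots> \<le> w x" using sum_le_suminf[OF sx, of "{..<m}"] w_eq[OF sx] by (simp add: d_def)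
      finally show ?thesis .
    qed
    then show "\<exists>N. \<forall>m\<ge>N. \<bar>u n x - u m x\<bar> \<le> w x" by blast
  qed
  have lim: "(\<lambda>n. L2_norm M (\<lambda>x. u n x - f x)) \<longlonglongrightarrow> 0"
  proof (rule L2_norm_dominated_limit[OF fm um wL])
    show "AE x in M. (\<lambda>n. u n x) \<longlonglongrightarrow> f x" using summ by eventually_elim (rule conv)
    show "AE x in M. \<bar>u n x - f x\<bar> \<le> w x" for n using summ by eventually_elim (rule bnd)
  qed
  have "(\<lambda>x. f x - u 0 x) \<in> L2 M"
  proof (rule L2I)
    show "integrable M (\<lambda>x. (f x - u 0 x)\<^sup>2)"
    proof (rule Bochner_Integration.integrable_bound[OF L2_integrable_square[OF wL]])
      show "AE x in M. norm ((f x - u 0 x)\<^sup>2) \<le> norm ((w x)\<^sup>2)" using summ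
      proof eventually_elim
        case (elim x)
        have "\<bar>f x - u 0 x\<bar> \<le> \<bar>w x\<bar>" using bnd[OF elim, of 0] w0[of x] by linarith
        then show ?case by (simp add: abs_le_square_iff)
      qed
    qed measurable
  qed measurable
  from L2_add[OF this u[of 0]] have "f \<in> L2 M" by simp
  with lim show ?thesis by blast
qed

section \<open>Isometric extension of a linear map\<close>

text \<open>Lists may repeat a generator, so combinations of combinations arise by scaling and
  appending; neither a canonical form nor independence of the generators is involved.\<close>

definition lincomb :: "('t \<Rightarrow> 'a \<Rightarrow> real) \<Rightarrow> (real \<times> 't) list \<Rightarrow> 'a \<Rightarrow> real" where
  "lincomb \<phi> xs x = (\<Sum>(c, t)\<leftarrow>xs. c * \<phi> t x)"

lemma lincomb_Nil [simp]: "lincomb \<phi> [] = (\<lambda>x. 0)"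
  by (simp add: lincomb_def fun_eq_iff)

text \<open>The factor 1 gives the right-hand side the shape \<open>a * f x + b * g x\<close> in
  which linearity is stated everywhere.\<close>

lemma lincomb_Cons: "lincomb \<phi> ((c, t) # xs) = (\<lambda>x. c * \<phi> t x + 1 * lincomb \<phi> xs x)"
  by (simp add: lincomb_def fun_eq_iff)

lemma lincomb_append: "lincomb \<phi> (xs @ ys) x = lincomb \<phi> xs x + lincomb \<phi> ys x"
  by (simp add: lincomb_def)

lemma lincomb_scale: "lincomb \<phi> (map (\<lambda>(c, t). (a * c, t)) xs) x = a * lincomb \<phi> xs x"
  by (induction xs) (auto simp: lincomb_def algebra_simps)

lemma lincomb_combine:
  "lincomb \<phi> (map (\<lambda>(c, t). (a * c, t)) xs @ map (\<lambda>(c, t). (b * c, t)) ys) =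
    (\<lambda>x. a * lincomb \<phi> xs x + b * lincomb \<phi> ys x)"
  by (simp add: lincomb_append lincomb_scale fun_eq_iff)

lemma lincomb_L2:
  assumes "snd ` set xs \<subseteq> T" "\<And>t. t \<in> T \<Longrightarrow> \<phi> t \<in> L2 M"
  shows "lincomb \<phi> xs \<in> L2 M"
  using assms(1) by (induction xs) (auto simp: lincomb_Cons assms(2) intro!: L2_add L2_scale)

lemma L2_inner_lincomb_image:
  assumes "\<And>t. t \<in> T \<Longrightarrow> \<phi> t \<in> L2 A" "\<And>t. t \<in> T \<Longrightarrow> \<psi> t \<in> L2 B"
    and "\<And>s t. s \<in> T \<Longrightarrow> t \<in> T \<Longrightarrow> L2_inner B (\<psi> s) (\<psi> t) = C * L2_inner A (\<phi> s) (\<phi> t)"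
    and "snd ` set xs \<subseteq> T" "snd ` set ys \<subseteq> T"
  shows "L2_inner B (lincomb \<psi> xs) (lincomb \<psi> ys) = C * L2_inner A (lincomb \<phi> xs) (lincomb \<phi> ys)"
proof -
  have 1: "L2_inner B (\<psi> s) (lincomb \<psi> ys) = C * L2_inner A (\<phi> s) (lincomb \<phi> ys)" if "s \<in> T" for s
    using assms(5)
  proof (induction ys)
    case Nil then show ?case by (simp add: L2_inner_def)
  next
    case (Cons y ys)
    obtain c t where y: "y = (c, t)" by fastforce
    with Cons have t: "t \<in> T" and ys: "snd ` set ys \<subseteq> T" by auto
    from lincomb_L2[OF ys assms(2)] lincomb_L2[OF ys assms(1)] that t Cons show ?case
      by (simp only: y lincomb_Cons L2_inner_lincomb_right assms(1-3)) (simp add: algebra_simps)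
  qed
  from assms(4) show ?thesis
  proof (induction xs)
    case Nil then show ?case by (simp add: L2_inner_def)
  next
    case (Cons y xs)
    obtain c t where y: "y = (c, t)" by fastforce
    with Cons have t: "t \<in> T" and xs: "snd ` set xs \<subseteq> T" by auto
    from lincomb_L2[OF xs assms(2)] lincomb_L2[OF xs assms(1)]
      lincomb_L2[OF assms(5) assms(2)] lincomb_L2[OF assms(5) assms(1)] t Cons show ?case
      by (simp only: y lincomb_Cons L2_inner_lincomb_left assms(1-3) 1) (simp add: algebra_simps)
  qed
qed

text \<open>The closure of the graph that sends a combination of the \<open>\<phi> t\<close> to the
  same combination of the \<open>\<psi> t\<close>. A relation needs no proof that the image is
  independent of the combination chosen; that it is single-valued up to null sets follows from the
  norm identity \<open>R_norm\<close>.\<close>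

definition graph_closure ::
    "'a measure \<Rightarrow> 'b measure \<Rightarrow> 't set \<Rightarrow> ('t \<Rightarrow> 'a \<Rightarrow> real) \<Rightarrow> ('t \<Rightarrow> 'b \<Rightarrow> real) \<Rightarrow>
      ('a \<Rightarrow> real) \<Rightarrow> ('b \<Rightarrow> real) \<Rightarrow> bool" where
  "graph_closure A B T \<phi> \<psi> f X \<longleftrightarrow> f \<in> L2 A \<and> X \<in> L2 B \<and> (\<forall>\<epsilon>>0. \<exists>xs. snd ` set xs \<subseteq> T \<and>
     L2_norm A (\<lambda>x. lincomb \<phi> xs x - f x) < \<epsilon> \<and> L2_norm B (\<lambda>x. lincomb \<psi> xs x - X x) < \<epsilon>)"

definition dense_span :: "'a measure \<Rightarrow> 't set \<Rightarrow> ('t \<Rightarrow> 'a \<Rightarrow> real) \<Rightarrow> ('a \<Rightarrow> real) set \<Rightarrow> bool" where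
  "dense_span A T \<phi> S \<longleftrightarrow> (\<forall>f\<in>S. \<forall>\<epsilon>>0. \<exists>xs. snd ` set xs \<subseteq> T \<and>
     L2_norm A (\<lambda>x. lincomb \<phi> xs x - f x) < \<epsilon>)"

text \<open>Common form of two constructions: indicators of \<open>{0..t}\<close> go to
  \<open>W t\<close> with \<open>C = 1\<close>, and tensor squares go to centred squares of Wiener
  integrals with \<open>C = 2\<close>. \<open>S\<close> is kept apart from \<open>L2 A\<close>
  because the second one lives on symmetric kernels.\<close>

locale isometric_frame =
  fixes A :: "'a measure" and B :: "'b measure" and T :: "'t set"
    and \<phi> :: "'t \<Rightarrow> 'a \<Rightarrow> real" and \<psi> :: "'t \<Rightarrow> 'b \<Rightarrow> real" and S :: "('a \<Rightarrow> real) set" and C :: real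
  assumes S_L2: "S \<subseteq> L2 A"
    and S_lin: "\<And>f g a b. f \<in> S \<Longrightarrow> g \<in> S \<Longrightarrow> (\<lambda>x. a * f x + b * g x) \<in> S"
    and phi_S: "\<And>t. t \<in> T \<Longrightarrow> \<phi> t \<in> S"
    and psi_L2: "\<And>t. t \<in> T \<Longrightarrow> \<psi> t \<in> L2 B"
    and inner_psi: "\<And>s t. s \<in> T \<Longrightarrow> t \<in> T \<Longrightarrow>
      L2_inner B (\<psi> s) (\<psi> t) = C * L2_inner A (\<phi> s) (\<phi> t)"
    and C_nonneg: "0 \<le> C"
    and dense: "dense_span A T \<phi> S"
begin

abbreviation R where "R \<equiv> graph_closure A B T \<phi> \<psi>"

lemma phi_L2: "t \<in> T \<Longrightarrow> \<phi> t \<in> L2 A"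
  using phi_S S_L2 by auto

lemma lincomb_phi_L2: "snd ` set xs \<subseteq> T \<Longrightarrow> lincomb \<phi> xs \<in> L2 A"
  by (rule lincomb_L2) (auto intro: phi_L2)

lemma lincomb_psi_L2: "snd ` set xs \<subseteq> T \<Longrightarrow> lincomb \<psi> xs \<in> L2 B"
  by (rule lincomb_L2) (auto intro: psi_L2)

lemma norm_lincomb_psi:
  assumes "snd ` set xs \<subseteq> T"
  shows "L2_norm B (lincomb \<psi> xs) = sqrt C * L2_norm A (lincomb \<phi> xs)"
  using L2_inner_lincomb_image[OF phi_L2 psi_L2 inner_psi assms assms]
  by (simp add: L2_norm_eq_sqrt_inner real_sqrt_mult)

lemma norm_lincomb_psi_diff:
  assumes "snd ` set xs \<subseteq> T" "snd ` set ys \<subseteq> T"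
  shows "L2_norm B (\<lambda>x. lincomb \<psi> xs x - lincomb \<psi> ys x) =
    sqrt C * L2_norm A (\<lambda>x. lincomb \<phi> xs x - lincomb \<phi> ys x)"
proof -
  let ?zs = "map (\<lambda>(c, t). (1 * c, t)) xs @ map (\<lambda>(c, t). (- 1 * c, t)) ys"
  have "snd ` set ?zs \<subseteq> T" using assms by force
  from norm_lincomb_psi[OF this] show ?thesis
    unfolding lincomb_combine by simp
qed

lemma R_generator: "t \<in> T \<Longrightarrow> R (\<phi> t) (\<psi> t)"
  unfolding graph_closure_def
  by (auto intro!: phi_L2 psi_L2 exI[of _ "[(1, t)]"] simp: lincomb_def)

lemma R_norm:
  assumes "R f X"
  shows "L2_norm B X = sqrt C * L2_norm A f"
proof -
  from assms have f: "f \<in> L2 A" and X: "X \<in> L2 B" by (auto simp: graph_closure_def)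
  have "\<bar>L2_norm B X - sqrt C * L2_norm A f\<bar> \<le> e" if "e > 0" for e
  proof -
    \<comment> \<open>The error is at most \<open>d\<close> on the side of \<open>B\<close> and
      \<open>sqrt C * d\<close> on the side of \<open>A\<close>; together this is
      \<open>e\<close>.\<close>
    define d where "d = e / (1 + sqrt C)"
    have "0 < d" using that C_nonneg by (simp add: d_def add_pos_nonneg)
    then obtain xs where xs: "snd ` set xs \<subseteq> T" "L2_norm A (\<lambda>x. lincomb \<phi> xs x - f x) < d"
      "L2_norm B (\<lambda>x. lincomb \<psi> xs x - X x) < d"
      using assms unfolding graph_closure_def by blast
    have 1: "\<bar>L2_norm B (lincomb \<psi> xs) - L2_norm B X\<bar> \<le> d"
      using L2_norm_diff_le[OF lincomb_psi_L2[OF xs(1)] X] xs(3) by simp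
    have "\<bar>L2_norm A (lincomb \<phi> xs) - L2_norm A f\<bar> \<le> d"
      using L2_norm_diff_le[OF lincomb_phi_L2[OF xs(1)] f] xs(2) by simp
    then have "sqrt C * \<bar>L2_norm A (lincomb \<phi> xs) - L2_norm A f\<bar> \<le> sqrt C * d"
      using C_nonneg by (intro mult_left_mono) auto
    moreover have "\<bar>sqrt C * (L2_norm A (lincomb \<phi> xs) - L2_norm A f)\<bar> =
        sqrt C * \<bar>L2_norm A (lincomb \<phi> xs) - L2_norm A f\<bar>"
      using C_nonneg by (simp add: abs_mult)
    ultimately have 2: "\<bar>sqrt C * L2_norm A (lincomb \<phi> xs) - sqrt C * L2_norm A f\<bar> \<le> sqrt C * d"
      by (simp add: right_diff_distrib)
    have "1 + sqrt C > 0" using real_sqrt_ge_zero[OF C_nonneg] by linarith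
    then have "(1 + sqrt C) * d = e" by (simp add: d_def)
    then have "d + sqrt C * d = e" by (simp add: algebra_simps)
    with 1 2 norm_lincomb_psi[OF xs(1)] show ?thesis by linarith
  qed
  then have "\<bar>L2_norm B X - sqrt C * L2_norm A f\<bar> \<le> 0" by (rule field_le_epsilon) simp
  then show ?thesis by simp
qed

lemma R_lincomb:
  assumes "R f X" "R g Y"
  shows "R (\<lambda>x. a * f x + b * g x) (\<lambda>x. a * X x + b * Y x)"
  unfolding graph_closure_def
proof (intro conjI allI impI)
  have L2: "f \<in> L2 A" "X \<in> L2 B" "g \<in> L2 A" "Y \<in> L2 B"
    using assms by (auto simp: graph_closure_def)
  then show "(\<lambda>x. a * f x + b * g x) \<in> L2 A" "(\<lambda>x. a * X x + b * Y x) \<in> L2 B"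
    by (auto intro: L2_lincomb)
  fix e :: real assume "e > 0"
  define d where "d = e / (1 + \<bar>a\<bar> + \<bar>b\<bar>)"
  have "d > 0" using \<open>e > 0\<close> by (simp add: d_def)
  obtain xs where xs: "snd ` set xs \<subseteq> T" "L2_norm A (\<lambda>x. lincomb \<phi> xs x - f x) < d"
      "L2_norm B (\<lambda>x. lincomb \<psi> xs x - X x) < d"
    using assms(1) \<open>d > 0\<close> unfolding graph_closure_def by blast
  obtain ys where ys: "snd ` set ys \<subseteq> T" "L2_norm A (\<lambda>x. lincomb \<phi> ys x - g x) < d"
      "L2_norm B (\<lambda>x. lincomb \<psi> ys x - Y x) < d"
    using assms(2) \<open>d > 0\<close> unfolding graph_closure_def by blast
  have "(1 + \<bar>a\<bar> + \<bar>b\<bar>) * d = e" unfolding d_def by simp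
  then have e: "\<bar>a\<bar> * d + \<bar>b\<bar> * d < e" using \<open>d > 0\<close> by (simp add: algebra_simps)
  let ?zs = "map (\<lambda>(c, t). (a * c, t)) xs @ map (\<lambda>(c, t). (b * c, t)) ys"
  have bound: "L2_norm M (\<lambda>x. lincomb p ?zs x - (a * u x + b * v x)) < e"
    if "lincomb p xs \<in> L2 M" "lincomb p ys \<in> L2 M" "u \<in> L2 M" "v \<in> L2 M"
      "L2_norm M (\<lambda>x. lincomb p xs x - u x) < d" "L2_norm M (\<lambda>x. lincomb p ys x - v x) < d"
    for M :: "'c measure" and p u v
  proof -
    have "L2_norm M (\<lambda>x. a * (lincomb p xs x - u x) + b * (lincomb p ys x - v x)) \<le>
        \<bar>a\<bar> * L2_norm M (\<lambda>x. lincomb p xs x - u x) + \<bar>b\<bar> * L2_norm M (\<lambda>x. lincomb p ys x - v x)"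
      using that by (intro L2_norm_lincomb_le L2_diff)
    also have "\<dots> \<le> \<bar>a\<bar> * d + \<bar>b\<bar> * d"
      using that by (intro add_mono mult_left_mono) auto
    finally show ?thesis using e unfolding lincomb_combine by (simp add: algebra_simps)
  qed
  show "\<exists>zs. snd ` set zs \<subseteq> T \<and>
      L2_norm A (\<lambda>x. lincomb \<phi> zs x - (a * f x + b * g x)) < e \<and>
      L2_norm B (\<lambda>x. lincomb \<psi> zs x - (a * X x + b * Y x)) < e"
  proof (intro exI conjI)
    show "snd ` set ?zs \<subseteq> T" using xs(1) ys(1) by force
    show "L2_norm A (\<lambda>x. lincomb \<phi> ?zs x - (a * f x + b * g x)) < e"
      by (rule bound) (use lincomb_phi_L2 xs ys L2 in auto)
    show "L2_norm B (\<lambda>x. lincomb \<psi> ?zs x - (a * X x + b * Y x)) < e"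
      by (rule bound) (use lincomb_psi_L2 xs ys L2 in auto)
  qed
qed

lemma R_exists:
  assumes "f \<in> S"
  shows "\<exists>X. R f X"
proof -
  have f: "f \<in> L2 A" using assms S_L2 by auto
  \<comment> \<open>Consecutive approximants differ by at most \<open>2 * ((1/2)^n / K)\<close>,
    their images by \<open>sqrt C\<close> times this. With \<open>2 * sqrt C \<le> K\<close> the
    images meet the rate that \<open>L2_complete_fast\<close> asks for.\<close>
  define K where "K = 2 * (1 + sqrt C)"
  have K: "K > 0" "K \<ge> 2" "2 * sqrt C \<le> K" using C_nonneg by (auto simp: K_def add_pos_nonneg)
  have "\<exists>xs. snd ` set xs \<subseteq> T \<and> L2_norm A (\<lambda>x. lincomb \<phi> xs x - f x) < (1/2)^n / K" for n
    using dense assms K unfolding dense_span_def by simp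
  then obtain xs where xs: "\<And>n. snd ` set (xs n) \<subseteq> T"
    "\<And>n. L2_norm A (\<lambda>x. lincomb \<phi> (xs n) x - f x) < (1/2)^n / K" by metis
  have "L2_norm B (\<lambda>x. lincomb \<psi> (xs (Suc n)) x - lincomb \<psi> (xs n) x) \<le> (1/2)^n" for n
  proof -
    have "L2_norm A (\<lambda>x. lincomb \<phi> (xs (Suc n)) x - lincomb \<phi> (xs n) x) \<le>
      L2_norm A (\<lambda>x. lincomb \<phi> (xs (Suc n)) x - f x) + L2_norm A (\<lambda>x. f x - lincomb \<phi> (xs n) x)"
      by (intro L2_norm_triangle_diff lincomb_phi_L2 xs f)
    also have "\<dots> \<le> (1/2)^Suc n / K + (1/2)^n / K"
      using xs(2)[of "Suc n"] xs(2)[of n]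
      by (simp add: L2_norm_minus_commute[of A f "lincomb \<phi> (xs n)"])
    also have "\<dots> \<le> 2 * ((1/2)^n / K)" using K(1) by (simp add: field_simps)
    finally have "sqrt C * L2_norm A (\<lambda>x. lincomb \<phi> (xs (Suc n)) x - lincomb \<phi> (xs n) x) \<le>
        sqrt C * (2 * ((1/2)^n / K))" using C_nonneg by (intro mult_left_mono) auto
    also have "\<dots> = (2 * sqrt C / K) * (1/2)^n" by simp
    also have "\<dots> \<le> 1 * (1/2)^n" using K by (intro mult_right_mono) (auto simp: field_simps)
    finally show ?thesis using norm_lincomb_psi_diff[OF xs(1) xs(1)] by simp
  qed
  then obtain X where X: "X \<in> L2 B" and lim: "(\<lambda>n. L2_norm B (\<lambda>x. lincomb \<psi> (xs n) x - X x)) \<longlonglongrightarrow> 0"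
    using L2_complete_fast[of "\<lambda>n. lincomb \<psi> (xs n)" B] lincomb_psi_L2[OF xs(1)] by auto
  have "R f X" unfolding graph_closure_def
  proof (intro conjI allI impI f X)
    fix e :: real assume "e > 0"
    have "\<forall>\<^sub>F n in sequentially. L2_norm B (\<lambda>x. lincomb \<psi> (xs n) x - X x) < e"
      by (rule order_tendstoD(2)[OF lim \<open>e > 0\<close>])
    moreover have "\<forall>\<^sub>F n in sequentially. (1/2::real)^n < e"
      using order_tendstoD(2)[OF LIMSEQ_realpow_zero[of "1/2::real"] \<open>e > 0\<close>] by simp
    ultimately have "\<forall>\<^sub>F n in sequentially. L2_norm B (\<lambda>x. lincomb \<psi> (xs n) x - X x) < e \<and> (1/2::real)^n < e"
      by (rule eventually_conj)
    then obtain n where n: "L2_norm B (\<lambda>x. lincomb \<psi> (xs n) x - X x) < e" "(1/2::real)^n < e"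
      using eventually_happens'[OF sequentially_bot] by blast
    have "(1/2::real)^n / K \<le> (1/2)^n / 1" using K by (intro divide_left_mono) auto
    then show "\<exists>xs. snd ` set xs \<subseteq> T \<and> L2_norm A (\<lambda>x. lincomb \<phi> xs x - f x) < e \<and>
        L2_norm B (\<lambda>x. lincomb \<psi> xs x - X x) < e"
      using xs(1)[of n] xs(2)[of n] n by (intro exI[of _ "xs n"]) auto
  qed
  then show ?thesis by blast
qed

lemma R_unique:
  assumes "R f X" "R g Y" "L2_norm A (\<lambda>x. f x - g x) = 0"
  shows "AE x in B. X x = Y x"
proof -
  have L2: "X \<in> L2 B" "Y \<in> L2 B" using assms by (auto simp: graph_closure_def)
  have "R (\<lambda>x. 1 * f x + (- 1) * g x) (\<lambda>x. 1 * X x + (- 1) * Y x)" using assms by (intro R_lincomb)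
  then have "L2_norm B (\<lambda>x. X x - Y x) = 0" using R_norm assms(3) by fastforce
  then have "AE x in B. X x - Y x = 0" using L2_norm_eq_0_iff[OF L2_diff[OF L2]] by simp
  then show ?thesis by auto
qed

theorem extension_exists:
  "\<exists>I. continuous_linear_L2 S A B I \<and> (\<forall>t\<in>T. AE x in B. I (\<phi> t) x = \<psi> t x)"
proof -
  define I where "I f = (SOME X. R f X)" for f
  have I: "R f (I f)" if "f \<in> S" for f
    unfolding I_def using R_exists[OF that] by (rule someI_ex)
  have zero: "L2_norm A (\<lambda>x. f x - f x) = 0" for f :: "'a \<Rightarrow> real" by simp
  have "continuous_linear_L2 S A B I"
    unfolding continuous_linear_L2_def
  proof (intro conjI ballI allI impI)
    fix f assume "f \<in> S" then show "I f \<in> L2 B" using I by (auto simp: graph_closure_def)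
  next
    fix f g a b assume "f \<in> S" "g \<in> S"
    then show "AE \<omega> in B. I (\<lambda>x. a * f x + b * g x) \<omega> = a * I f \<omega> + b * I g \<omega>"
      by (intro R_unique[OF I R_lincomb zero] S_lin I)
  next
    fix u f assume u: "\<forall>n. u n \<in> S" and f: "f \<in> S"
      and lim: "(\<lambda>n. L2_norm A (\<lambda>x. u n x - f x)) \<longlonglongrightarrow> 0"
    have "L2_norm B (\<lambda>\<omega>. I (u n) \<omega> - I f \<omega>) = sqrt C * L2_norm A (\<lambda>x. u n x - f x)" for n
    proof -
      have "R (\<lambda>x. 1 * u n x + (- 1) * f x) (\<lambda>x. 1 * I (u n) x + (- 1) * I f x)"
        using u f by (intro R_lincomb I) auto
      from R_norm[OF this] show ?thesis by simp
    qed
    then show "(\<lambda>n. L2_norm B (\<lambda>\<omega>. I (u n) \<omega> - I f \<omega>)) \<longlonglongrightarrow> 0"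
      using tendsto_mult_right_zero[OF lim] by simp
  qed
  moreover have "AE x in B. I (\<phi> t) x = \<psi> t x" if "t \<in> T" for t
    using that by (intro R_unique[OF I R_generator zero] phi_S)
  ultimately show ?thesis by blast
qed

text \<open>Ties the characterisation of an integral to its construction: every continuous linear
  map with the right values on generators lies in the closed graph, hence is isometric up to
  \<open>C\<close> and unique almost everywhere. Only this makes a map chosen by \<open>SOME\<close>
  usable.\<close>

lemma continuous_linear_graph:
  assumes I: "continuous_linear_L2 S A B I" and gen: "\<And>t. t \<in> T \<Longrightarrow> AE x in B. I (\<phi> t) x = \<psi> t x"
    and f: "f \<in> S"
  shows "R f (I f)"
proof -
  have IL2: "I g \<in> L2 B" if "g \<in> S" for g using I that by (auto simp: continuous_linear_L2_def)
  have S0: "(\<lambda>x. 0) \<in> S" using S_lin[OF f f, of 0 0] by simp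
  have lin: "lincomb \<phi> xs \<in> S \<and> (AE x in B. I (lincomb \<phi> xs) x = lincomb \<psi> xs x)"
    if "snd ` set xs \<subseteq> T" for xs using that
  proof (induction xs)
    case Nil
    \<comment> \<open>Linearity with zero coefficients yields the value at the zero
      function.\<close>
    have "AE x in B. I (\<lambda>x. 0 * f x + 0 * f x) x = 0 * I f x + 0 * I f x"
      using I f unfolding continuous_linear_L2_def by blast
    then show ?case using S0 by simp
  next
    case (Cons y xs)
    obtain c t where y: "y = (c, t)" by fastforce
    with Cons have t: "t \<in> T" and S: "lincomb \<phi> xs \<in> S"
      and ae: "AE x in B. I (lincomb \<phi> xs) x = lincomb \<psi> xs x" by auto
    have "AE x in B. I (\<lambda>x. c * \<phi> t x + 1 * lincomb \<phi> xs x) x = c * I (\<phi> t) x + 1 * I (lincomb \<phi> xs) x"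
      using I phi_S[OF t] S unfolding continuous_linear_L2_def by blast
    then show ?case using gen[OF t] ae S_lin[OF phi_S[OF t] S, of c 1]
      unfolding y lincomb_Cons by auto
  qed
  have fL: "f \<in> L2 A" using f S_L2 by auto
  have "\<exists>xs. snd ` set xs \<subseteq> T \<and> L2_norm A (\<lambda>x. lincomb \<phi> xs x - f x) < inverse (real (Suc n))" for n
    using dense f unfolding dense_span_def by simp
  then obtain xs where xs: "\<And>n. snd ` set (xs n) \<subseteq> T"
    "\<And>n. L2_norm A (\<lambda>x. lincomb \<phi> (xs n) x - f x) < inverse (real (Suc n))" by metis
  have lim: "(\<lambda>n. L2_norm A (\<lambda>x. lincomb \<phi> (xs n) x - f x)) \<longlonglongrightarrow> 0"
    by (rule tendsto_sandwich[OF _ _ tendsto_const LIMSEQ_inverse_real_of_nat])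
      (auto intro!: always_eventually less_imp_le xs(2) simp del: of_nat_Suc)
  then have "(\<lambda>n. L2_norm B (\<lambda>\<omega>. I (lincomb \<phi> (xs n)) \<omega> - I f \<omega>)) \<longlonglongrightarrow> 0"
    using I f lin[OF xs(1)] unfolding continuous_linear_L2_def by auto
  moreover have "L2_norm B (\<lambda>\<omega>. I (lincomb \<phi> (xs n)) \<omega> - I f \<omega>) =
      L2_norm B (\<lambda>\<omega>. lincomb \<psi> (xs n) \<omega> - I f \<omega>)" for n
  proof (rule L2_norm_cong_AE)
    show "(\<lambda>\<omega>. I (lincomb \<phi> (xs n)) \<omega> - I f \<omega>) \<in> borel_measurable B"
      using lin[OF xs(1)] f by (auto intro!: L2_measurable L2_diff IL2)
  next
    show "(\<lambda>\<omega>. lincomb \<psi> (xs n) \<omega> - I f \<omega>) \<in> borel_measurable B"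
      using f by (auto intro!: L2_measurable L2_diff IL2 lincomb_psi_L2 xs)
    show "AE x in B. I (lincomb \<phi> (xs n)) x - I f x = lincomb \<psi> (xs n) x - I f x"
      using lin[OF xs(1)[of n]] by auto
  qed
  ultimately have lim2: "(\<lambda>n. L2_norm B (\<lambda>\<omega>. lincomb \<psi> (xs n) \<omega> - I f \<omega>)) \<longlonglongrightarrow> 0" by simp
  show ?thesis unfolding graph_closure_def
  proof (intro conjI allI impI fL IL2 f)
    fix e :: real assume "e > 0"
    have "\<forall>\<^sub>F n in sequentially. L2_norm A (\<lambda>x. lincomb \<phi> (xs n) x - f x) < e \<and>
        L2_norm B (\<lambda>\<omega>. lincomb \<psi> (xs n) \<omega> - I f \<omega>) < e"
      by (intro eventually_conj order_tendstoD(2)[OF lim \<open>e > 0\<close>] order_tendstoD(2)[OF lim2 \<open>e > 0\<close>])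
    then obtain n where "L2_norm A (\<lambda>x. lincomb \<phi> (xs n) x - f x) < e"
        "L2_norm B (\<lambda>\<omega>. lincomb \<psi> (xs n) \<omega> - I f \<omega>) < e"
      using eventually_happens'[OF sequentially_bot] by blast
    then show "\<exists>xs. snd ` set xs \<subseteq> T \<and> L2_norm A (\<lambda>x. lincomb \<phi> xs x - f x) < e \<and>
        L2_norm B (\<lambda>x. lincomb \<psi> xs x - I f x) < e"
      using xs(1)[of n] by (intro exI[of _ "xs n"]) simp
  qed
qed

end

section \<open>Density of spans\<close>

definition L2_closed_subspace :: "'a measure \<Rightarrow> ('a \<Rightarrow> real) set \<Rightarrow> bool" where
  "L2_closed_subspace M C \<longleftrightarrow> C \<subseteq> L2 M \<and> (\<lambda>x. 0) \<in> C \<and>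
     (\<forall>f\<in>C. \<forall>g\<in>C. \<forall>a b. (\<lambda>x. a * f x + b * g x) \<in> C) \<and>
     (\<forall>f\<in>L2 M. (\<forall>\<epsilon>>0. \<exists>g\<in>C. L2_norm M (\<lambda>x. g x - f x) < \<epsilon>) \<longrightarrow> f \<in> C)"

lemma L2_closed_subspace_lincomb:
  "L2_closed_subspace M C \<Longrightarrow> f \<in> C \<Longrightarrow> g \<in> C \<Longrightarrow> (\<lambda>x. a * f x + b * g x) \<in> C"
  unfolding L2_closed_subspace_def by blast

lemma L2_closed_subspace_limit:
  assumes C: "L2_closed_subspace M C" and f: "f \<in> L2 M" and u: "\<And>n. u n \<in> C"
    and lim: "(\<lambda>n. L2_norm M (\<lambda>x. u n x - f x)) \<longlonglongrightarrow> 0"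
  shows "f \<in> C"
proof -
  have "\<exists>g\<in>C. L2_norm M (\<lambda>x. g x - f x) < e" if "e > 0" for e
  proof -
    have "\<forall>\<^sub>F n in sequentially. L2_norm M (\<lambda>x. u n x - f x) < e"
      by (rule order_tendstoD(2)[OF lim that])
    then obtain n where "L2_norm M (\<lambda>x. u n x - f x) < e"
      using eventually_happens'[OF sequentially_bot] by blast
    then show ?thesis using u by blast
  qed
  then show ?thesis using C f unfolding L2_closed_subspace_def by blast
qed

lemma indicator_L2:
  assumes "A \<in> sets M" "emeasure M A < \<infinity>"
  shows "(indicator A :: 'a \<Rightarrow> real) \<in> L2 M"
proof (rule L2I)
  have "integrable M (indicator A :: 'a \<Rightarrow> real)" using assms by (simp add: integrable_indicator_iff)
  moreover have "(indicator A x :: real)\<^sup>2 = indicator A x" for x by (simp split: split_indicator)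
  ultimately show "integrable M (\<lambda>x. (indicator A x :: real)\<^sup>2)" by simp
qed (use assms in measurable)

text \<open>Dynkin's argument, localised: complements and unions are treated for the traces on
  \<open>E n\<close>, since a measurable set may have infinite measure and then its indicator is not
  in L2. Monotone approximation leads from indicators to nonnegative functions, and the positive and
  negative parts lead to \<open>f\<close>.\<close>

lemma L2_closed_subspace_eq_UNIV:
  assumes C: "L2_closed_subspace M C"
    and G: "Int_stable G" "G \<subseteq> Pow (space M)" "sets M = sigma_sets (space M) G"
    and E: "\<And>n::nat. E n \<in> sets M" "\<And>n. emeasure M (E n) < \<infinity>" "incseq E" "(\<Union>n. E n) = space M"
    and gen: "\<And>A n. A \<in> G \<Longrightarrow> indicator (A \<inter> E n) \<in> C" "\<And>n. indicator (E n) \<in> C"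
    and f: "f \<in> L2 M"
  shows "f \<in> C"
proof -
  note lin = L2_closed_subspace_lincomb[OF C]
  have zero: "(\<lambda>x. 0) \<in> C" using C by (simp add: L2_closed_subspace_def)
  have Esub: "E n \<subseteq> space M" for n using E(1) by (rule sets.sets_into_space)
  have 1: "\<forall>n. indicator (A \<inter> E n) \<in> C" if "A \<in> sets M" for A
    using G(1,2) that[unfolded G(3)]
  proof (induction rule: sigma_sets_induct_disjoint)
    case (basic A) then show ?case using gen by blast
  next
    case empty then show ?case using zero by (simp add: indicator_def[abs_def])
  next
    case (compl A)
    have eq: "indicator ((space M - A) \<inter> E n) = (\<lambda>x. 1 * indicator (E n) x + (- 1) * indicator (A \<inter> E n) x :: real)" for n
      using Esub[of n] by (auto simp: fun_eq_iff split: split_indicator)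
    have "indicator (A \<inter> E n) \<in> C" for n using compl by blast
    then show ?case unfolding eq by (intro allI lin gen(2))
  next
    case (union A)
    show ?case
    proof
      fix n
      have A: "A i \<in> sets M" for i using union G(3) by auto
      have 2: "indicator ((\<Union>i<k. A i) \<inter> E n) \<in> C" for k
      proof (induction k)
        case 0 then show ?case using zero by (simp add: indicator_def[abs_def])
      next
        case (Suc k)
        have disj: "x \<notin> A i" if "i < k" "x \<in> A k" for x i
          using disjoint_family_onD[OF union(1), of i k] that by auto
        have eq: "indicator ((\<Union>i<Suc k. A i) \<inter> E n) =
            (\<lambda>x. 1 * indicator ((\<Union>i<k. A i) \<inter> E n) x + 1 * indicator (A k \<inter> E n) x :: real)"
          using disj by (auto simp: fun_eq_iff lessThan_Suc split: split_indicator)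
        have "indicator (A k \<inter> E n) \<in> C" using union(3)[of k] by (rule spec)
        with Suc show ?case unfolding eq by (rule lin)
      qed
      show "indicator ((\<Union>i. A i) \<inter> E n) \<in> C"
      proof (rule L2_closed_subspace_limit[OF C _ 2])
        show "indicator (\<Union> (range A) \<inter> E n) \<in> L2 M"
        proof (rule indicator_L2)
          have "emeasure M (\<Union> (range A) \<inter> E n) \<le> emeasure M (E n)"
            using A E(1) by (intro emeasure_mono) auto
          also have "\<dots> < \<infinity>" by (rule E(2))
          finally show "emeasure M (\<Union> (range A) \<inter> E n) < \<infinity>" .
        qed (use A E(1) in auto)
        show "(\<lambda>k. L2_norm M (\<lambda>x. indicator ((\<Union>i<k. A i) \<inter> E n) x - indicator (\<Union> (range A) \<inter> E n) x)) \<longlonglongrightarrow> 0"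
        proof (rule L2_norm_dominated_limit)
          show "indicator (\<Union> (range A) \<inter> E n) \<in> borel_measurable M"
            "\<And>k. indicator ((\<Union>i<k. A i) \<inter> E n) \<in> borel_measurable M"
            using A E(1) by (auto intro!: borel_measurable_indicator)
          show "indicator (E n) \<in> L2 M" using E by (intro indicator_L2)
          show "AE x in M. (\<lambda>k. indicator ((\<Union>i<k. A i) \<inter> E n) x) \<longlonglongrightarrow> (indicator (\<Union> (range A) \<inter> E n) x :: real)"
          proof (rule AE_I2)
            fix x
            have "(\<lambda>k. indicator (\<Union>i<k. A i) x * indicator (E n) x) \<longlonglongrightarrow> (indicator (\<Union> (range A)) x * indicator (E n) x :: real)"
              by (intro tendsto_mult LIMSEQ_indicator_UN tendsto_const)
            then show "(\<lambda>k. indicator ((\<Union>i<k. A i) \<inter> E n) x) \<longlonglongrightarrow> (indicator (\<Union> (range A) \<inter> E n) x :: real)"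
              by (simp add: indicator_inter_arith)
          qed
          show "AE x in M. \<bar>indicator ((\<Union>i<k. A i) \<inter> E n) x - indicator (\<Union> (range A) \<inter> E n) x\<bar> \<le> (indicator (E n) x :: real)" for k
            by (rule AE_I2) (auto split: split_indicator)
        qed
      qed
    qed
  qed
  have 2: "indicator A \<in> C" if A: "A \<in> sets M" "emeasure M A < \<infinity>" for A
  proof (rule L2_closed_subspace_limit[OF C indicator_L2[OF A]])
    show "indicator (A \<inter> E n) \<in> C" for n using 1[OF A(1)] by blast
    show "(\<lambda>n. L2_norm M (\<lambda>x. indicator (A \<inter> E n) x - indicator A x)) \<longlonglongrightarrow> 0"
    proof (rule L2_norm_dominated_limit[OF _ _ indicator_L2[OF A]])
      show "indicator A \<in> borel_measurable M" "\<And>n. indicator (A \<inter> E n) \<in> borel_measurable M"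
        using A E(1) by auto
      show "AE x in M. (\<lambda>n. indicator (A \<inter> E n) x) \<longlonglongrightarrow> (indicator A x :: real)"
      proof (rule AE_I2)
        fix x assume x: "x \<in> space M"
        have "(\<lambda>n. indicator A x * indicator (E n) x) \<longlonglongrightarrow> (indicator A x * indicator (\<Union>n. E n) x :: real)"
          by (intro tendsto_mult LIMSEQ_indicator_incseq tendsto_const E(3))
        then show "(\<lambda>n. indicator (A \<inter> E n) x) \<longlonglongrightarrow> (indicator A x :: real)"
          using x by (simp add: indicator_inter_arith E(4))
      qed
      show "AE x in M. \<bar>indicator (A \<inter> E n) x - indicator A x\<bar> \<le> (indicator A x :: real)" for n
        by (rule AE_I2) (auto split: split_indicator)
    qed
  qed
  have L2_le: "g \<in> L2 M" if "g \<in> borel_measurable M" "h \<in> L2 M" "\<And>x. x \<in> space M \<Longrightarrow> \<bar>g x\<bar> \<le> \<bar>h x\<bar>" for g h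
  proof (rule L2I[OF that(1)], rule Bochner_Integration.integrable_bound[OF L2_integrable_square[OF that(2)]])
    show "AE x in M. norm ((g x)\<^sup>2) \<le> norm ((h x)\<^sup>2)"
      using that(3) by (intro AE_I2) (simp add: abs_le_square_iff)
  qed (use that(1) in measurable)
  have 3: "g \<in> L2 M \<longrightarrow> g \<in> C" if "g \<in> borel_measurable M" "\<And>x. 0 \<le> g x" for g
    using that
  proof (induction rule: borel_measurable_induct_real)
    case (set A)
    show ?case
    proof
      assume "(indicator A :: _ \<Rightarrow> real) \<in> L2 M"
      then have "integrable M (\<lambda>x. (indicator A x :: real)\<^sup>2)" by (rule L2_integrable_square)
      moreover have "(indicator A x :: real)\<^sup>2 = indicator A x" for x by (simp split: split_indicator)
      ultimately have "integrable M (indicator A :: _ \<Rightarrow> real)" by simp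
      then show "indicator A \<in> C" using set by (intro 2) (simp_all add: integrable_indicator_iff)
    qed
  next
    case (mult u c)
    show ?case
    proof
      assume L: "(\<lambda>x. c * u x) \<in> L2 M"
      show "(\<lambda>x. c * u x) \<in> C"
      \<comment> \<open>For \<open>c = 0\<close> nothing is known about \<open>u\<close>, which need
        not be square-integrable; otherwise dividing by \<open>c\<close> recovers it.\<close>
      proof (cases "c = 0")
        case True then show ?thesis using zero by simp
      next
        case False
        have "u \<in> L2 M" using L2_scale[OF L, of "1/c"] False by simp
        then have "u \<in> C" using mult by blast
        then show ?thesis using lin[of u u c 0] by simp
      qed
    qed
  next
    case (add u v)
    show ?case
    proof
      assume L: "(\<lambda>x. v x + u x) \<in> L2 M"
      have u0: "0 \<le> u x" and v0: "0 \<le> v x" for x by fact+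
      have "u \<in> borel_measurable M" "v \<in> borel_measurable M" by fact+
      moreover have "\<bar>u x\<bar> \<le> \<bar>v x + u x\<bar>" "\<bar>v x\<bar> \<le> \<bar>v x + u x\<bar>" for x
        using u0[of x] v0[of x] by simp_all
      ultimately have "u \<in> L2 M" "v \<in> L2 M" using L2_le[OF _ L] by blast+
      then have "u \<in> C" "v \<in> C" using add by blast+
      then show "(\<lambda>x. v x + u x) \<in> C" using lin[of v u 1 1] by simp
    qed
  next
    case (seq U)
    show ?case
    proof
      assume L: "g \<in> L2 M"
      have le: "U i x \<le> g x" if "x \<in> space M" for i x
      proof (rule incseq_le)
        have "incseq U" by fact
        then show "incseq (\<lambda>i. U i x)" by (auto simp: incseq_def le_fun_def)
        show "(\<lambda>i. U i x) \<longlonglongrightarrow> g x" using that by fact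
      qed
      have U0: "0 \<le> U i x" and Um: "U i \<in> borel_measurable M" for i x by fact+
      have "U i \<in> L2 M" for i
      proof (rule L2_le[OF Um L])
        fix x assume "x \<in> space M"
        then show "\<bar>U i x\<bar> \<le> \<bar>g x\<bar>" using le[of x i] U0[of i x] by linarith
      qed
      then have UC: "U i \<in> C" for i using seq by blast
      show "g \<in> C"
      proof (rule L2_closed_subspace_limit[OF C L UC], rule L2_norm_dominated_limit[OF L2_measurable[OF L] Um L])
        show "AE x in M. (\<lambda>n. U n x) \<longlonglongrightarrow> g x" using seq by (intro AE_I2)
        show "AE x in M. \<bar>U n x - g x\<bar> \<le> g x" for n
        proof (rule AE_I2)
          fix x assume "x \<in> space M"
          then show "\<bar>U n x - g x\<bar> \<le> g x" using le[of x n] U0[of n x] by linarith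
        qed
      qed
    qed
  qed
  have fm: "f \<in> borel_measurable M" using f by (rule L2_measurable)
  have "(\<lambda>x. max (f x) 0) \<in> L2 M" "(\<lambda>x. max (- f x) 0) \<in> L2 M"
    by (rule L2_le[OF _ f], use fm in auto)+
  then have "(\<lambda>x. max (f x) 0) \<in> C" "(\<lambda>x. max (- f x) 0) \<in> C"
    using 3[of "\<lambda>x. max (f x) 0"] 3[of "\<lambda>x. max (- f x) 0"] fm by auto
  from lin[OF this, of 1 "-1"] have "(\<lambda>x. max (f x) 0 - max (- f x) 0) \<in> C" by simp
  moreover have "max (f x) 0 - max (- f x) 0 = f x" for x by (simp add: max_def)
  ultimately show ?thesis by simp
qed

definition L2_span_closure :: "'a measure \<Rightarrow> 't set \<Rightarrow> ('t \<Rightarrow> 'a \<Rightarrow> real) \<Rightarrow> ('a \<Rightarrow> real) set" where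
  "L2_span_closure M T \<phi> = {f \<in> L2 M. \<forall>\<epsilon>>0. \<exists>xs. snd ` set xs \<subseteq> T \<and>
     L2_norm M (\<lambda>x. lincomb \<phi> xs x - f x) < \<epsilon>}"

lemma lincomb_in_span_closure:
  assumes "\<And>t. t \<in> T \<Longrightarrow> \<phi> t \<in> L2 M" "snd ` set xs \<subseteq> T"
  shows "lincomb \<phi> xs \<in> L2_span_closure M T \<phi>"
  unfolding L2_span_closure_def using lincomb_L2[OF assms(2,1)] assms(2)
  by (auto intro!: exI[of _ xs])

lemma L2_closed_subspace_span_closure:
  assumes \<phi>: "\<And>t. t \<in> T \<Longrightarrow> \<phi> t \<in> L2 M"
  shows "L2_closed_subspace M (L2_span_closure M T \<phi>)"
  unfolding L2_closed_subspace_def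
proof (intro conjI ballI allI impI)
  show "L2_span_closure M T \<phi> \<subseteq> L2 M" by (auto simp: L2_span_closure_def)
  show "(\<lambda>x. 0) \<in> L2_span_closure M T \<phi>" using lincomb_in_span_closure[OF \<phi>, where xs = "[]"] by simp
next
  fix f g a b assume f: "f \<in> L2_span_closure M T \<phi>" and g: "g \<in> L2_span_closure M T \<phi>"
  then have L2: "f \<in> L2 M" "g \<in> L2 M" by (auto simp: L2_span_closure_def)
  show "(\<lambda>x. a * f x + b * g x) \<in> L2_span_closure M T \<phi>"
    unfolding L2_span_closure_def
  proof (intro CollectI conjI allI impI L2_lincomb L2)
    fix e :: real assume "e > 0"
    define d where "d = e / (1 + \<bar>a\<bar> + \<bar>b\<bar>)"
    have "d > 0" using \<open>e > 0\<close> by (simp add: d_def)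
    obtain xs where xs: "snd ` set xs \<subseteq> T" "L2_norm M (\<lambda>x. lincomb \<phi> xs x - f x) < d"
      using f \<open>d > 0\<close> unfolding L2_span_closure_def by blast
    obtain ys where ys: "snd ` set ys \<subseteq> T" "L2_norm M (\<lambda>x. lincomb \<phi> ys x - g x) < d"
      using g \<open>d > 0\<close> unfolding L2_span_closure_def by blast
    have "(1 + \<bar>a\<bar> + \<bar>b\<bar>) * d = e" unfolding d_def by simp
    then have e: "\<bar>a\<bar> * d + \<bar>b\<bar> * d < e" using \<open>d > 0\<close> by (simp add: algebra_simps)
    let ?zs = "map (\<lambda>(c, t). (a * c, t)) xs @ map (\<lambda>(c, t). (b * c, t)) ys"
    have "L2_norm M (\<lambda>x. a * (lincomb \<phi> xs x - f x) + b * (lincomb \<phi> ys x - g x)) \<le>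
        \<bar>a\<bar> * L2_norm M (\<lambda>x. lincomb \<phi> xs x - f x) + \<bar>b\<bar> * L2_norm M (\<lambda>x. lincomb \<phi> ys x - g x)"
      using L2 by (intro L2_norm_lincomb_le L2_diff lincomb_L2[OF xs(1)] lincomb_L2[OF ys(1)] \<phi>)
    also have "\<dots> \<le> \<bar>a\<bar> * d + \<bar>b\<bar> * d"
      using xs ys by (intro add_mono mult_left_mono) auto
    finally have "L2_norm M (\<lambda>x. lincomb \<phi> ?zs x - (a * f x + b * g x)) < e"
      using e unfolding lincomb_combine by (simp add: algebra_simps)
    moreover have "snd ` set ?zs \<subseteq> T" using xs(1) ys(1) by force
    ultimately show "\<exists>zs. snd ` set zs \<subseteq> T \<and> L2_norm M (\<lambda>x. lincomb \<phi> zs x - (a * f x + b * g x)) < e"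
      by blast
  qed
next
  fix f assume f: "f \<in> L2 M"
    and ap: "\<forall>e>0. \<exists>g\<in>L2_span_closure M T \<phi>. L2_norm M (\<lambda>x. g x - f x) < e"
  show "f \<in> L2_span_closure M T \<phi>"
    unfolding L2_span_closure_def
  proof (intro CollectI conjI allI impI f)
    fix e :: real assume "e > 0"
    then have "e / 2 > 0" by simp
    then obtain g where g: "g \<in> L2_span_closure M T \<phi>" "L2_norm M (\<lambda>x. g x - f x) < e / 2"
      using ap by blast
    from g(1) \<open>e / 2 > 0\<close> obtain xs where xs: "snd ` set xs \<subseteq> T" "L2_norm M (\<lambda>x. lincomb \<phi> xs x - g x) < e / 2"
      unfolding L2_span_closure_def by blast
    have "g \<in> L2 M" using g(1) by (simp add: L2_span_closure_def)
    moreover have "lincomb \<phi> xs \<in> L2 M" by (rule lincomb_L2[OF xs(1)]) (rule \<phi>)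
    ultimately have "L2_norm M (\<lambda>x. lincomb \<phi> xs x - f x) < e"
      using L2_norm_triangle_diff[of "lincomb \<phi> xs" M g f] f xs(2) g(2) by simp
    with xs(1)
    show "\<exists>xs. snd ` set xs \<subseteq> T \<and> L2_norm M (\<lambda>x. lincomb \<phi> xs x - f x) < e"
      by blast
  qed
qed

lemma dense_span_iff: "S \<subseteq> L2 M \<Longrightarrow> dense_span M T \<phi> S \<longleftrightarrow> S \<subseteq> L2_span_closure M T \<phi>"
  unfolding dense_span_def L2_span_closure_def by blast

section \<open>Kernels on the quarter plane\<close>

lemma sigma_finite_Rplus: "sigma_finite_measure Rplus"
  unfolding Rplus_def
  by (rule sigma_finite_measure_restrict_space) (auto intro: lborel.sigma_finite_measure_axioms)

interpretation Rplus: sigma_finite_measure Rplus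
  by (rule sigma_finite_Rplus)

interpretation Rplus2: pair_sigma_finite Rplus Rplus
  by unfold_locales

lemma space_Rplus [simp]: "space Rplus = {0..}"
  by (simp add: Rplus_def space_restrict_space)

lemma emeasure_Rplus_atLeastAtMost [simp]: "emeasure Rplus {0..t} = ennreal t" if "0 \<le> t"
proof -
  have "emeasure (restrict_space lborel {0..}) {0..t} = emeasure lborel {0..t}"
    by (intro emeasure_restrict_space) auto
  also have "\<dots> = ennreal t" using that by simp
  finally show ?thesis by (simp add: Rplus_def)
qed

lemma atLeastAtMost_sets_Rplus [measurable]: "{0..t} \<in> sets Rplus"
proof -
  have "{0..t} = {0..} \<inter> {..t}" by auto
  then show ?thesis unfolding Rplus_def sets_restrict_space by auto
qed

lemma measure_Rplus_atLeastAtMost: "measure Rplus {0..t} = t" if "0 \<le> t"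
  using that by (simp add: measure_def)

lemma indicator_Rplus_L2: "(indicator {0..t} :: real \<Rightarrow> real) \<in> L2 Rplus"
proof (cases "0 \<le> t")
  case True then show ?thesis by (intro indicator_L2) auto
next
  case False
  then have "indicator {0..t} = (\<lambda>x. 0 :: real)" by (auto simp: fun_eq_iff)
  then show ?thesis by simp
qed

lemma L2_inner_indicator_Rplus:
  assumes "0 \<le> s" "0 \<le> t"
  shows "L2_inner Rplus (indicator {0..s}) (indicator {0..t}) = min s t"
proof -
  have "indicator {0..s} x * indicator {0..t} x = (indicator {0..min s t} x :: real)" for x
    by (auto split: split_indicator)
  then have "L2_inner Rplus (indicator {0..s}) (indicator {0..t}) = measure Rplus {0..min s t}"
    by (simp add: L2_inner_def)
  then show ?thesis using assms by (simp add: measure_Rplus_atLeastAtMost)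
qed

text \<open>The traces of the half-lines \<open>{..a}\<close> form a generating \<pi>-system of
  \<open>Rplus\<close>. Cut off by \<open>{0..real n}\<close> they are again intervals
  \<open>{0..t}\<close>, or empty if \<open>a\<close> is negative.\<close>

lemma dense_span_indicator_Rplus:
  "dense_span Rplus {0..} (\<lambda>t. indicator {0..t} :: real \<Rightarrow> real) (L2 Rplus)"
proof (unfold dense_span_iff[OF order_refl], rule subsetI)
  let ?\<phi> = "\<lambda>t. indicator {0..t} :: real \<Rightarrow> real"
  let ?C = "L2_span_closure Rplus {0..} ?\<phi>"
  fix f assume f: "f \<in> L2 Rplus"
  have C: "L2_closed_subspace Rplus ?C"
    by (rule L2_closed_subspace_span_closure) (rule indicator_Rplus_L2)
  have ind: "indicator {0..t} \<in> ?C" if "0 \<le> t" for t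
    using lincomb_in_span_closure[where T = "{0..}" and \<phi> = ?\<phi> and M = Rplus and xs = "[(1, t)]"] that indicator_Rplus_L2
    by (simp add: lincomb_def[abs_def])
  define G where "G = (\<inter>) {0::real..} ` range atMost"
  show "f \<in> ?C"
  proof (rule L2_closed_subspace_eq_UNIV[OF C, where G = G and E = "\<lambda>n. {0..real n}"])
    show "Int_stable G"
    proof (rule Int_stableI)
      fix a b assume "a \<in> G" "b \<in> G"
      then obtain s t where "a = {0..} \<inter> {..s}" "b = {0..} \<inter> {..t}" by (auto simp: G_def)
      then have "a \<inter> b = {0..} \<inter> {..min s t}" by auto
      then show "a \<inter> b \<in> G" by (auto simp: G_def)
    qed
    show "G \<subseteq> Pow (space Rplus)" by (auto simp: G_def)
    have "sets Rplus = (\<inter>) {0..} ` sigma_sets UNIV (range atMost)"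
      unfolding Rplus_def sets_restrict_space sets_lborel borel_eq_atMost by simp
    also have "\<dots> = sigma_sets {0..} ((\<inter>) {0..} ` range atMost)"
    proof (rule sigma_sets_Int)
      have "{0::real..} \<in> sets borel" by simp
      then show "{0::real..} \<in> sigma_sets UNIV (range atMost)" unfolding borel_eq_atMost by simp
    qed simp
    finally show "sets Rplus = sigma_sets (space Rplus) G" by (simp add: G_def)
    show "emeasure Rplus {0..real n} < \<infinity>" for n by simp
    show "incseq (\<lambda>n. {0..real n})" by (auto simp: incseq_def)
    show "(\<Union>n. {0..real n}) = space Rplus"
      using real_arch_simple by (auto simp: space_Rplus)
    show "indicator (A \<inter> {0..real n}) \<in> ?C" if A: "A \<in> G" for A n
    proof -
      obtain a where a: "A = {0..} \<inter> {..a}" using A by (auto simp: G_def)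
      show ?thesis
      proof (cases "0 \<le> a")
        case True
        have "A \<inter> {0..real n} = {0..min a (real n)}" using a by auto
        then show ?thesis using ind[of "min a (real n)"] True by simp
      next
        case False
        then have "indicator (A \<inter> {0..real n}) = (\<lambda>x. 0 :: real)" using a by (auto simp: fun_eq_iff)
        then show ?thesis using C by (simp add: L2_closed_subspace_def)
      qed
    qed
    show "indicator {0..real n} \<in> ?C" for n by (rule ind) simp
  qed (use f in auto)
qed

definition tensor :: "('a \<Rightarrow> real) \<Rightarrow> ('a \<Rightarrow> real) \<Rightarrow> 'a \<times> 'a \<Rightarrow> real" where
  "tensor h k = (\<lambda>(x, y). h x * k y)"

lemma tensor_apply: "tensor h k (x, y) = h x * k y"
  by (simp add: tensor_def)

lemma (in pair_sigma_finite) integrable_prod: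
  fixes f :: "'a \<Rightarrow> real" and g :: "'b \<Rightarrow> real"
  assumes f: "integrable M1 f" and g: "integrable M2 g"
  shows "integrable (M1 \<Otimes>\<^sub>M M2) (\<lambda>(x, y). f x * g y)"
proof (rule Fubini_integrable)
  show "(\<lambda>(x, y). f x * g y) \<in> borel_measurable (M1 \<Otimes>\<^sub>M M2)"
    using borel_measurable_integrable[OF f] borel_measurable_integrable[OF g] by measurable
  show "integrable M1 (\<lambda>x. \<integral>y. norm (case (x, y) of (x, y) \<Rightarrow> f x * g y) \<partial>M2)"
    using f by (simp add: abs_mult)
  show "AE x in M1. integrable M2 (\<lambda>y. case (x, y) of (x, y) \<Rightarrow> f x * g y)"
    using g by simp
qed

lemma (in pair_sigma_finite) integral_prod:
  fixes f :: "'a \<Rightarrow> real" and g :: "'b \<Rightarrow> real"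
  assumes f: "integrable M1 f" and g: "integrable M2 g"
  shows "(\<integral>(x, y). f x * g y \<partial>(M1 \<Otimes>\<^sub>M M2)) = (\<integral>x. f x \<partial>M1) * (\<integral>y. g y \<partial>M2)"
  using integral_fst'[OF integrable_prod[OF f g]] by simp

lemma tensor_measurable [measurable]:
  "h \<in> borel_measurable M \<Longrightarrow> k \<in> borel_measurable M \<Longrightarrow> tensor h k \<in> borel_measurable (M \<Otimes>\<^sub>M M)"
  unfolding tensor_def split_def
  by (intro borel_measurable_times measurable_compose[OF measurable_fst] measurable_compose[OF measurable_snd])

lemma tensor_L2:
  assumes "h \<in> L2 Rplus" "k \<in> L2 Rplus"
  shows "tensor h k \<in> L2 Rplus2"
proof (rule L2I)
  have "integrable Rplus2 (\<lambda>(x, y). (h x)\<^sup>2 * (k y)\<^sup>2)"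
    using assms by (intro Rplus2.integrable_prod L2_integrable_square)
  then show "integrable Rplus2 (\<lambda>z. (tensor h k z)\<^sup>2)"
    by (simp add: tensor_def split_def power_mult_distrib)
qed (use assms L2_measurable in measurable)

lemma L2_inner_tensor:
  assumes "h \<in> L2 Rplus" "k \<in> L2 Rplus" "h' \<in> L2 Rplus" "k' \<in> L2 Rplus"
  shows "L2_inner Rplus2 (tensor h k) (tensor h' k') = L2_inner Rplus h h' * L2_inner Rplus k k'"
proof -
  have "(\<lambda>z. tensor h k z * tensor h' k' z) = (\<lambda>(x, y). (h x * h' x) * (k y * k' y))"
    by (auto simp: tensor_def fun_eq_iff)
  then show ?thesis
    unfolding L2_inner_def using assms
    by (simp add: Rplus2.integral_prod L2_integrable_mult)
qed

lemma tensor_sym: "h \<in> L2 Rplus \<Longrightarrow> tensor h h \<in> L2_sym"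
  using tensor_L2[of h h] by (simp add: L2_sym_def tensor_def mult.commute)

lemma L2_sym_subset: "L2_sym \<subseteq> L2 Rplus2"
  by (auto simp: L2_sym_def)

lemma L2_sym_lincomb:
  assumes "f \<in> L2_sym" "g \<in> L2_sym"
  shows "(\<lambda>x. a * f x + b * g x) \<in> L2_sym"
proof -
  have "AE z in Rplus2. case z of (x, y) \<Rightarrow> f (x, y) = f (y, x)"
    "AE z in Rplus2. case z of (x, y) \<Rightarrow> g (x, y) = g (y, x)"
    using assms by (auto simp: L2_sym_def)
  then have "AE (x, y) in Rplus2. a * f (x, y) + b * g (x, y) = a * f (y, x) + b * g (y, x)"
    by eventually_elim (auto split: prod.splits)
  then show ?thesis using assms by (auto simp: L2_sym_def intro: L2_lincomb)
qed

text \<open>A measurable rectangle cut off by a bounded square is a product of two sets of finite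
  measure, so its indicator is a single tensor.\<close>

lemma dense_span_tensor:
  "dense_span Rplus2 (L2 Rplus \<times> L2 Rplus) (\<lambda>(h, k). tensor h k) (L2 Rplus2)"
proof (unfold dense_span_iff[OF order_refl], rule subsetI)
  let ?\<phi> = "\<lambda>(h, k). tensor h k :: real \<times> real \<Rightarrow> real"
  let ?T = "L2 Rplus \<times> L2 Rplus"
  let ?C = "L2_span_closure Rplus2 ?T ?\<phi>"
  fix f assume f: "f \<in> L2 Rplus2"
  have \<phi>: "?\<phi> t \<in> L2 Rplus2" if "t \<in> ?T" for t using that by (auto intro: tensor_L2)
  have C: "L2_closed_subspace Rplus2 ?C" by (rule L2_closed_subspace_span_closure[OF \<phi>])
  have ten: "tensor h k \<in> ?C" if "h \<in> L2 Rplus" "k \<in> L2 Rplus" for h k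
    using lincomb_in_span_closure[where T = ?T and \<phi> = ?\<phi> and M = Rplus2 and xs = "[(1, (h, k))]", OF \<phi>] that
    by (simp add: lincomb_def[abs_def])
  have indprod: "indicator (a \<times> b) = tensor (indicator a) (indicator b)" for a b :: "real set"
    by (auto simp: tensor_def fun_eq_iff split: split_indicator)
  have fin: "(indicator (a \<inter> {0..real n}) :: real \<Rightarrow> real) \<in> L2 Rplus" if a: "a \<in> sets Rplus" for a n
  proof (rule indicator_L2)
    have "emeasure Rplus (a \<inter> {0..real n}) \<le> emeasure Rplus {0..real n}"
      using a by (intro emeasure_mono) auto
    also have "\<dots> < \<infinity>" by simp
    finally show "emeasure Rplus (a \<inter> {0..real n}) < \<infinity>" .
  qed (use a in auto)
  show "f \<in> ?C"
  proof (rule L2_closed_subspace_eq_UNIV[OF C, where E = "\<lambda>n. {0..real n} \<times> {0..real n}"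
        and G = "{a \<times> b | a b. a \<in> sets Rplus \<and> b \<in> sets Rplus}"])
    show "Int_stable {a \<times> b | a b. a \<in> sets Rplus \<and> b \<in> sets Rplus}"
      by (rule Int_stable_pair_measure_generator)
    show "{a \<times> b | a b. a \<in> sets Rplus \<and> b \<in> sets Rplus} \<subseteq> Pow (space Rplus2)"
      unfolding space_pair_measure by (rule pair_measure_closed)
    show "sets Rplus2 = sigma_sets (space Rplus2) {a \<times> b | a b. a \<in> sets Rplus \<and> b \<in> sets Rplus}"
      by (simp add: sets_pair_measure space_pair_measure)
    show "{0..real n} \<times> {0..real n} \<in> sets Rplus2" for n by auto
    show "emeasure Rplus2 ({0..real n} \<times> {0..real n}) < \<infinity>" for n
      by (subst Rplus.emeasure_pair_measure_Times) (auto simp: ennreal_mult_less_top)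
    show "incseq (\<lambda>n. {0..real n} \<times> {0..real n})" by (auto simp: incseq_def)
    show "(\<Union>n. {0..real n} \<times> {0..real n}) = space Rplus2"
    proof (auto simp: space_pair_measure)
      fix a b :: real
      obtain n where "max a b \<le> real n" using real_arch_simple by blast
      then show "\<exists>n. a \<le> real n \<and> b \<le> real n" by auto
    qed
    show "indicator (A \<inter> {0..real n} \<times> {0..real n}) \<in> ?C"
      if A: "A \<in> {a \<times> b | a b. a \<in> sets Rplus \<and> b \<in> sets Rplus}" for A n
    proof -
      obtain a b where ab: "A = a \<times> b" "a \<in> sets Rplus" "b \<in> sets Rplus" using A by blast
      have "A \<inter> {0..real n} \<times> {0..real n} = (a \<inter> {0..real n}) \<times> (b \<inter> {0..real n})"
        using ab by auto
      then show ?thesis using ten[OF fin fin, OF ab(2,3)] by (simp add: indprod)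
    qed
    show "indicator ({0..real n} \<times> {0..real n}) \<in> ?C" for n
      unfolding indprod by (intro ten indicator_Rplus_L2)
  qed (rule f)
qed

lemma L2_norm_swap:
  assumes "f \<in> L2 Rplus2"
  shows "(\<lambda>(x, y). f (y, x)) \<in> L2 Rplus2" "L2_norm Rplus2 (\<lambda>(x, y). f (y, x)) = L2_norm Rplus2 f"
proof -
  have f [measurable]: "f \<in> borel_measurable Rplus2" using assms by (rule L2_measurable)
  have eq: "(\<lambda>z. (case z of (x, y) \<Rightarrow> f (y, x))\<^sup>2) = (\<lambda>(x, y). (\<lambda>z. (f z)\<^sup>2) (y, x))"
    by (auto simp: fun_eq_iff)
  show "(\<lambda>(x, y). f (y, x)) \<in> L2 Rplus2"
  proof (rule L2I)
    show "integrable Rplus2 (\<lambda>z. (case z of (x, y) \<Rightarrow> f (y, x))\<^sup>2)"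
      unfolding eq by (rule Rplus2.integrable_product_swap) (rule L2_integrable_square[OF assms])
  qed measurable
  have "(\<integral>z. (case z of (x, y) \<Rightarrow> f (y, x))\<^sup>2 \<partial>Rplus2) = (\<integral>z. (f z)\<^sup>2 \<partial>Rplus2)"
    unfolding eq by (rule Rplus2.integral_product_swap) measurable
  then show "L2_norm Rplus2 (\<lambda>(x, y). f (y, x)) = L2_norm Rplus2 f"
    by (simp add: L2_norm_def)
qed

text \<open>Symmetrization of \<open>h \<otimes> k\<close> and polarization:
  \<open>h \<otimes> k + k \<otimes> h = ((h + k) \<otimes> (h + k) - (h - k) \<otimes> (h - k)) / 2\<close>.\<close>

lemma dense_span_tensor_sym: "dense_span Rplus2 (L2 Rplus) (\<lambda>h. tensor h h) L2_sym"
  unfolding dense_span_def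
proof (intro ballI allI impI)
  fix f and e :: real assume f: "f \<in> L2_sym" and "e > 0"
  then have fL: "f \<in> L2 Rplus2" using L2_sym_subset by auto
  let ?T = "L2 Rplus \<times> L2 Rplus"
  let ?\<phi> = "\<lambda>(h, k). tensor h k :: real \<times> real \<Rightarrow> real"
  obtain xs where xs: "snd ` set xs \<subseteq> ?T" "L2_norm Rplus2 (\<lambda>z. lincomb ?\<phi> xs z - f z) < e"
    using dense_span_tensor fL \<open>e > 0\<close> unfolding dense_span_def by blast
  \<comment> \<open>Averaging over the swap of variables costs a factor 1/2 and polarization another
    one, hence the weight \<open>c / 4\<close>.\<close>
  define ys :: "(real \<times> (real \<Rightarrow> real)) list" where
    "ys = concat (map (\<lambda>(c, (h, k)). [(c / 4, \<lambda>x. h x + k x), (- c / 4, \<lambda>x. h x - k x)]) xs)"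
  have ysT: "snd ` set ys \<subseteq> L2 Rplus"
    using xs(1) unfolding ys_def by (fastforce intro: L2_add L2_diff)
  have ys_eq: "lincomb (\<lambda>h. tensor h h) ys (x, y) = (lincomb ?\<phi> xs (x, y) + lincomb ?\<phi> xs (y, x)) / 2" for x y
    unfolding ys_def
    by (induction xs) (auto simp: lincomb_def tensor_def field_simps)
  define g where "g = (\<lambda>z. lincomb ?\<phi> xs z - f z)"
  have gL: "g \<in> L2 Rplus2" unfolding g_def
    by (intro L2_diff fL lincomb_L2[OF xs(1)]) (auto intro: tensor_L2)
  \<comment> \<open>As \<open>f\<close> is symmetric, the error of the symmetrised combination is
    the symmetrised error, and averaging over the swap does not increase the norm.\<close>
  have "L2_norm Rplus2 (\<lambda>z. lincomb (\<lambda>h. tensor h h) ys z - f z) =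
      L2_norm Rplus2 (\<lambda>z. (1/2) * g z + (1/2) * (case z of (x, y) \<Rightarrow> g (y, x)))"
  proof (rule L2_norm_cong_AE)
    have "lincomb (\<lambda>h. tensor h h) ys \<in> L2 Rplus2"
      by (rule lincomb_L2[OF ysT]) (rule tensor_L2)
    then show "(\<lambda>z. lincomb (\<lambda>h. tensor h h) ys z - f z) \<in> borel_measurable Rplus2"
      by (intro L2_measurable L2_diff fL)
    show "(\<lambda>z. (1/2) * g z + (1/2) * (case z of (x, y) \<Rightarrow> g (y, x))) \<in> borel_measurable Rplus2"
      by (intro L2_measurable L2_lincomb gL L2_norm_swap)
    have "AE z in Rplus2. case z of (x, y) \<Rightarrow> f (x, y) = f (y, x)" using f by (simp add: L2_sym_def)
    then show "AE z in Rplus2. lincomb (\<lambda>h. tensor h h) ys z - f z =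
        (1/2) * g z + (1/2) * (case z of (x, y) \<Rightarrow> g (y, x))"
      by eventually_elim (auto simp: ys_eq g_def field_simps split: prod.splits)
  qed
  also have "\<dots> \<le> \<bar>1/2\<bar> * L2_norm Rplus2 g + \<bar>1/2\<bar> * L2_norm Rplus2 (\<lambda>(x, y). g (y, x))"
    by (intro L2_norm_lincomb_le gL L2_norm_swap)
  also have "\<dots> = L2_norm Rplus2 g" by (simp add: L2_norm_swap[OF gL])
  also have "\<dots> < e" using xs(2) by (simp add: g_def)
  finally show "\<exists>xs. snd ` set xs \<subseteq> L2 Rplus \<and>
      L2_norm Rplus2 (\<lambda>z. lincomb (\<lambda>h. tensor h h) xs z - f z) < e"
    using ysT by blast
qed

section \<open>Gaussian variables and Wiener integrals\<close>

definition cf :: "'a measure \<Rightarrow> ('a \<Rightarrow> real) \<Rightarrow> real \<Rightarrow> complex" where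
  "cf M X t = (CLINT \<omega>|M. iexp (t * X \<omega>))"

lemma char_distr_eq_cf: "X \<in> borel_measurable M \<Longrightarrow> char (distr M borel X) t = cf M X t"
  by (simp add: char_def cf_def integral_distr)

lemma cf_scale: "cf M (\<lambda>\<omega>. c * X \<omega>) t = cf M X (t * c)"
  by (simp add: cf_def mult.assoc)

lemma cf_cong_AE:
  assumes "X \<in> borel_measurable M" "Y \<in> borel_measurable M" "AE \<omega> in M. X \<omega> = Y \<omega>"
  shows "cf M X t = cf M Y t"
  unfolding cf_def using assms(1,2)
  by (intro integral_cong_AE) (use assms(3) in auto)

lemma iexp_diff_le: "cmod (iexp a - iexp b) \<le> \<bar>a - b\<bar>"
proof -
  have "iexp a - iexp b = iexp b * (iexp (a - b) - 1)"
    by (simp add: algebra_simps flip: exp_add)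
  then have "cmod (iexp a - iexp b) = cmod (iexp (a - b) - 1)" by (simp add: norm_mult)
  also have "\<dots> \<le> \<bar>a - b\<bar>" using iexp_approx1[of "a - b" 0] by simp
  finally show ?thesis .
qed

context prob_space
begin

lemma integrable_iexp_real: "X \<in> borel_measurable M \<Longrightarrow> integrable M (\<lambda>\<omega>. iexp (X \<omega>))"
  using integrable_iexp[of "\<lambda>\<omega>. complex_of_real (X \<omega>)"] by simp

lemma integral_abs_le_L2_norm:
  assumes "Z \<in> L2 M"
  shows "integrable M (\<lambda>\<omega>. \<bar>Z \<omega>\<bar>)" "(\<integral>\<omega>. \<bar>Z \<omega>\<bar> \<partial>M) \<le> L2_norm M Z"
proof -
  have one: "(\<lambda>\<omega>. 1) \<in> L2 M" by (rule L2I) auto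
  have "Z \<in> borel_measurable M" using assms by (rule L2_measurable)
  then have Z: "(\<lambda>\<omega>. \<bar>Z \<omega>\<bar>) \<in> L2 M" using L2_integrable_square[OF assms] by (intro L2I) auto
  show "integrable M (\<lambda>\<omega>. \<bar>Z \<omega>\<bar>)" using L2_integrable_mult[OF Z one] by simp
  have "L2_norm M (\<lambda>\<omega>. 1) = 1" by (simp add: L2_norm_def prob_space)
  moreover have "L2_norm M (\<lambda>\<omega>. \<bar>Z \<omega>\<bar>) = L2_norm M Z" by (simp add: L2_norm_def)
  ultimately show "(\<integral>\<omega>. \<bar>Z \<omega>\<bar> \<partial>M) \<le> L2_norm M Z"
    using L2_Cauchy_Schwarz[OF Z one] by (simp add: L2_inner_def)
qed

text \<open>\<open>iexp\<close> is 1-Lipschitz, and on a probability space the L1 norm is at most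
  the L2 norm. This is how L2 limits pass to characteristic functions.\<close>

lemma iexp_mean_close:
  assumes X: "X \<in> borel_measurable M" and Y: "Y \<in> borel_measurable M"
    and L2: "(\<lambda>\<omega>. X \<omega> - Y \<omega>) \<in> L2 M"
  shows "cmod ((CLINT \<omega>|M. iexp (X \<omega>)) - (CLINT \<omega>|M. iexp (Y \<omega>))) \<le> L2_norm M (\<lambda>\<omega>. X \<omega> - Y \<omega>)"
proof -
  have "(CLINT \<omega>|M. iexp (X \<omega>)) - (CLINT \<omega>|M. iexp (Y \<omega>)) = (CLINT \<omega>|M. iexp (X \<omega>) - iexp (Y \<omega>))"
    by (intro Bochner_Integration.integral_diff[symmetric] integrable_iexp_real X Y)
  also have "cmod \<dots> \<le> (\<integral>\<omega>. cmod (iexp (X \<omega>) - iexp (Y \<omega>)) \<partial>M)" by (rule integral_norm_bound)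
  also have "\<dots> \<le> (\<integral>\<omega>. \<bar>X \<omega> - Y \<omega>\<bar> \<partial>M)"
  proof (rule integral_mono)
    show "integrable M (\<lambda>\<omega>. cmod (iexp (X \<omega>) - iexp (Y \<omega>)))"
      by (intro integrable_norm Bochner_Integration.integrable_diff integrable_iexp_real X Y)
    show "integrable M (\<lambda>\<omega>. \<bar>X \<omega> - Y \<omega>\<bar>)" by (rule integral_abs_le_L2_norm[OF L2])
    show "cmod (iexp (X \<omega>) - iexp (Y \<omega>)) \<le> \<bar>X \<omega> - Y \<omega>\<bar>" for \<omega>
      by (rule iexp_diff_le)
  qed
  also have "\<dots> \<le> L2_norm M (\<lambda>\<omega>. X \<omega> - Y \<omega>)" by (rule integral_abs_le_L2_norm[OF L2])
  finally show ?thesis .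
qed

lemma cf_close:
  assumes "X \<in> L2 M" "Y \<in> L2 M"
  shows "cmod (cf M X t - cf M Y t) \<le> \<bar>t\<bar> * L2_norm M (\<lambda>\<omega>. X \<omega> - Y \<omega>)"
proof -
  have "(\<lambda>\<omega>. t * X \<omega> - t * Y \<omega>) \<in> L2 M" using assms by (intro L2_diff L2_scale)
  moreover have "L2_norm M (\<lambda>\<omega>. t * X \<omega> - t * Y \<omega>) = \<bar>t\<bar> * L2_norm M (\<lambda>\<omega>. X \<omega> - Y \<omega>)"
    using L2_norm_scale[of M t "\<lambda>\<omega>. X \<omega> - Y \<omega>"] by (simp add: right_diff_distrib)
  ultimately show ?thesis
    using iexp_mean_close[of "\<lambda>\<omega>. t * X \<omega>" "\<lambda>\<omega>. t * Y \<omega>"] assms[THEN L2_measurable]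
    by (simp add: cf_def)
qed

end

interpretation std_normal: real_distribution std_normal_distribution
  by (rule real_dist_normal_dist)

text \<open>Every centred normal law, the Dirac mass included, is a scaling of the standard one.
  This spares the computation of characteristic functions and moments the case of variance
  0.\<close>

lemma normal_law_eq_distr:
  assumes "0 \<le> v"
  shows "normal_law 0 v = distr std_normal_distribution borel (\<lambda>x. sqrt v * x)"
proof (cases "v = 0")
  case True
  have "distr std_normal_distribution borel (\<lambda>x. 0 :: real) = return borel 0"
    by (rule std_normal.distr_const) simp
  then show ?thesis using True by (simp add: normal_law_def)
next
  case False
  with assms have v: "0 < v" by simp
  have "distr std_normal_distribution lborel (\<lambda>x. x) = std_normal_distribution"
    by (rule distr_id2) simp
  then have "distributed std_normal_distribution lborel (\<lambda>x. (sqrt v * x - 0) / sqrt v) std_normal_density"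
    using v by (simp add: distributed_def)
  then have "distributed std_normal_distribution lborel (\<lambda>x. sqrt v * x) (normal_density 0 (sqrt v))"
    using v by (subst std_normal.normal_standard_normal_convert) auto
  then have "distr std_normal_distribution lborel (\<lambda>x. sqrt v * x) = density lborel (normal_density 0 (sqrt v))"
    by (simp add: distributed_def)
  moreover have "distr std_normal_distribution lborel (\<lambda>x. sqrt v * x) = distr std_normal_distribution borel (\<lambda>x. sqrt v * x)"
    by (intro distr_cong) auto
  ultimately show ?thesis using False by (simp add: normal_law_def)
qed

lemma real_distribution_normal_law: "0 \<le> v \<Longrightarrow> real_distribution (normal_law 0 v)"
  by (simp add: normal_law_eq_distr std_normal.real_distribution_distr)

lemma char_normal_law:
  assumes "0 \<le> v"
  shows "char (normal_law 0 v) t = complex_of_real (exp (- (v * t\<^sup>2) / 2))"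
proof -
  have "char (normal_law 0 v) t = cf std_normal_distribution (\<lambda>x. sqrt v * x) t"
    using assms by (simp add: normal_law_eq_distr char_distr_eq_cf)
  also have "\<dots> = char std_normal_distribution (t * sqrt v)"
    unfolding cf_scale by (simp add: cf_def char_def)
  finally show ?thesis using assms by (simp add: char_std_normal_distribution power_mult_distrib mult.commute)
qed

text \<open>The second moment gives the isometry for Wiener integrals, the fourth the one for their
  squares.\<close>

lemma normal_law_moments:
  assumes "0 \<le> v"
  shows "integrable (normal_law 0 v) (\<lambda>x. x ^ k)"
    "(\<integral>x. x\<^sup>2 \<partial>normal_law 0 v) = v" "(\<integral>x. x ^ 4 \<partial>normal_law 0 v) = 3 * v\<^sup>2"
proof -
  have pow: "(\<integral>x. x ^ k \<partial>normal_law 0 v) = (sqrt v)^k * (LINT x|std_normal_distribution. x ^ k)" for k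
    using assms by (simp add: normal_law_eq_distr integral_distr power_mult_distrib)
  show "integrable (normal_law 0 v) (\<lambda>x. x ^ k)"
    using assms integrable_std_normal_distribution_moment[of k]
    by (simp add: normal_law_eq_distr integrable_distr_eq power_mult_distrib)
  show "(\<integral>x. x\<^sup>2 \<partial>normal_law 0 v) = v"
    using std_normal_distribution_even_moments(1)[of 1] assms by (simp add: pow fact_numeral)
  have "sqrt v ^ 4 = (sqrt v ^ 2)^2" by (simp flip: power_mult)
  then show "(\<integral>x. x ^ 4 \<partial>normal_law 0 v) = 3 * v\<^sup>2"
    using std_normal_distribution_even_moments(1)[of 2] assms by (simp add: pow fact_numeral)
qed

context prob_space
begin

lemma distr_eq_normal_lawI:
  assumes "X \<in> borel_measurable M" "0 \<le> v"
    and "\<And>t. cf M X t = complex_of_real (exp (- (v * t\<^sup>2) / 2))"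
  shows "distr M borel X = normal_law 0 v"
proof (rule Levy_uniqueness)
  show "char (distr M borel X) = char (normal_law 0 v)"
    using assms by (simp add: fun_eq_iff char_distr_eq_cf char_normal_law)
qed (use assms real_distribution_normal_law in \<open>auto intro: real_distribution_distr\<close>)

lemma normal_variable:
  assumes X: "X \<in> borel_measurable M" and v: "0 \<le> v" and d: "distr M borel X = normal_law 0 v"
  shows "X \<in> L2 M" "(L2_norm M X)\<^sup>2 = v" "(\<lambda>\<omega>. (X \<omega>)\<^sup>2) \<in> L2 M" "(\<integral>\<omega>. (X \<omega>) ^ 4 \<partial>M) = 3 * v\<^sup>2"
    "cf M X t = complex_of_real (exp (- (v * t\<^sup>2) / 2))" "integrable M (\<lambda>\<omega>. (X \<omega>) ^ 4)"
proof -
  have int: "integrable M (\<lambda>\<omega>. (X \<omega>) ^ k)" for k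
    using normal_law_moments(1)[OF v, of k] X unfolding d[symmetric] by (simp add: integrable_distr_eq)
  have pow: "(\<integral>\<omega>. (X \<omega>) ^ k \<partial>M) = (\<integral>x. x ^ k \<partial>normal_law 0 v)" for k
    using X unfolding d[symmetric] by (simp add: integral_distr)
  show "X \<in> L2 M" using X int by (intro L2I)
  show "(L2_norm M X)\<^sup>2 = v" using pow[of 2] v by (simp add: L2_norm_def normal_law_moments)
  have "((X \<omega>)\<^sup>2)\<^sup>2 = X \<omega> ^ 4" for \<omega> by (simp flip: power_mult)
  then show "(\<lambda>\<omega>. (X \<omega>)\<^sup>2) \<in> L2 M" using X int[of 4] by (intro L2I) auto
  show "(\<integral>\<omega>. (X \<omega>) ^ 4 \<partial>M) = 3 * v\<^sup>2" using pow[of 4] v by (simp add: normal_law_moments)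
  show "cf M X t = complex_of_real (exp (- (v * t\<^sup>2) / 2))"
    using char_distr_eq_cf[OF X] d char_normal_law[OF v] by metis
  show "integrable M (\<lambda>\<omega>. (X \<omega>) ^ 4)" by (rule int)
qed

end

section \<open>Construction of the Wiener integral\<close>

locale brownian =
  fixes M :: "'a measure" and W :: "real \<Rightarrow> 'a \<Rightarrow> real"
  assumes bm: "brownian_motion M W"
begin

sublocale prob_space M
  using bm by (simp add: brownian_motion_def)

lemma W_measurable [measurable]: "0 \<le> t \<Longrightarrow> W t \<in> borel_measurable M"
  using bm by (simp add: brownian_motion_def)

lemma W_0: "AE \<omega> in M. W 0 \<omega> = 0"
  using bm by (simp add: brownian_motion_def)

lemma W_increment:
  assumes "0 \<le> s" "s \<le> t"
  shows "distr M borel (\<lambda>\<omega>. W t \<omega> - W s \<omega>) = normal_law 0 (t - s)"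
proof (cases "s = t")
  case True
  have "distr M borel (\<lambda>\<omega>. 0 :: real) = return borel 0" by (rule distr_const) simp
  then show ?thesis using True by (simp add: normal_law_def)
next
  case False
  then show ?thesis using bm assms by (simp add: brownian_motion_def)
qed

lemma W_normal:
  assumes "0 \<le> t"
  shows "distr M borel (W t) = normal_law 0 t"
proof -
  have "distr M borel (W t) = distr M borel (\<lambda>\<omega>. W t \<omega> - W 0 \<omega>)"
    using W_0 assms by (intro distr_cong_AE) auto
  then show ?thesis using W_increment[of 0 t] assms by simp
qed

lemma W_L2: "0 \<le> t \<Longrightarrow> W t \<in> L2 M"
  using normal_variable(1)[OF W_measurable _ W_normal] by blast

text \<open>The variances of \<open>W s\<close>, \<open>W t\<close> and \<open>W t - W s\<close>
  determine the covariance.\<close>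

lemma inner_W:
  assumes "0 \<le> s" "0 \<le> t"
  shows "L2_inner M (W s) (W t) = min s t"
proof -
  have *: "L2_inner M (W s) (W t) = s" if "0 \<le> s" "s \<le> t" for s t
  proof -
    have t: "0 \<le> t" using that by simp
    have n: "(L2_norm M (W s))\<^sup>2 = s" "(L2_norm M (W t))\<^sup>2 = t"
      using normal_variable(2)[OF W_measurable _ W_normal] that t by blast+
    have "(L2_norm M (\<lambda>\<omega>. W t \<omega> - W s \<omega>))\<^sup>2 = t - s"
      by (rule normal_variable(2)) (use that t W_increment in auto)
    then have "t + s - 2 * L2_inner M (W t) (W s) = t - s"
      using L2_norm_sq_lincomb[OF W_L2 W_L2, of t s 1 "-1"] that t n by simp
    then show ?thesis by (simp add: L2_inner_commute)
  qed
  show ?thesis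
    using *[of s t] *[of t s] assms by (cases "s \<le> t") (auto simp: L2_inner_commute min_def)
qed

sublocale wiener_frame: isometric_frame Rplus M "{0..}" "\<lambda>t. indicator {0..t}" W "L2 Rplus" 1
proof
  show "L2_inner M (W s) (W t) = 1 * L2_inner Rplus (indicator {0..s}) (indicator {0..t})"
    if "s \<in> {0..}" "t \<in> {0..}" for s t
    using that by (simp add: inner_W L2_inner_indicator_Rplus)
qed (auto intro: L2_lincomb indicator_Rplus_L2 W_L2 dense_span_indicator_Rplus)

abbreviation J :: "(real \<Rightarrow> real) \<Rightarrow> 'a \<Rightarrow> real" where
  "J \<equiv> wiener_integral M W"

lemma wiener_integral_spec:
  "continuous_linear_L2 (L2 Rplus) Rplus M J"
  "0 \<le> t \<Longrightarrow> AE \<omega> in M. J (indicator {0..t}) \<omega> = W t \<omega>"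
proof -
  have "\<exists>J. continuous_linear_L2 (L2 Rplus) Rplus M J \<and>
     (\<forall>t\<ge>0. AE \<omega> in M. J (indicator {0..t}) \<omega> = W t \<omega>)"
    using wiener_frame.extension_exists by auto
  from someI_ex[OF this]
  show "continuous_linear_L2 (L2 Rplus) Rplus M J"
    "0 \<le> t \<Longrightarrow> AE \<omega> in M. J (indicator {0..t}) \<omega> = W t \<omega>"
    unfolding wiener_integral_def by blast+
qed

lemma J_L2: "h \<in> L2 Rplus \<Longrightarrow> J h \<in> L2 M"
  using wiener_integral_spec(1) by (simp add: continuous_linear_L2_def)

lemma J_lincomb:
  "g \<in> L2 Rplus \<Longrightarrow> h \<in> L2 Rplus \<Longrightarrow> AE \<omega> in M. J (\<lambda>x. a * g x + b * h x) \<omega> = a * J g \<omega> + b * J h \<omega>"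
  using wiener_integral_spec(1) by (simp add: continuous_linear_L2_def)

lemma J_graph: "h \<in> L2 Rplus \<Longrightarrow> wiener_frame.R h (J h)"
  using wiener_integral_spec by (intro wiener_frame.continuous_linear_graph) auto

lemma J_norm: "h \<in> L2 Rplus \<Longrightarrow> L2_norm M (J h) = L2_norm Rplus h"
  using wiener_frame.R_norm[OF J_graph] by simp

text \<open>Values of \<open>W\<close> at several times are dependent, increments over a common grid
  are not; so the combination is rewritten over the grid of all times that occur in it.\<close>

lemma lincomb_W_increments:
  assumes "snd ` set xs \<subseteq> {0..}"
  shows "\<exists>n t d. 0 \<le> t 0 \<and> mono t \<and>
    (AE \<omega> in M. lincomb W xs \<omega> = (\<Sum>i<n. d i * (W (t (Suc i)) \<omega> - W (t i) \<omega>)))"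
proof -
  \<comment> \<open>The time 0 is added so that \<open>W s\<close> telescopes from the first grid
    point, where \<open>W\<close> vanishes almost surely; it also makes \<open>l\<close>
    nonempty.\<close>
  define l where "l = sorted_list_of_set (insert 0 (snd ` set xs))"
  have fin: "finite (insert 0 (snd ` set xs))" by simp
  have set_l: "set l = insert 0 (snd ` set xs)" unfolding l_def using fin by (rule set_sorted_list_of_set)
  have sl: "sorted l" unfolding l_def by (simp del: sorted_list_of_set_insert_remove)
  have ne: "length l > 0" using set_l by (metis empty_iff insert_iff length_greater_0_conv list.set(1))
  define n where "n = length l - 1"
  \<comment> \<open>Constant after the last grid point, so that \<open>t\<close> is monotone on all
    natural numbers, as the definition of Brownian motion demands.\<close>
  define t where "t i = l ! min i n" for i
  have mono: "mono t"
  proof (rule monoI)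
    fix i j :: nat assume "i \<le> j"
    moreover have "n < length l" using ne by (simp add: n_def)
    ultimately have "min i n \<le> min j n" "min j n < length l" by auto
    then show "t i \<le> t j" unfolding t_def using sl by (simp add: sorted_nth_mono)
  qed
  obtain j0 where j0: "j0 < length l" "l ! j0 = 0" using set_l by (metis in_set_conv_nth insertI1)
  have t0': "t 0 \<in> set l" unfolding t_def using ne by simp
  have "t 0 \<le> 0" using sorted_nth_mono[OF sl, of 0 j0] j0 by (simp add: t_def)
  moreover have ge: "0 \<le> s" if "s \<in> set l" for s using that set_l assms by auto
  ultimately have t0: "t 0 = 0" using t0' by (meson order_antisym)
  have *: "snd ` set ys \<subseteq> set l \<Longrightarrow> \<exists>d. AE \<omega> in M. lincomb W ys \<omega> = (\<Sum>i<n. d i * (W (t (Suc i)) \<omega> - W (t i) \<omega>))" for ys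
  proof (induction ys)
    case Nil
    then show ?case by (intro exI[of _ "\<lambda>_. 0"]) simp
  next
    case (Cons y ys)
    obtain c s where y: "y = (c, s)" by fastforce
    from Cons obtain d where d: "AE \<omega> in M. lincomb W ys \<omega> = (\<Sum>i<n. d i * (W (t (Suc i)) \<omega> - W (t i) \<omega>))"
      by auto
    have "s \<in> set l" using Cons.prems y by simp
    then obtain j where j: "j < length l" "l ! j = s" by (metis in_set_conv_nth)
    have jn: "j \<le> n" and tj: "t j = s" using j by (auto simp: n_def t_def min_def)
    have "AE \<omega> in M. lincomb W (y # ys) \<omega> =
        (\<Sum>i<n. ((if i < j then c else 0) + d i) * (W (t (Suc i)) \<omega> - W (t i) \<omega>))"
      using d W_0
    proof eventually_elim
      case (elim \<omega>)
      let ?D = "\<lambda>i. W (t (Suc i)) \<omega> - W (t i) \<omega>"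
      have "W s \<omega> = (\<Sum>i<j. ?D i)"
        using sum_lessThan_telescope[of "\<lambda>i. W (t i) \<omega>" j] elim(2) by (simp add: tj t0)
      then have "c * W s \<omega> = (\<Sum>i<j. c * ?D i)" by (simp add: sum_distrib_left)
      also have "\<dots> = (\<Sum>i<n. (if i < j then c else 0) * ?D i)"
        using jn by (intro sum.mono_neutral_cong_left) auto
      finally show ?case using elim(1) by (simp add: y lincomb_Cons sum.distrib distrib_right)
    qed
    then show ?case by (intro exI[of _ "\<lambda>i. (if i < j then c else 0) + d i"])
  qed
  from *[of xs] obtain d where "AE \<omega> in M. lincomb W xs \<omega> = (\<Sum>i<n. d i * (W (t (Suc i)) \<omega> - W (t i) \<omega>))"
    using set_l by auto
  then show ?thesis using mono t0 by (intro exI[of _ n] exI[of _ t] exI[of _ d]) simp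
qed

lemma lincomb_W_normal:
  assumes xs: "snd ` set xs \<subseteq> {0..}"
  shows "distr M borel (lincomb W xs) =
    normal_law 0 ((L2_norm Rplus (lincomb (\<lambda>t. indicator {0..t}) xs))\<^sup>2)"
proof -
  obtain n t d where t: "0 \<le> t 0" "mono t"
    and eq: "AE \<omega> in M. lincomb W xs \<omega> = (\<Sum>i<n. d i * (W (t (Suc i)) \<omega> - W (t i) \<omega>))"
    using lincomb_W_increments[OF xs] by blast
  have tpos: "0 \<le> t i" for i using t monoD[OF t(2), of 0 i] by simp
  have tle: "t i \<le> t (Suc i)" for i using monoD[OF t(2)] by simp
  have m: "lincomb W xs \<in> borel_measurable M"
    using wiener_frame.lincomb_psi_L2[OF xs] by (rule L2_measurable)
  define v where "v = (\<Sum>i<n. (d i)\<^sup>2 * (t (Suc i) - t i))"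
  have v: "0 \<le> v" unfolding v_def using tle by (intro sum_nonneg mult_nonneg_nonneg) auto
  define D where "D i \<omega> = W (t (Suc i)) \<omega> - W (t i) \<omega>" for i \<omega>
  have Dm: "D i \<in> borel_measurable M" for i unfolding D_def using tpos by measurable
  have ind: "indep_vars (\<lambda>_. borel) (\<lambda>i \<omega>. D i \<omega>) {..<n}"
    unfolding D_def using bm t by (simp add: brownian_motion_def)
  have ind2: "indep_vars (\<lambda>_. borel) (\<lambda>i \<omega>. d i * D i \<omega>) {..<n}"
    by (rule indep_vars_compose2[OF ind]) auto
  have "distr M borel (lincomb W xs) = normal_law 0 v"
  proof (rule distr_eq_normal_lawI[OF m v])
    fix s
    have "cf M (lincomb W xs) s = cf M (\<lambda>\<omega>. \<Sum>i<n. d i * D i \<omega>) s"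
    proof (intro cf_cong_AE m)
      show "(\<lambda>\<omega>. \<Sum>i<n. d i * D i \<omega>) \<in> borel_measurable M" using Dm by simp
      show "AE \<omega> in M. lincomb W xs \<omega> = (\<Sum>i<n. d i * D i \<omega>)" using eq by (simp add: D_def)
    qed
    also have "\<dots> = char (distr M borel (\<lambda>\<omega>. \<Sum>i<n. d i * D i \<omega>)) s"
      using Dm by (subst char_distr_eq_cf) auto
    also have "\<dots> = (\<Prod>i<n. char (distr M borel (\<lambda>\<omega>. d i * D i \<omega>)) s)"
      by (rule char_distr_sum[OF ind2])
    also have "\<dots> = (\<Prod>i<n. complex_of_real (exp (- ((t (Suc i) - t i) * (s * d i)\<^sup>2) / 2)))"
    proof (rule prod.cong[OF refl])
      fix i
      have "char (distr M borel (\<lambda>\<omega>. d i * D i \<omega>)) s = cf M (D i) (s * d i)"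
        using Dm by (subst char_distr_eq_cf) (auto simp: cf_scale)
      also have "\<dots> = complex_of_real (exp (- ((t (Suc i) - t i) * (s * d i)\<^sup>2) / 2))"
        by (rule normal_variable(5)[OF Dm])
          (use tle tpos W_increment in \<open>auto simp: D_def[abs_def]\<close>)
      finally show "char (distr M borel (\<lambda>\<omega>. d i * D i \<omega>)) s = complex_of_real (exp (- ((t (Suc i) - t i) * (s * d i)\<^sup>2) / 2))" .
    qed
    also have "\<dots> = complex_of_real (exp (\<Sum>i<n. - ((t (Suc i) - t i) * (s * d i)\<^sup>2) / 2))"
      by (simp add: exp_sum)
    also have "(\<Sum>i<n. - ((t (Suc i) - t i) * (s * d i)\<^sup>2) / 2) = - (v * s\<^sup>2) / 2"
      unfolding v_def by (simp add: sum_distrib_left sum_negf power_mult_distrib mult.assoc mult.commute mult.left_commute flip: sum_divide_distrib)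
    finally show "cf M (lincomb W xs) s = complex_of_real (exp (- (v * s\<^sup>2) / 2))" .
  qed
  \<comment> \<open>\<open>v\<close> was computed from the grid; the isometry identifies it with the
    squared norm of the step function.\<close>
  moreover from normal_variable(2)[OF m v this]
  have "v = (L2_norm Rplus (lincomb (\<lambda>t. indicator {0..t}) xs))\<^sup>2"
    using wiener_frame.norm_lincomb_psi[OF xs] by simp
  ultimately show ?thesis by simp
qed

end

section \<open>Double Wiener integrals\<close>

lemma (in isometric_frame) R_sequence:
  assumes "R f X"
  shows "\<exists>xs. (\<forall>n. snd ` set (xs n) \<subseteq> T) \<and>
    (\<lambda>n. L2_norm A (\<lambda>x. lincomb \<phi> (xs n) x - f x)) \<longlonglongrightarrow> 0 \<and>
    (\<lambda>n. L2_norm B (\<lambda>x. lincomb \<psi> (xs n) x - X x)) \<longlonglongrightarrow> 0"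
proof -
  have "\<exists>xs. snd ` set xs \<subseteq> T \<and> L2_norm A (\<lambda>x. lincomb \<phi> xs x - f x) < inverse (real (Suc n)) \<and>
      L2_norm B (\<lambda>x. lincomb \<psi> xs x - X x) < inverse (real (Suc n))" for n
    using assms unfolding graph_closure_def by simp
  then obtain xs where xs: "\<And>n. snd ` set (xs n) \<subseteq> T"
    "\<And>n. L2_norm A (\<lambda>x. lincomb \<phi> (xs n) x - f x) < inverse (real (Suc n))"
    "\<And>n. L2_norm B (\<lambda>x. lincomb \<psi> (xs n) x - X x) < inverse (real (Suc n))" by metis
  have "(\<lambda>n. L2_norm A (\<lambda>x. lincomb \<phi> (xs n) x - f x)) \<longlonglongrightarrow> 0"
    by (rule tendsto_sandwich[OF _ _ tendsto_const LIMSEQ_inverse_real_of_nat])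
      (auto intro!: always_eventually less_imp_le xs(2) simp del: of_nat_Suc)
  moreover have "(\<lambda>n. L2_norm B (\<lambda>x. lincomb \<psi> (xs n) x - X x)) \<longlonglongrightarrow> 0"
    by (rule tendsto_sandwich[OF _ _ tendsto_const LIMSEQ_inverse_real_of_nat])
      (auto intro!: always_eventually less_imp_le xs(3) simp del: of_nat_Suc)
  ultimately show ?thesis using xs(1) by blast
qed

lemma L2_norm_tendsto:
  assumes "\<And>n. u n \<in> L2 M" "f \<in> L2 M" "(\<lambda>n. L2_norm M (\<lambda>x. u n x - f x)) \<longlonglongrightarrow> 0"
  shows "(\<lambda>n. L2_norm M (u n)) \<longlonglongrightarrow> L2_norm M f"
proof -
  have "(\<lambda>n. L2_norm M (u n) - L2_norm M f) \<longlonglongrightarrow> 0"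
    by (rule Lim_null_comparison[OF always_eventually assms(3)]) (simp add: L2_norm_diff_le assms)
  then show ?thesis by (simp add: LIM_zero_iff)
qed

section \<open>Normality and fourth moments of Wiener integrals\<close>

context brownian
begin

lemma J_measurable [measurable]: "h \<in> L2 Rplus \<Longrightarrow> J h \<in> borel_measurable M"
  using J_L2 by (rule L2_measurable)

lemma cf_L2_limit:
  assumes "\<And>n. u n \<in> L2 M" "X \<in> L2 M" "(\<lambda>n. L2_norm M (\<lambda>\<omega>. u n \<omega> - X \<omega>)) \<longlonglongrightarrow> 0"
  shows "(\<lambda>n. cf M (u n) t) \<longlonglongrightarrow> cf M X t"
proof -
  have "(\<lambda>n. cf M (u n) t - cf M X t) \<longlonglongrightarrow> 0"
  proof (rule Lim_null_comparison[OF always_eventually])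
    show "\<forall>n. cmod (cf M (u n) t - cf M X t) \<le> \<bar>t\<bar> * L2_norm M (\<lambda>\<omega>. u n \<omega> - X \<omega>)"
      using assms by (simp add: cf_close)
    show "(\<lambda>n. \<bar>t\<bar> * L2_norm M (\<lambda>\<omega>. u n \<omega> - X \<omega>)) \<longlonglongrightarrow> 0"
      using tendsto_mult_right_zero[OF assms(3)] by simp
  qed
  then show ?thesis by (simp add: LIM_zero_iff)
qed

text \<open>Normality survives L2 limits: the characteristic functions converge, and so do the
  variances, which are the squared norms of the approximating step functions.\<close>

lemma J_normal:
  assumes h: "h \<in> L2 Rplus"
  shows "distr M borel (J h) = normal_law 0 ((L2_norm Rplus h)\<^sup>2)"
proof (rule distr_eq_normal_lawI)
  fix t
  let ?\<phi> = "\<lambda>t. indicator {0..t} :: real \<Rightarrow> real"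
  obtain xs where xs: "\<And>n. snd ` set (xs n) \<subseteq> {0..}"
    "(\<lambda>n. L2_norm Rplus (\<lambda>x. lincomb ?\<phi> (xs n) x - h x)) \<longlonglongrightarrow> 0"
    "(\<lambda>n. L2_norm M (\<lambda>x. lincomb W (xs n) x - J h x)) \<longlonglongrightarrow> 0"
    using wiener_frame.R_sequence[OF J_graph[OF h]] by blast
  have 1: "(\<lambda>n. cf M (lincomb W (xs n)) t) \<longlonglongrightarrow> cf M (J h) t"
    by (intro cf_L2_limit wiener_frame.lincomb_psi_L2 xs J_L2 h)
  have lim: "(\<lambda>n. L2_norm Rplus (lincomb ?\<phi> (xs n))) \<longlonglongrightarrow> L2_norm Rplus h"
    by (intro L2_norm_tendsto wiener_frame.lincomb_phi_L2 xs h)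
  have eq: "cf M (lincomb W (xs n)) t =
      complex_of_real (exp (- ((L2_norm Rplus (lincomb ?\<phi> (xs n)))\<^sup>2 * t\<^sup>2) / 2))" for n
    by (rule normal_variable(5)[OF L2_measurable[OF wiener_frame.lincomb_psi_L2[OF xs(1)]] _ lincomb_W_normal[OF xs(1)]])
      simp
  have "(\<lambda>n. cf M (lincomb W (xs n)) t) \<longlonglongrightarrow> complex_of_real (exp (- ((L2_norm Rplus h)\<^sup>2 * t\<^sup>2) / 2))"
    unfolding eq by (intro tendsto_intros lim) simp
  from LIMSEQ_unique[OF 1 this]
  show "cf M (J h) t = complex_of_real (exp (- ((L2_norm Rplus h)\<^sup>2 * t\<^sup>2) / 2))" .
qed (use h in auto)

lemma J_square_L2: "h \<in> L2 Rplus \<Longrightarrow> (\<lambda>\<omega>. (J h \<omega>)\<^sup>2) \<in> L2 M"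
  using normal_variable(3)[OF J_measurable _ J_normal] by simp

lemma J_fourth_moment: "h \<in> L2 Rplus \<Longrightarrow> (\<integral>\<omega>. (J h \<omega>) ^ 4 \<partial>M) = 3 * (L2_norm Rplus h) ^ 4"
proof -
  assume h: "h \<in> L2 Rplus"
  have "((L2_norm Rplus h)\<^sup>2)\<^sup>2 = (L2_norm Rplus h) ^ 4" by (simp flip: power_mult)
  then show ?thesis using normal_variable(4)[OF J_measurable[OF h] _ J_normal[OF h]] by simp
qed

lemma const_L2: "(\<lambda>\<omega>. c) \<in> L2 M"
  by (rule L2I) auto

lemma J_square_centered_L2: "h \<in> L2 Rplus \<Longrightarrow> (\<lambda>\<omega>. (J h \<omega>)\<^sup>2 - c) \<in> L2 M"
  by (intro L2_diff J_square_L2 const_L2)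

text \<open>By polarization, from the fourth moments of \<open>J (g \<plusminus> h)\<close>:
  \<open>(x + y)\<^sup>4 + (x - y)\<^sup>4 = 2 x\<^sup>4 + 12 x\<^sup>2 y\<^sup>2 + 2 y\<^sup>4\<close>.\<close>

lemma J_mixed_fourth_moment:
  assumes g: "g \<in> L2 Rplus" and h: "h \<in> L2 Rplus"
  shows "(\<integral>\<omega>. (J g \<omega>)\<^sup>2 * (J h \<omega>)\<^sup>2 \<partial>M) =
    (L2_norm Rplus g)\<^sup>2 * (L2_norm Rplus h)\<^sup>2 + 2 * (L2_inner Rplus g h)\<^sup>2"
proof -
  define s t c where "s = (L2_norm Rplus g)\<^sup>2" and "t = (L2_norm Rplus h)\<^sup>2" and "c = L2_inner Rplus g h"
  have n4: "(L2_norm Rplus u) ^ 4 = ((L2_norm Rplus u)\<^sup>2)\<^sup>2" for u by (simp flip: power_mult)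
  have m4: "(\<integral>\<omega>. (J g \<omega> + b * J h \<omega>) ^ 4 \<partial>M) = 3 * (s + 2 * b * c + b\<^sup>2 * t)\<^sup>2"
    and i4: "integrable M (\<lambda>\<omega>. (J g \<omega> + b * J h \<omega>) ^ 4)" for b
  proof -
    have gh: "(\<lambda>x. 1 * g x + b * h x) \<in> L2 Rplus" using g h by (rule L2_lincomb)
    have ae: "AE \<omega> in M. (J (\<lambda>x. 1 * g x + b * h x) \<omega>) ^ 4 = (J g \<omega> + b * J h \<omega>) ^ 4"
      using J_lincomb[OF g h, of 1 b] by auto
    have "(\<integral>\<omega>. (J g \<omega> + b * J h \<omega>) ^ 4 \<partial>M) = (\<integral>\<omega>. (J (\<lambda>x. 1 * g x + b * h x) \<omega>) ^ 4 \<partial>M)"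
      using ae J_measurable[OF g] J_measurable[OF h] J_measurable[OF gh] by (intro integral_cong_AE) auto
    also have "\<dots> = 3 * ((L2_norm Rplus (\<lambda>x. 1 * g x + b * h x))\<^sup>2)\<^sup>2"
      unfolding J_fourth_moment[OF gh] n4 by (rule refl)
    also have "(L2_norm Rplus (\<lambda>x. 1 * g x + b * h x))\<^sup>2 = s + 2 * b * c + b\<^sup>2 * t"
      unfolding L2_norm_sq_lincomb[OF g h] by (simp add: s_def t_def c_def)
    finally show "(\<integral>\<omega>. (J g \<omega> + b * J h \<omega>) ^ 4 \<partial>M) = 3 * (s + 2 * b * c + b\<^sup>2 * t)\<^sup>2" .
    have "integrable M (\<lambda>\<omega>. (J (\<lambda>x. 1 * g x + b * h x) \<omega>) ^ 4)"
      by (rule normal_variable(6)[OF J_measurable[OF gh] _ J_normal[OF gh]]) simp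
    then show "integrable M (\<lambda>\<omega>. (J g \<omega> + b * J h \<omega>) ^ 4)"
      using ae J_measurable[OF g] J_measurable[OF h] J_measurable[OF gh]
      by (subst integrable_cong_AE[of _ _ "\<lambda>\<omega>. (J (\<lambda>x. 1 * g x + b * h x) \<omega>) ^ 4"]) auto
  qed
  have ig: "integrable M (\<lambda>\<omega>. (J g \<omega>) ^ 4)" using i4[of 0] by simp
  have ih: "integrable M (\<lambda>\<omega>. (J h \<omega>) ^ 4)"
    by (rule normal_variable(6)[OF J_measurable[OF h] _ J_normal[OF h]]) simp
  have i22: "integrable M (\<lambda>\<omega>. (J g \<omega>)\<^sup>2 * (J h \<omega>)\<^sup>2)"
    by (intro L2_integrable_mult J_square_L2 g h)
  have mg: "(\<integral>\<omega>. (J g \<omega>) ^ 4 \<partial>M) = 3 * s\<^sup>2" and mh: "(\<integral>\<omega>. (J h \<omega>) ^ 4 \<partial>M) = 3 * t\<^sup>2"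
    unfolding J_fourth_moment[OF g] J_fourth_moment[OF h] n4 s_def t_def by (rule refl)+
  have "(\<lambda>\<omega>. (J g \<omega> + 1 * J h \<omega>) ^ 4 + (J g \<omega> + (- 1) * J h \<omega>) ^ 4) =
      (\<lambda>\<omega>. 2 * (J g \<omega>) ^ 4 + 12 * ((J g \<omega>)\<^sup>2 * (J h \<omega>)\<^sup>2) + 2 * (J h \<omega>) ^ 4)"
    by (rule ext) (simp add: power4_eq_xxxx power2_eq_square algebra_simps)
  then have "(\<integral>\<omega>. (J g \<omega> + 1 * J h \<omega>) ^ 4 + (J g \<omega> + (- 1) * J h \<omega>) ^ 4 \<partial>M) =
      (\<integral>\<omega>. 2 * (J g \<omega>) ^ 4 + 12 * ((J g \<omega>)\<^sup>2 * (J h \<omega>)\<^sup>2) + 2 * (J h \<omega>) ^ 4 \<partial>M)"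
    by simp
  also have "\<dots> = 2 * (3 * s\<^sup>2) + 12 * (\<integral>\<omega>. (J g \<omega>)\<^sup>2 * (J h \<omega>)\<^sup>2 \<partial>M) + 2 * (3 * t\<^sup>2)"
    using ig ih i22 mg mh by simp
  also have "(\<integral>\<omega>. (J g \<omega> + 1 * J h \<omega>) ^ 4 + (J g \<omega> + (- 1) * J h \<omega>) ^ 4 \<partial>M) =
      3 * (s + 2 * 1 * c + 1\<^sup>2 * t)\<^sup>2 + 3 * (s + 2 * (- 1) * c + (- 1)\<^sup>2 * t)\<^sup>2"
    by (subst Bochner_Integration.integral_add[OF i4 i4]) (simp only: m4)
  finally have "12 * (\<integral>\<omega>. (J g \<omega>)\<^sup>2 * (J h \<omega>)\<^sup>2 \<partial>M) = 12 * (s * t + 2 * c\<^sup>2)"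
    by (simp add: power2_eq_square algebra_simps)
  then show ?thesis by (simp add: s_def t_def c_def)
qed

lemma J_square_mean:
  assumes "h \<in> L2 Rplus"
  shows "integrable M (\<lambda>\<omega>. (J h \<omega>)\<^sup>2)" "(\<integral>\<omega>. (J h \<omega>)\<^sup>2 \<partial>M) = (L2_norm Rplus h)\<^sup>2"
  using L2_integrable_square[OF J_L2[OF assms]] J_norm[OF assms] L2_norm_sq[of M "J h"]
  by (simp_all add: L2_inner_def power2_eq_square)

text \<open>The mixed moment exceeds the product of the two variances by twice the squared
  covariance. This is the origin of the constant 2 in the isometry of the double integral.\<close>

lemma J_square_inner:
  assumes g: "g \<in> L2 Rplus" and h: "h \<in> L2 Rplus"
  shows "L2_inner M (\<lambda>\<omega>. (J g \<omega>)\<^sup>2 - (L2_norm Rplus g)\<^sup>2) (\<lambda>\<omega>. (J h \<omega>)\<^sup>2 - (L2_norm Rplus h)\<^sup>2) =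
    2 * (L2_inner Rplus g h)\<^sup>2"
proof -
  define s t where "s = (L2_norm Rplus g)\<^sup>2" and "t = (L2_norm Rplus h)\<^sup>2"
  have i22: "integrable M (\<lambda>\<omega>. (J g \<omega>)\<^sup>2 * (J h \<omega>)\<^sup>2)"
    by (intro L2_integrable_mult J_square_L2 g h)
  have "(\<lambda>\<omega>. ((J g \<omega>)\<^sup>2 - s) * ((J h \<omega>)\<^sup>2 - t)) =
      (\<lambda>\<omega>. (J g \<omega>)\<^sup>2 * (J h \<omega>)\<^sup>2 - t * (J g \<omega>)\<^sup>2 - s * (J h \<omega>)\<^sup>2 + s * t)"
    by (simp add: fun_eq_iff algebra_simps)
  then have "L2_inner M (\<lambda>\<omega>. (J g \<omega>)\<^sup>2 - s) (\<lambda>\<omega>. (J h \<omega>)\<^sup>2 - t) =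
      (\<integral>\<omega>. (J g \<omega>)\<^sup>2 * (J h \<omega>)\<^sup>2 - t * (J g \<omega>)\<^sup>2 - s * (J h \<omega>)\<^sup>2 + s * t \<partial>M)"
    by (simp add: L2_inner_def)
  also have "\<dots> = (\<integral>\<omega>. (J g \<omega>)\<^sup>2 * (J h \<omega>)\<^sup>2 \<partial>M) - t * s - s * t + s * t"
    using i22 J_square_mean[OF g] J_square_mean[OF h] by (simp add: s_def t_def prob_space)
  finally show ?thesis using J_mixed_fourth_moment[OF g h] by (simp add: s_def t_def)
qed

sublocale double_frame: isometric_frame Rplus2 M "L2 Rplus" "\<lambda>h. tensor h h"
  "\<lambda>h \<omega>. (J h \<omega>)\<^sup>2 - (L2_norm Rplus h)\<^sup>2" L2_sym 2
proof
  show "L2_inner M (\<lambda>\<omega>. (J g \<omega>)\<^sup>2 - (L2_norm Rplus g)\<^sup>2) (\<lambda>\<omega>. (J h \<omega>)\<^sup>2 - (L2_norm Rplus h)\<^sup>2) =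
      2 * L2_inner Rplus2 (tensor g g) (tensor h h)" if "g \<in> L2 Rplus" "h \<in> L2 Rplus" for g h
    unfolding J_square_inner[OF that] L2_inner_tensor[OF that(1,1,2,2)] by (simp add: power2_eq_square)
qed (auto intro: L2_sym_lincomb tensor_sym J_square_centered_L2 dense_span_tensor_sym L2_sym_subset[THEN subsetD])

abbreviation I2 :: "(real \<times> real \<Rightarrow> real) \<Rightarrow> 'a \<Rightarrow> real" where
  "I2 \<equiv> double_wiener_integral M W"

lemma double_wiener_integral_spec:
  "continuous_linear_L2 L2_sym Rplus2 M I2"
  "h \<in> L2 Rplus \<Longrightarrow> AE \<omega> in M. I2 (tensor h h) \<omega> = (J h \<omega>)\<^sup>2 - (L2_norm Rplus h)\<^sup>2"
proof -
  have n: "(\<integral>t. (h t)\<^sup>2 \<partial>Rplus) = (L2_norm Rplus h)\<^sup>2" for h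
    by (simp add: L2_norm_def)
  have "\<exists>I. continuous_linear_L2 L2_sym Rplus2 M I \<and>
     (\<forall>h\<in>L2 Rplus. AE \<omega> in M. I (\<lambda>(x, y). h x * h y) \<omega> = (J h \<omega>)\<^sup>2 - (\<integral>t. (h t)\<^sup>2 \<partial>Rplus))"
    using double_frame.extension_exists unfolding n tensor_def by blast
  from someI_ex[OF this]
  show "continuous_linear_L2 L2_sym Rplus2 M I2"
    "h \<in> L2 Rplus \<Longrightarrow> AE \<omega> in M. I2 (tensor h h) \<omega> = (J h \<omega>)\<^sup>2 - (L2_norm Rplus h)\<^sup>2"
    unfolding double_wiener_integral_def n tensor_def by blast+
qed

lemma I2_graph: "f \<in> L2_sym \<Longrightarrow> double_frame.R f (I2 f)"
  using double_wiener_integral_spec by (intro double_frame.continuous_linear_graph) auto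

lemma I2_L2: "f \<in> L2_sym \<Longrightarrow> I2 f \<in> L2 M"
  using double_wiener_integral_spec(1) by (simp add: continuous_linear_L2_def)

lemma I2_diff_norm:
  assumes "f \<in> L2_sym" "g \<in> L2_sym"
  shows "L2_norm M (\<lambda>\<omega>. I2 f \<omega> - I2 g \<omega>) = sqrt 2 * L2_norm Rplus2 (\<lambda>z. f z - g z)"
proof -
  have "double_frame.R (\<lambda>z. 1 * f z + (- 1) * g z) (\<lambda>\<omega>. 1 * I2 f \<omega> + (- 1) * I2 g \<omega>)"
    by (intro double_frame.R_lincomb I2_graph assms)
  from double_frame.R_norm[OF this] show ?thesis by simp
qed

text \<open>In the closed graph a finite combination is approximated by itself, so on such kernels
  the double integral is an explicit quadratic expression in Wiener integrals.\<close>

lemma I2_lincomb_tensor: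
  fixes n :: nat
  assumes "\<And>i. i < n \<Longrightarrow> u i \<in> L2 Rplus" "f \<in> L2_sym"
    "AE z in Rplus2. f z = (\<Sum>i<n. l i * tensor (u i) (u i) z)"
  shows "AE \<omega> in M. I2 f \<omega> = (\<Sum>i<n. l i * ((J (u i) \<omega>)\<^sup>2 - (L2_norm Rplus (u i))\<^sup>2))"
proof -
  let ?xs = "map (\<lambda>i. (l i, u i)) [0..<n]"
  let ?f = "\<lambda>z. \<Sum>i<n. l i * tensor (u i) (u i) z"
  let ?X = "\<lambda>\<omega>. \<Sum>i<n. l i * ((J (u i) \<omega>)\<^sup>2 - (L2_norm Rplus (u i))\<^sup>2)"
  have T: "snd ` set ?xs \<subseteq> L2 Rplus" using assms(1) by auto
  have lc: "lincomb p ?xs = (\<lambda>x. \<Sum>i<n. l i * p (u i) x)" for p :: "(real \<Rightarrow> real) \<Rightarrow> 'c \<Rightarrow> real"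
    by (simp add: lincomb_def fun_eq_iff o_def interv_sum_list_conv_sum_set_nat atLeast0LessThan)
  have R: "double_frame.R ?f ?X"
    using double_frame.lincomb_phi_L2[OF T] double_frame.lincomb_psi_L2[OF T] T
    unfolding graph_closure_def lc by (intro conjI allI impI exI[of _ ?xs]) (simp_all only: lc, simp_all)
  have fL: "f \<in> L2 Rplus2" "?f \<in> L2 Rplus2"
    using assms(2) L2_sym_subset R by (auto simp: graph_closure_def)
  have "L2_norm Rplus2 (\<lambda>z. f z - ?f z) = 0"
    using assms(3) by (subst L2_norm_eq_0_iff[OF L2_diff[OF fL]]) auto
  from double_frame.R_unique[OF I2_graph[OF assms(2)] R this] show ?thesis .
qed

end

section \<open>Factorization of joint characteristic functions\<close>

context prob_space
begin

text \<open>Reweighting by \<open>U\<close> divided by its mean gives a probability measure under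
  which \<open>X\<close> has the same characteristic function as under \<open>M\<close>, hence the
  same law. So any function of \<open>X\<close> has the same mean under both measures. If the mean
  is 0, then \<open>U\<close> vanishes almost everywhere.\<close>

lemma decouple_nonneg:
  fixes U :: "'a \<Rightarrow> real" and g :: "real \<Rightarrow> complex"
  assumes X: "X \<in> borel_measurable M" and U: "U \<in> borel_measurable M" "\<And>\<omega>. 0 \<le> U \<omega>" "\<And>\<omega>. U \<omega> \<le> K"
    and char: "\<And>t. (CLINT \<omega>|M. U \<omega> *\<^sub>R iexp (t * X \<omega>)) = (\<integral>\<omega>. U \<omega> \<partial>M) *\<^sub>R (CLINT \<omega>|M. iexp (t * X \<omega>))"
    and g: "g \<in> borel_measurable borel"
  shows "(CLINT \<omega>|M. U \<omega> *\<^sub>R g (X \<omega>)) = (\<integral>\<omega>. U \<omega> \<partial>M) *\<^sub>R (CLINT \<omega>|M. g (X \<omega>))"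
proof -
  define m where "m = (\<integral>\<omega>. U \<omega> \<partial>M)"
  have Ui: "integrable M U"
    by (rule integrable_const_bound[of _ K]) (use U in auto)
  have m0: "0 \<le> m" unfolding m_def using U by (intro integral_nonneg_AE) auto
  show ?thesis
  proof (cases "m = 0")
    case True
    then have "AE \<omega> in M. U \<omega> = 0"
      using integral_nonneg_eq_0_iff_AE[OF Ui] U by (simp add: m_def)
    then have "AE \<omega> in M. U \<omega> *\<^sub>R g (X \<omega>) = 0" by eventually_elim simp
    then have "(CLINT \<omega>|M. U \<omega> *\<^sub>R g (X \<omega>)) = 0" by (rule integral_eq_zero_AE)
    then show ?thesis using True by (simp add: m_def)
  next
    case False
    with m0 have m: "m > 0" by simp
    let ?w = "\<lambda>\<omega>. U \<omega> / m"
    define N where "N = density M ?w"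
    have wm [measurable]: "?w \<in> borel_measurable M" using U(1) by measurable
    have w0: "AE \<omega> in M. 0 \<le> ?w \<omega>" using U(2) m by simp
    have "emeasure N (space N) = (\<integral>\<^sup>+\<omega>. ennreal (?w \<omega>) \<partial>M)"
      unfolding N_def by (subst emeasure_density) (auto cong: nn_integral_cong)
    also have "\<dots> = ennreal (\<integral>\<omega>. ?w \<omega> \<partial>M)" using Ui w0 by (intro nn_integral_eq_integral) auto
    also have "(\<integral>\<omega>. ?w \<omega> \<partial>M) = 1" using m by (simp add: m_def)
    finally interpret N: prob_space N by (intro prob_spaceI) simp
    have XN: "X \<in> borel_measurable N" using X by (simp add: N_def)
    have intN: "(CLINT \<omega>|N. k (X \<omega>)) = (1 / m) *\<^sub>R (CLINT \<omega>|M. U \<omega> *\<^sub>R k (X \<omega>))"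
      if k: "k \<in> borel_measurable borel" for k :: "real \<Rightarrow> complex"
    proof -
      have "(CLINT \<omega>|N. k (X \<omega>)) = (CLINT \<omega>|M. ?w \<omega> *\<^sub>R k (X \<omega>))"
        unfolding N_def using w0 X k by (intro integral_density) auto
      also have "\<dots> = (CLINT \<omega>|M. (1 / m) *\<^sub>R (U \<omega> *\<^sub>R k (X \<omega>)))" by simp
      finally show ?thesis by (simp only: integral_scaleR_right)
    qed
    have "distr N borel X = distr M borel X"
    proof (rule Levy_uniqueness)
      show "real_distribution (distr N borel X)" using XN by (rule N.real_distribution_distr)
      show "real_distribution (distr M borel X)" using X by (rule real_distribution_distr)
      show "char (distr N borel X) = char (distr M borel X)"
      proof
        fix t
        have "char (distr N borel X) t = (CLINT \<omega>|N. iexp (t * X \<omega>))"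
          using char_distr_eq_cf[OF XN] by (simp add: cf_def)
        also have "\<dots> = (1 / m) *\<^sub>R (CLINT \<omega>|M. U \<omega> *\<^sub>R iexp (t * X \<omega>))" by (rule intN) measurable
        also have "\<dots> = char (distr M borel X) t"
          unfolding char using m char_distr_eq_cf[OF X] by (simp add: cf_def flip: m_def)
        finally show "char (distr N borel X) t = char (distr M borel X) t" .
      qed
    qed
    then have "(CLINT x|distr N borel X. g x) = (CLINT x|distr M borel X. g x)" by simp
    then have "(CLINT \<omega>|N. g (X \<omega>)) = (CLINT \<omega>|M. g (X \<omega>))"
      using X XN g by (simp add: integral_distr)
    then have "m *\<^sub>R (CLINT \<omega>|M. g (X \<omega>)) = m *\<^sub>R ((1 / m) *\<^sub>R (CLINT \<omega>|M. U \<omega> *\<^sub>R g (X \<omega>)))"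
      by (simp only: intN[OF g])
    then show ?thesis using m by (simp add: m_def[symmetric])
  qed
qed

text \<open>Adding the bound \<open>K\<close> makes the weight nonnegative. Constants decouple
  trivially, so \<open>K\<close> can be subtracted again.\<close>

lemma decouple_real:
  fixes U :: "'a \<Rightarrow> real" and g :: "real \<Rightarrow> complex"
  assumes X: "X \<in> borel_measurable M" and U: "U \<in> borel_measurable M" "\<And>\<omega>. \<bar>U \<omega>\<bar> \<le> K"
    and char: "\<And>t. (CLINT \<omega>|M. U \<omega> *\<^sub>R iexp (t * X \<omega>)) = (\<integral>\<omega>. U \<omega> \<partial>M) *\<^sub>R (CLINT \<omega>|M. iexp (t * X \<omega>))"
    and g: "g \<in> borel_measurable borel" "\<And>x. cmod (g x) \<le> B"
  shows "(CLINT \<omega>|M. U \<omega> *\<^sub>R g (X \<omega>)) = (\<integral>\<omega>. U \<omega> \<partial>M) *\<^sub>R (CLINT \<omega>|M. g (X \<omega>))"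
proof -
  have Ui: "integrable M U"
    by (rule integrable_const_bound[of _ K]) (use U in auto)
  have K0: "0 \<le> K" using U(2)[of undefined] by linarith
  have expand: "(CLINT \<omega>|M. (K + U \<omega>) *\<^sub>R k (X \<omega>)) =
      K *\<^sub>R (CLINT \<omega>|M. k (X \<omega>)) + (CLINT \<omega>|M. U \<omega> *\<^sub>R k (X \<omega>))"
    if k: "k \<in> borel_measurable borel" "\<And>x. cmod (k x) \<le> C" for k :: "real \<Rightarrow> complex" and C
  proof -
    have 1: "integrable M (\<lambda>\<omega>. k (X \<omega>))"
      by (rule integrable_const_bound[of _ C]) (use k X in auto)
    have 2: "integrable M (\<lambda>\<omega>. U \<omega> *\<^sub>R k (X \<omega>))"
    proof (rule integrable_const_bound[of _ "K * C"])
      show "AE \<omega> in M. norm (U \<omega> *\<^sub>R k (X \<omega>)) \<le> K * C"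
        using U(2) k(2) K0 by (intro AE_I2) (auto intro!: mult_mono)
    qed (use k X U in measurable)
    have "(CLINT \<omega>|M. (K + U \<omega>) *\<^sub>R k (X \<omega>)) = (CLINT \<omega>|M. K *\<^sub>R k (X \<omega>) + U \<omega> *\<^sub>R k (X \<omega>))"
      by (simp add: scaleR_left_distrib)
    also have "\<dots> = K *\<^sub>R (CLINT \<omega>|M. k (X \<omega>)) + (CLINT \<omega>|M. U \<omega> *\<^sub>R k (X \<omega>))"
      using 1 2 by (simp add: Bochner_Integration.integral_add)
    finally show ?thesis .
  qed
  have m: "(\<integral>\<omega>. K + U \<omega> \<partial>M) = K + (\<integral>\<omega>. U \<omega> \<partial>M)" using Ui by (simp add: prob_space)
  have iexp1: "cmod (iexp (t * x)) \<le> 1" for t x :: real by simp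
  have "(CLINT \<omega>|M. (K + U \<omega>) *\<^sub>R g (X \<omega>)) = (\<integral>\<omega>. K + U \<omega> \<partial>M) *\<^sub>R (CLINT \<omega>|M. g (X \<omega>))"
  proof (rule decouple_nonneg[OF X])
    show "0 \<le> K + U \<omega>" "K + U \<omega> \<le> 2 * K" for \<omega> using U(2)[of \<omega>] by linarith+
    show "(CLINT \<omega>|M. (K + U \<omega>) *\<^sub>R iexp (t * X \<omega>)) = (\<integral>\<omega>. K + U \<omega> \<partial>M) *\<^sub>R (CLINT \<omega>|M. iexp (t * X \<omega>))" for t
    proof -
      have "(CLINT \<omega>|M. (K + U \<omega>) *\<^sub>R iexp (t * X \<omega>)) =
          K *\<^sub>R (CLINT \<omega>|M. iexp (t * X \<omega>)) + (CLINT \<omega>|M. U \<omega> *\<^sub>R iexp (t * X \<omega>))"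
        by (rule expand[of _ 1, OF _ iexp1]) measurable
      then show ?thesis by (simp only: m char scaleR_left_distrib)
    qed
  qed (use U g in auto)
  then show ?thesis unfolding m expand[OF g] by (simp add: scaleR_left_distrib)
qed

text \<open>Real and imaginary part of \<open>V\<close> are combinations of \<open>V\<close> and its
  conjugate, and the hypothesis is inherited by both.\<close>

lemma decouple:
  fixes V :: "'a \<Rightarrow> complex" and g :: "real \<Rightarrow> complex"
  assumes X: "X \<in> borel_measurable M" and V: "V \<in> borel_measurable M" "\<And>\<omega>. cmod (V \<omega>) \<le> K"
    and char: "\<And>t. (CLINT \<omega>|M. V \<omega> * iexp (t * X \<omega>)) = (CLINT \<omega>|M. V \<omega>) * (CLINT \<omega>|M. iexp (t * X \<omega>))"
    and g: "g \<in> borel_measurable borel" "\<And>x. cmod (g x) \<le> B"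
  shows "(CLINT \<omega>|M. V \<omega> * g (X \<omega>)) = (CLINT \<omega>|M. V \<omega>) * (CLINT \<omega>|M. g (X \<omega>))"
proof -
  have Vi: "integrable M V"
    by (rule integrable_const_bound[of _ K]) (use V in auto)
  have K0: "0 \<le> K" using V(2)[of undefined] norm_ge_zero order_trans by blast
  have Vk: "integrable M (\<lambda>\<omega>. V \<omega> * k \<omega>)" "integrable M (\<lambda>\<omega>. cnj (V \<omega>) * k \<omega>)"
    if "k \<in> borel_measurable M" "\<And>\<omega>. cmod (k \<omega>) \<le> C" for k C
  proof -
    have b: "cmod (V \<omega>) * cmod (k \<omega>) \<le> K * C" for \<omega>
      using V(2)[of \<omega>] that(2)[of \<omega>] K0 by (intro mult_mono) auto
    have "(\<lambda>\<omega>. cnj (V \<omega>)) \<in> borel_measurable M"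
      by (rule borel_measurable_continuous_on[OF _ V(1)]) (intro continuous_intros)
    then show "integrable M (\<lambda>\<omega>. V \<omega> * k \<omega>)" "integrable M (\<lambda>\<omega>. cnj (V \<omega>) * k \<omega>)"
      by - (rule integrable_const_bound[of _ "K * C"]; use b that(1) V(1) in \<open>auto simp: norm_mult\<close>)+
  qed
  \<comment> \<open>This is the hypothesis at \<open>- t\<close>, conjugated.\<close>
  have charc: "(CLINT \<omega>|M. cnj (V \<omega>) * iexp (t * X \<omega>)) = cnj (CLINT \<omega>|M. V \<omega>) * (CLINT \<omega>|M. iexp (t * X \<omega>))" for t
  proof -
    have c: "cnj (iexp (- t * x)) = iexp (t * x)" for x by (simp add: exp_cnj)
    have "(CLINT \<omega>|M. cnj (V \<omega>) * iexp (t * X \<omega>)) = (CLINT \<omega>|M. cnj (V \<omega> * iexp (- t * X \<omega>)))"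
      unfolding complex_cnj_mult c ..
    also have "\<dots> = cnj (CLINT \<omega>|M. V \<omega> * iexp (- t * X \<omega>))" by (rule Bochner_Integration.integral_cnj)
    also have "\<dots> = cnj (CLINT \<omega>|M. V \<omega>) * cnj (CLINT \<omega>|M. iexp (- t * X \<omega>))" by (simp only: char complex_cnj_mult)
    also have "cnj (CLINT \<omega>|M. iexp (- t * X \<omega>)) = (CLINT \<omega>|M. cnj (iexp (- t * X \<omega>)))" by (rule Bochner_Integration.integral_cnj[symmetric])
    finally show ?thesis unfolding c .
  qed
  have iX: "(\<lambda>\<omega>. iexp (t * X \<omega>)) \<in> borel_measurable M" for t using X by measurable
  have iX1: "cmod (iexp (t * X \<omega>)) \<le> 1" for t \<omega> by simp
  define EV where "EV = (CLINT \<omega>|M. V \<omega>)"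
  have Rem: "(\<integral>\<omega>. Re (V \<omega>) \<partial>M) = Re EV" "(\<integral>\<omega>. Im (V \<omega>) \<partial>M) = Im EV"
    using Vi by (simp_all add: EV_def)
  have ReE: "Re (V \<omega>) *\<^sub>R z = (1/2) * (V \<omega> * z) + (1/2) * (cnj (V \<omega>) * z)" for \<omega> z
    by (simp add: complex_eq_iff field_simps)
  have ImE: "Im (V \<omega>) *\<^sub>R z = (- \<i>/2) * (V \<omega> * z) + (\<i>/2) * (cnj (V \<omega>) * z)" for \<omega> z
    by (simp add: complex_eq_iff field_simps)
  have Re': "Re EV *\<^sub>R z = (1/2) * (EV * z) + (1/2) * (cnj EV * z)"
    and Im': "Im EV *\<^sub>R z = (- \<i>/2) * (EV * z) + (\<i>/2) * (cnj EV * z)" for z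
    by (simp_all add: complex_eq_iff field_simps)
  have 1: "(CLINT \<omega>|M. Re (V \<omega>) *\<^sub>R g (X \<omega>)) = (\<integral>\<omega>. Re (V \<omega>) \<partial>M) *\<^sub>R (CLINT \<omega>|M. g (X \<omega>))"
  proof (rule decouple_real[OF X _ _ _ g])
    show "\<bar>Re (V \<omega>)\<bar> \<le> K" for \<omega> using abs_Re_le_cmod[of "V \<omega>"] V(2)[of \<omega>] by linarith
    show "(CLINT \<omega>|M. Re (V \<omega>) *\<^sub>R iexp (t * X \<omega>)) = (\<integral>\<omega>. Re (V \<omega>) \<partial>M) *\<^sub>R (CLINT \<omega>|M. iexp (t * X \<omega>))" for t
      unfolding Rem Re' ReE using Vk[OF iX iX1, of t]
      by (subst Bochner_Integration.integral_add)
        (simp_all only: integrable_mult_right integral_mult_right_zero char charc EV_def)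
  qed (use V in measurable)
  have 2: "(CLINT \<omega>|M. Im (V \<omega>) *\<^sub>R g (X \<omega>)) = (\<integral>\<omega>. Im (V \<omega>) \<partial>M) *\<^sub>R (CLINT \<omega>|M. g (X \<omega>))"
  proof (rule decouple_real[OF X _ _ _ g])
    show "\<bar>Im (V \<omega>)\<bar> \<le> K" for \<omega> using abs_Im_le_cmod[of "V \<omega>"] V(2)[of \<omega>] by linarith
    show "(CLINT \<omega>|M. Im (V \<omega>) *\<^sub>R iexp (t * X \<omega>)) = (\<integral>\<omega>. Im (V \<omega>) \<partial>M) *\<^sub>R (CLINT \<omega>|M. iexp (t * X \<omega>))" for t
      unfolding Rem Im' ImE using Vk[OF iX iX1, of t]
      by (subst Bochner_Integration.integral_add)
        (simp_all only: integrable_mult_right integral_mult_right_zero char charc EV_def)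
  qed (use V in measurable)
  have gX: "(\<lambda>\<omega>. g (X \<omega>)) \<in> borel_measurable M" using g X by measurable
  have int: "integrable M (\<lambda>\<omega>. Re (V \<omega>) *\<^sub>R g (X \<omega>))" "integrable M (\<lambda>\<omega>. Im (V \<omega>) *\<^sub>R g (X \<omega>))"
    unfolding ReE ImE using Vk[OF gX g(2)] by (intro Bochner_Integration.integrable_add integrable_mult_right; simp)+
  have eq: "V \<omega> * g (X \<omega>) = Re (V \<omega>) *\<^sub>R g (X \<omega>) + \<i> * (Im (V \<omega>) *\<^sub>R g (X \<omega>))" for \<omega>
    by (simp add: complex_eq_iff algebra_simps)
  have "(CLINT \<omega>|M. V \<omega> * g (X \<omega>)) = (CLINT \<omega>|M. Re (V \<omega>) *\<^sub>R g (X \<omega>)) + \<i> * (CLINT \<omega>|M. Im (V \<omega>) *\<^sub>R g (X \<omega>))"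
    unfolding eq using int
    by (subst Bochner_Integration.integral_add) (simp_all only: integrable_mult_right integral_mult_right_zero)
  also have "\<dots> = EV * (CLINT \<omega>|M. g (X \<omega>))"
    unfolding 1 2 Rem by (simp add: complex_eq_iff algebra_simps)
  finally show ?thesis by (simp add: EV_def)
qed

text \<open>Kac's theorem: factorization of the joint characteristic function implies independence.
  The exponentials are replaced by the functions \<open>g l\<close> one at a time.\<close>

lemma factor_joint_cf:
  fixes X :: "nat \<Rightarrow> 'a \<Rightarrow> real" and g :: "nat \<Rightarrow> real \<Rightarrow> complex"
  assumes X: "\<And>l. l < k \<Longrightarrow> X l \<in> borel_measurable M"
    and char: "\<And>t. (CLINT \<omega>|M. iexp (\<Sum>l<k. t l * X l \<omega>)) = (\<Prod>l<k. CLINT \<omega>|M. iexp (t l * X l \<omega>))"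
    and g: "\<And>l. l < k \<Longrightarrow> g l \<in> borel_measurable borel" "\<And>l x. l < k \<Longrightarrow> cmod (g l x) \<le> 1"
  shows "(CLINT \<omega>|M. \<Prod>l<k. g l (X l \<omega>)) = (\<Prod>l<k. CLINT \<omega>|M. g l (X l \<omega>))"
proof -
  define h where "h m t l x = (if l < m then g l x else iexp (t l * x))" for m and t :: "nat \<Rightarrow> real" and l x
  have h: "h m t l \<in> borel_measurable borel" "cmod (h m t l x) \<le> 1" if "l < k" for m t l x
    using g[OF that] unfolding h_def[abs_def] by (auto split: if_splits)
  have hX: "(\<lambda>\<omega>. h m t l (X l \<omega>)) \<in> borel_measurable M" if "l < k" for m t l
    using measurable_compose[OF X[OF that] h(1)[OF that]] by simp
  have "m \<le> k \<Longrightarrow> (CLINT \<omega>|M. \<Prod>l<k. h m t l (X l \<omega>)) = (\<Prod>l<k. CLINT \<omega>|M. h m t l (X l \<omega>))" for m t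
  proof (induction m arbitrary: t)
    case 0
    show ?case using char[of t] by (simp add: h_def sum_distrib_left exp_sum)
  next
    case (Suc m)
    then have mk: "m < k" by simp
    let ?R = "{..<k} - {m}"
    define V where "V \<omega> = (\<Prod>l\<in>?R. h m t l (X l \<omega>))" for \<omega>
    define P where "P = (\<Prod>l\<in>?R. CLINT \<omega>|M. h m t l (X l \<omega>))"
    \<comment> \<open>The induction hypothesis at every frequency \<open>s\<close> of the variable
      \<open>m\<close>, which is why \<open>t\<close> is arbitrary in the induction;
      \<open>V\<close> does not depend on \<open>t m\<close>.\<close>
    have split: "(CLINT \<omega>|M. V \<omega> * iexp (s * X m \<omega>)) = P * (CLINT \<omega>|M. iexp (s * X m \<omega>))" for s
    proof -
      have eq: "h m (t(m := s)) l = h m t l" if "l \<in> ?R" for l using that by (auto simp: h_def fun_eq_iff)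
      have hm: "h m (t(m := s)) m = (\<lambda>x. iexp (s * x))" by (auto simp: h_def fun_eq_iff)
      have "(CLINT \<omega>|M. \<Prod>l<k. h m (t(m := s)) l (X l \<omega>)) = (\<Prod>l<k. CLINT \<omega>|M. h m (t(m := s)) l (X l \<omega>))"
        using Suc by simp
      moreover have "(\<Prod>l<k. h m (t(m := s)) l (X l \<omega>)) = V \<omega> * iexp (s * X m \<omega>)" for \<omega>
        unfolding V_def using mk eq hm by (subst prod.remove[of _ m]) (auto simp: mult.commute)
      moreover have "(\<Prod>l<k. CLINT \<omega>|M. h m (t(m := s)) l (X l \<omega>)) = P * (CLINT \<omega>|M. iexp (s * X m \<omega>))"
        unfolding P_def using mk eq hm by (subst prod.remove[of _ m]) (auto simp: mult.commute)
      ultimately show ?thesis by simp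
    qed
    \<comment> \<open>At frequency 0 the last factor is 1.\<close>
    have EV: "(CLINT \<omega>|M. V \<omega>) = P" using split[of 0] by (simp add: prob_space)
    have "(CLINT \<omega>|M. V \<omega> * g m (X m \<omega>)) = (CLINT \<omega>|M. V \<omega>) * (CLINT \<omega>|M. g m (X m \<omega>))"
    proof (rule decouple[OF X[OF mk] _ _ _ g(1)[OF mk] g(2)[OF mk]])
      show "V \<in> borel_measurable M" unfolding V_def[abs_def] using hX by (intro borel_measurable_prod) auto
      show "cmod (V \<omega>) \<le> 1" for \<omega> unfolding V_def prod_norm[symmetric] using h by (intro prod_le_1) auto
      show "(CLINT \<omega>|M. V \<omega> * iexp (s * X m \<omega>)) = (CLINT \<omega>|M. V \<omega>) * (CLINT \<omega>|M. iexp (s * X m \<omega>))" for s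
        by (simp only: split EV)
    qed
    then have 1: "(CLINT \<omega>|M. V \<omega> * g m (X m \<omega>)) = P * (CLINT \<omega>|M. g m (X m \<omega>))" by (simp add: EV)
    have eq: "h (Suc m) t l = h m t l" if "l \<in> ?R" for l using that by (auto simp: h_def fun_eq_iff)
    have hm: "h (Suc m) t m = g m" by (auto simp: h_def fun_eq_iff)
    have "(\<Prod>l<k. h (Suc m) t l (X l \<omega>)) = V \<omega> * g m (X m \<omega>)" for \<omega>
      unfolding V_def using mk eq hm by (subst prod.remove[of _ m]) (auto simp: mult.commute)
    moreover have "(\<Prod>l<k. CLINT \<omega>|M. h (Suc m) t l (X l \<omega>)) = P * (CLINT \<omega>|M. g m (X m \<omega>))"
      unfolding P_def using mk eq hm by (subst prod.remove[of _ m]) (auto simp: mult.commute)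
    ultimately show ?case using 1 by simp
  qed
  from this[of k "\<lambda>_. 0"]
  have "(CLINT \<omega>|M. \<Prod>l<k. h k (\<lambda>_. 0) l (X l \<omega>)) = (\<Prod>l<k. CLINT \<omega>|M. h k (\<lambda>_. 0) l (X l \<omega>))"
    by simp
  moreover have "(\<Prod>l<k. h k (\<lambda>_. 0) l (X l \<omega>)) = (\<Prod>l<k. g l (X l \<omega>))" for \<omega>
    by (intro prod.cong) (auto simp: h_def)
  moreover have "(\<Prod>l<k. CLINT \<omega>|M. h k (\<lambda>_. 0) l (X l \<omega>)) = (\<Prod>l<k. CLINT \<omega>|M. g l (X l \<omega>))"
    by (intro prod.cong) (auto simp: h_def)
  ultimately show ?thesis by simp
qed

end

section \<open>The square of a normal variable\<close>

text \<open>The characteristic function of the chi-square law with one degree of freedom.\<close>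

definition normal_square_cf :: "real \<Rightarrow> complex" where
  "normal_square_cf s = (CLINT x|std_normal_distribution. iexp (s * x\<^sup>2))"

definition normal_square_cf' :: "real \<Rightarrow> complex" where
  "normal_square_cf' s = (CLINT x|std_normal_distribution. of_real (x\<^sup>2) * iexp (s * x\<^sup>2))"

lemma integrable_std_normal_bound:
  fixes g :: "real \<Rightarrow> complex"
  assumes "g \<in> borel_measurable borel" "\<And>x. cmod (g x) \<le> \<bar>x ^ k\<bar>"
  shows "integrable std_normal_distribution g"
proof (rule Bochner_Integration.integrable_bound)
  show "integrable std_normal_distribution (\<lambda>x. x ^ k)" by (rule integrable_std_normal_distribution_moment)
qed (use assms in auto)

text \<open>Differentiation under the integral sign: the difference quotients are dominated by
  \<open>x\<^sup>2\<close>, which is integrable for the normal law.\<close>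

lemma normal_square_cf_has_derivative: "(normal_square_cf has_vector_derivative \<i> * normal_square_cf' s) (at s)"
proof -
  define q where "q h = (normal_square_cf (s + h) - normal_square_cf s) / of_real h" for h
  have lim: "(q \<longlongrightarrow> \<i> * normal_square_cf' s) (at 0)"
    unfolding tendsto_at_iff_sequentially
  proof (intro allI impI)
    fix X :: "nat \<Rightarrow> real" assume X: "\<forall>i. X i \<in> UNIV - {0}" "X \<longlonglongrightarrow> 0"
    have X0: "X i \<noteq> 0" for i using X(1) by simp
    let ?f = "\<lambda>i x. (iexp ((s + X i) * x\<^sup>2) - iexp (s * x\<^sup>2)) / of_real (X i)"
    have int: "integrable std_normal_distribution (\<lambda>x. iexp (t * x\<^sup>2))" for t
      by (rule integrable_std_normal_bound[of _ 0]) auto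
    have "q (X i) = (CLINT x|std_normal_distribution. ?f i x)" for i
      unfolding q_def normal_square_cf_def
      by (simp only: integral_divide_zero Bochner_Integration.integral_diff[OF int int])
    moreover have "(\<lambda>i. CLINT x|std_normal_distribution. ?f i x) \<longlonglongrightarrow>
        (CLINT x|std_normal_distribution. \<i> * (of_real (x\<^sup>2) * iexp (s * x\<^sup>2)))"
    proof (rule integral_dominated_convergence[where w = "\<lambda>x. x\<^sup>2"])
      show "integrable std_normal_distribution (\<lambda>x. x\<^sup>2)"
        by (rule integrable_std_normal_distribution_moment)
      show "AE x in std_normal_distribution. norm (?f i x) \<le> x\<^sup>2" for i
      proof (rule AE_I2)
        fix x
        have "cmod (iexp ((s + X i) * x\<^sup>2) - iexp (s * x\<^sup>2)) \<le> \<bar>(s + X i) * x\<^sup>2 - s * x\<^sup>2\<bar>"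
          by (rule iexp_diff_le)
        also have "\<dots> = \<bar>X i\<bar> * x\<^sup>2" by (simp add: algebra_simps abs_mult)
        finally show "norm (?f i x) \<le> x\<^sup>2" using X0[of i]
          by (simp add: norm_divide divide_le_eq mult.commute del: of_real_mult of_real_add)
      qed
      show "AE x in std_normal_distribution. (\<lambda>i. ?f i x) \<longlonglongrightarrow> \<i> * (of_real (x\<^sup>2) * iexp (s * x\<^sup>2))"
      proof (rule AE_I2)
        fix x :: real
        have "((\<lambda>t. iexp (t * x\<^sup>2)) has_vector_derivative (x\<^sup>2 *\<^sub>R (\<i> * iexp (s * x\<^sup>2)))) (at s)"
          by (rule vector_diff_chain_at[where f = "\<lambda>t. t * x\<^sup>2" and g = iexp, unfolded o_def])
            (auto intro!: derivative_eq_intros has_vector_derivative_iexp simp flip: has_real_derivative_iff_has_vector_derivative)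
        then have d: "((\<lambda>t. Re (iexp (t * x\<^sup>2))) has_field_derivative Re (x\<^sup>2 *\<^sub>R (\<i> * iexp (s * x\<^sup>2)))) (at s)"
          "((\<lambda>t. Im (iexp (t * x\<^sup>2))) has_field_derivative Im (x\<^sup>2 *\<^sub>R (\<i> * iexp (s * x\<^sup>2)))) (at s)"
          by (simp_all only: has_vector_derivative_complex_iff)
        have "((\<lambda>h. (iexp ((s + h) * x\<^sup>2) - iexp (s * x\<^sup>2)) / of_real h) \<longlongrightarrow> x\<^sup>2 *\<^sub>R (\<i> * iexp (s * x\<^sup>2))) (at 0)"
          using d unfolding DERIV_def tendsto_complex_iff by (simp only: minus_complex.sel Re_divide_of_real Im_divide_of_real)
        then have "((\<lambda>h. (iexp ((s + h) * x\<^sup>2) - iexp (s * x\<^sup>2)) / of_real h) \<circ> X) \<longlonglongrightarrow> x\<^sup>2 *\<^sub>R (\<i> * iexp (s * x\<^sup>2))"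
          using X unfolding tendsto_at_iff_sequentially by blast
        then show "(\<lambda>i. ?f i x) \<longlonglongrightarrow> \<i> * (of_real (x\<^sup>2) * iexp (s * x\<^sup>2))"
          unfolding o_def scaleR_conv_of_real by (simp only: mult.left_commute)
      qed
    qed auto
    ultimately show "(q \<circ> X) \<longlonglongrightarrow> \<i> * normal_square_cf' s"
      unfolding o_def normal_square_cf'_def by (simp only: integral_mult_right_zero)
  qed
  then have "((\<lambda>h. (Re (normal_square_cf (s + h)) - Re (normal_square_cf s)) / h) \<longlongrightarrow> Re (\<i> * normal_square_cf' s)) (at 0)"
    "((\<lambda>h. (Im (normal_square_cf (s + h)) - Im (normal_square_cf s)) / h) \<longlongrightarrow> Im (\<i> * normal_square_cf' s)) (at 0)"
    unfolding tendsto_complex_iff q_def by (simp_all only: minus_complex.sel Re_divide_of_real Im_divide_of_real)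
  then show ?thesis unfolding has_vector_derivative_complex_iff DERIV_def by blast
qed

text \<open>Integration by parts: \<open>x e\<^bsup>i s x\<^sup>2\<^esup>\<close> times the density vanishes at infinity.\<close>

lemma normal_square_cf'_eq: "(1 - 2 * \<i> * of_real s) * normal_square_cf' s = normal_square_cf s"
proof -
  let ?n = "std_normal_density"
  define F where "F x = of_real (x * ?n x) * iexp (s * x\<^sup>2)" for x
  define f where "f x = ?n x *\<^sub>R (iexp (s * x\<^sup>2) - (1 - 2 * \<i> * of_real s) * (of_real (x\<^sup>2) * iexp (s * x\<^sup>2)))" for x
  have i0: "integrable std_normal_distribution (\<lambda>x. iexp (s * x\<^sup>2))"
    by (rule integrable_std_normal_bound[of _ 0]) auto
  have i2: "integrable std_normal_distribution (\<lambda>x. of_real (x\<^sup>2) * iexp (s * x\<^sup>2))"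
    by (rule integrable_std_normal_bound[of _ 2]) (auto simp: norm_mult norm_power)
  let ?g = "\<lambda>x. iexp (s * x\<^sup>2) - (1 - 2 * \<i> * of_real s) * (of_real (x\<^sup>2) * iexp (s * x\<^sup>2))"
  have ig: "integrable std_normal_distribution ?g"
    using i0 i2 by (intro Bochner_Integration.integrable_diff integrable_mult_right)
  have fi: "integrable lborel f"
    using ig unfolding f_def[abs_def] by (subst (asm) integrable_density) auto
  have "(LBINT x=-\<infinity>..\<infinity>. f x) = 0 - 0"
  proof (rule interval_integral_FTC_integrable)
    fix x :: real
    have dn: "(?n has_real_derivative - x * ?n x) (at x)"
      unfolding std_normal_density_def[abs_def] by (auto intro!: derivative_eq_intros simp: field_simps)
    have 1: "((\<lambda>x. complex_of_real (x * ?n x)) has_vector_derivative of_real (?n x - x\<^sup>2 * ?n x)) (at x)"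
      by (intro has_vector_derivative_of_real) (auto intro!: derivative_eq_intros dn simp: power2_eq_square)
    have 2: "((\<lambda>x. iexp (s * x\<^sup>2)) has_vector_derivative ((2 * s * x) *\<^sub>R (\<i> * iexp (s * x\<^sup>2)))) (at x)"
      by (rule vector_diff_chain_at[where f = "\<lambda>x. s * x\<^sup>2" and g = iexp, unfolded o_def])
        (auto intro!: derivative_eq_intros has_vector_derivative_iexp simp flip: has_real_derivative_iff_has_vector_derivative)
    have "(F has_vector_derivative of_real (x * ?n x) * ((2 * s * x) *\<^sub>R (\<i> * iexp (s * x\<^sup>2))) +
        of_real (?n x - x\<^sup>2 * ?n x) * iexp (s * x\<^sup>2)) (at x)"
      unfolding F_def[abs_def] by (rule has_vector_derivative_mult[OF 1 2])
    moreover have "of_real (x * ?n x) * ((2 * s * x) *\<^sub>R (\<i> * iexp (s * x\<^sup>2))) +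
        of_real (?n x - x\<^sup>2 * ?n x) * iexp (s * x\<^sup>2) = f x"
      unfolding f_def scaleR_conv_of_real by (simp add: algebra_simps power2_eq_square)
    ultimately show "(F has_vector_derivative f x) (at x)" by simp
    have "isCont ?n x" by (rule DERIV_isCont[OF dn])
    then show "isCont f x" unfolding f_def[abs_def] by (intro continuous_intros) auto
  next
    show "set_integrable lborel (einterval (- \<infinity>) \<infinity>) f"
      using fi by (simp add: set_integrable_def)
    \<comment> \<open>From \<open>x\<^sup>2 / 2 \<le> exp (x\<^sup>2 / 2)\<close> the density is at
      most \<open>2 / x\<^sup>2\<close>, which is enough decay for the boundary terms.\<close>
    have bound: "cmod (F x) \<le> 2 / \<bar>x\<bar>" if "x \<noteq> 0" for x
    proof -
      have "x\<^sup>2 / 2 \<le> exp (x\<^sup>2 / 2)" using exp_ge_add_one_self[of "x\<^sup>2/2"] by linarith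
      then have "exp (- x\<^sup>2 / 2) \<le> 2 / x\<^sup>2" using that by (simp add: exp_minus field_simps)
      moreover have "1 \<le> sqrt (2 * pi)" using pi_ge_two by simp
      ultimately have "?n x \<le> 2 / x\<^sup>2"
        unfolding std_normal_density_def using mult_mono[of "1 / sqrt (2 * pi)" 1 "exp (- x\<^sup>2 / 2)" "2 / x\<^sup>2"]
        by (simp add: divide_le_eq)
      then have "\<bar>x\<bar> * ?n x \<le> \<bar>x\<bar> * (2 / x\<^sup>2)" by (intro mult_left_mono) auto
      also have "\<dots> = 2 / \<bar>x\<bar>" using that by (simp add: power2_eq_square field_simps abs_if)
      finally show ?thesis by (simp add: F_def norm_mult)
    qed
    have top: "(F \<longlongrightarrow> 0) at_top" "(F \<longlongrightarrow> 0) at_bot"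
    proof -
      have ev: "\<forall>\<^sub>F x in F'. cmod (F x) \<le> 2 / \<bar>x\<bar>" if "\<forall>\<^sub>F x in F'. x \<noteq> (0::real)" for F'
        using that by eventually_elim (rule bound)
      have "((\<lambda>x::real. 2 / \<bar>x\<bar>) \<longlongrightarrow> 0) at_top" 
        by (intro tendsto_divide_0[OF tendsto_const] filterlim_at_top_imp_at_infinity filterlim_abs_real) 
      then show "(F \<longlongrightarrow> 0) at_top"
        by (rule Lim_null_comparison[rotated]) (rule ev, rule eventually_mono[OF eventually_ge_at_top[of 1]], simp)
      have "((\<lambda>x::real. 2 / \<bar>x\<bar>) \<longlongrightarrow> 0) at_bot" 
        by (intro tendsto_divide_0[OF tendsto_const] filterlim_at_top_imp_at_infinity) 
          (subst filterlim_at_bot_mirror, simp add: filterlim_abs_real)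
      then show "(F \<longlongrightarrow> 0) at_bot"
        by (rule Lim_null_comparison[rotated]) (rule ev, rule eventually_mono[OF eventually_le_at_bot[of "-1"]], simp)
    qed
    show "((F \<circ> real_of_ereal) \<longlongrightarrow> 0) (at_right (- \<infinity>))"
      using top(2) by (simp add: ereal_tendsto_simps)
    show "((F \<circ> real_of_ereal) \<longlongrightarrow> 0) (at_left \<infinity>)"
      using top(1) by (simp add: ereal_tendsto_simps)
  qed simp
  then have "(CLINT x|lborel. f x) = 0"
    by (simp add: interval_lebesgue_integral_def set_lebesgue_integral_def)
  also have "(CLINT x|lborel. f x) = (CLINT x|std_normal_distribution. ?g x)"
    unfolding f_def by (subst integral_density) auto
  also have "\<dots> = normal_square_cf s - (1 - 2 * \<i> * of_real s) * normal_square_cf' s"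
    using i0 i2 by (simp only: Bochner_Integration.integral_diff integrable_mult_right integral_mult_right_zero normal_square_cf_def normal_square_cf'_def)
  finally show ?thesis by simp
qed

text \<open>The two preceding facts form the differential equation
  \<open>(1 - 2 * \<i> * s) * y' = \<i> * y\<close>. Since \<open>w\<close> is the square root of
  \<open>1 - 2 * \<i> * s\<close>, its product with the solution is constant, and it is 1 at 0. The
  radicand has real part 1 and so avoids the branch cut.\<close>

lemma normal_square_cf_eq: "normal_square_cf s = exp (- Ln (1 - 2 * \<i> * of_real s) / 2)"
proof -
  define w where "w s = exp (Ln (1 - 2 * \<i> * of_real s) / 2)" for s :: real
  have nz: "1 - 2 * \<i> * of_real s \<noteq> 0" for s :: real by (simp add: complex_eq_iff)
  have slit: "1 - 2 * \<i> * of_real s \<notin> \<real>\<^sub>\<le>\<^sub>0" for s :: real by (simp add: complex_nonpos_Reals_iff)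
  have dw: "(w has_vector_derivative (- \<i>) * w s / (1 - 2 * \<i> * of_real s)) (at s)" for s :: real
  proof -
    have "((\<lambda>z. exp (Ln (1 - 2 * \<i> * z) / 2)) has_field_derivative
        (- \<i>) * w s / (1 - 2 * \<i> * of_real s)) (at (of_real s))"
      using slit[of s] nz[of s] unfolding w_def by (auto intro!: derivative_eq_intros simp: field_simps)
    then show ?thesis unfolding w_def[abs_def] by (rule has_vector_derivative_real_field)
  qed
  have "((\<lambda>s. normal_square_cf s * w s) has_vector_derivative 0) (at s within UNIV)" for s
  proof -
    have "normal_square_cf s * ((- \<i>) * w s / (1 - 2 * \<i> * of_real s)) + \<i> * normal_square_cf' s * w s = 0"
    proof -
      have "normal_square_cf s * ((- \<i>) * w s / (1 - 2 * \<i> * of_real s)) =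
          ((1 - 2 * \<i> * of_real s) * normal_square_cf' s) * ((- \<i>) * w s / (1 - 2 * \<i> * of_real s))"
        by (simp only: normal_square_cf'_eq)
      also have "\<dots> = - (\<i> * normal_square_cf' s * w s)" using nz[of s] by (simp add: mult.assoc mult.commute mult.left_commute)
      finally show ?thesis by simp
    qed
    then show ?thesis using has_vector_derivative_mult[OF normal_square_cf_has_derivative[of s] dw[of s]] by simp
  qed
  then obtain c where c: "\<And>s. normal_square_cf s * w s = c"
    using has_vector_derivative_zero_constant[of UNIV "\<lambda>s. normal_square_cf s * w s"] by auto
  have "normal_square_cf 0 = 1" using std_normal.prob_space by (simp add: normal_square_cf_def)
  then have "c = 1" using c[of 0] by (simp add: w_def)
  then have "normal_square_cf s * w s = 1" using c by simp
  moreover have "w s * exp (- Ln (1 - 2 * \<i> * of_real s) / 2) = 1"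
    unfolding w_def by (simp flip: exp_add)
  ultimately show ?thesis by (metis mult.assoc mult.commute mult_1)
qed

section \<open>Characteristic functions of finite-rank double integrals\<close>

definition orthonormal :: "nat \<Rightarrow> (nat \<Rightarrow> real \<Rightarrow> real) \<Rightarrow> bool" where
  "orthonormal d u \<longleftrightarrow> (\<forall>i<d. u i \<in> L2 Rplus) \<and>
     (\<forall>i<d. \<forall>j<d. L2_inner Rplus (u i) (u j) = of_bool (i = j))"

text \<open>The \<open>l i\<close> may repeat or vanish; vanishing ones are excluded only where the
  eigenvalues are read off.\<close>

definition spectral :: "(real \<times> real \<Rightarrow> real) \<Rightarrow> nat \<Rightarrow> (nat \<Rightarrow> real) \<Rightarrow> (nat \<Rightarrow> real \<Rightarrow> real) \<Rightarrow> bool" where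
  "spectral f d l u \<longleftrightarrow> f \<in> L2_sym \<and> orthonormal d u \<and>
     (AE z in Rplus2. f z = (\<Sum>i<d. l i * tensor (u i) (u i) z))"

text \<open>The logarithm of the characteristic function of \<open>\<xi>\<^sup>2 - 1\<close> for a standard normal \<open>\<xi>\<close>.\<close>

definition log_chi :: "real \<Rightarrow> complex" where
  "log_chi x = - (\<i> * of_real x) - Ln (1 - 2 * \<i> * of_real x) / 2"

text \<open>A continuous logarithm of the characteristic function that vanishes at 0. As a sum of
  principal logarithms it may leave the strip of the principal branch, so agreement with
  \<open>Ln\<close> is guaranteed only near 0.\<close>

definition log_cf :: "nat \<Rightarrow> (nat \<Rightarrow> real) \<Rightarrow> real \<Rightarrow> complex" where
  "log_cf d l t = (\<Sum>i<d. log_chi (t * l i))"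

definition psum :: "nat \<Rightarrow> (nat \<Rightarrow> real) \<Rightarrow> nat \<Rightarrow> real" where
  "psum d l r = (\<Sum>i<d. l i ^ r)"

lemma exp_log_chi: "exp (log_chi s) = iexp (- s) * normal_square_cf s"
  by (simp add: log_chi_def normal_square_cf_eq flip: exp_add)

lemma spectral_norm:
  assumes "spectral f d l u"
  shows "(L2_norm Rplus2 f)\<^sup>2 = psum d l 2"
proof -
  have u: "u i \<in> L2 Rplus" if "i < d" for i using assms that by (simp add: spectral_def orthonormal_def)
  have uu: "L2_inner Rplus (u i) (u j) = of_bool (i = j)" if "i < d" "j < d" for i j
    using assms that by (simp add: spectral_def orthonormal_def)
  let ?f = "\<lambda>z. \<Sum>i<d. l i * tensor (u i) (u i) z"
  have ten: "tensor (u i) (u i) \<in> L2 Rplus2" if "i < d" for i using u that by (intro tensor_L2)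
  have fL: "f \<in> L2 Rplus2" "?f \<in> L2 Rplus2"
    using assms L2_sym_subset ten by (auto simp: spectral_def intro!: L2_sum L2_scale)
  have "L2_norm Rplus2 f = L2_norm Rplus2 ?f"
    using assms fL by (intro L2_norm_cong_AE) (auto simp: spectral_def intro: L2_measurable)
  then have "(L2_norm Rplus2 f)\<^sup>2 = L2_inner Rplus2 ?f ?f" by (simp add: L2_norm_sq)
  also have "\<dots> = (\<Sum>i<d. l i * L2_inner Rplus2 (tensor (u i) (u i)) ?f)"
    by (rule L2_inner_sum_left) (use ten fL in auto)
  also have "\<dots> = (\<Sum>i<d. l i * (\<Sum>j<d. l j * L2_inner Rplus2 (tensor (u i) (u i)) (tensor (u j) (u j))))"
    by (intro sum.cong refl arg_cong2[of _ _ _ _ "(*)"] L2_inner_sum_right) (use ten in auto)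
  also have "\<dots> = (\<Sum>i<d. l i * (\<Sum>j<d. if i = j then l j else 0))"
    using u by (intro sum.cong refl arg_cong2[of _ _ _ _ "(*)"]) (auto simp: L2_inner_tensor uu)
  also have "\<dots> = psum d l 2" by (simp add: psum_def power2_eq_square)
  finally show ?thesis .
qed

context brownian
begin

lemma J_sum:
  fixes d :: nat
  assumes "\<And>i. i < d \<Longrightarrow> u i \<in> L2 Rplus"
  shows "AE \<omega> in M. J (\<lambda>x. \<Sum>i<d. t i * u i x) \<omega> = (\<Sum>i<d. t i * J (u i) \<omega>)"
  using assms
proof (induction d)
  case 0
  have "AE \<omega> in M. J (\<lambda>x. 0 * 0 + 0 * 0) \<omega> = 0 * J (\<lambda>x. 0) \<omega> + 0 * J (\<lambda>x. 0) \<omega>"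
    by (rule J_lincomb) simp_all
  then show ?case by simp
next
  case (Suc d)
  have "AE \<omega> in M. J (\<lambda>x. 1 * (\<Sum>i<d. t i * u i x) + t d * u d x) \<omega> =
      1 * J (\<lambda>x. \<Sum>i<d. t i * u i x) \<omega> + t d * J (u d) \<omega>"
    using Suc.prems by (intro J_lincomb L2_sum L2_scale) auto
  moreover have "AE \<omega> in M. J (\<lambda>x. \<Sum>i<d. t i * u i x) \<omega> = (\<Sum>i<d. t i * J (u i) \<omega>)"
    using Suc by simp
  ultimately show ?case by eventually_elim simp
qed

lemma J_iexp_mean:
  assumes "h \<in> L2 Rplus"
  shows "(CLINT \<omega>|M. iexp (J h \<omega>)) = exp (- of_real ((L2_norm Rplus h)\<^sup>2) / 2)"
proof -
  have "cf M (J h) 1 = complex_of_real (exp (- ((L2_norm Rplus h)\<^sup>2 * 1\<^sup>2) / 2))"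
    by (rule normal_variable(5)[OF J_measurable[OF assms] _ J_normal[OF assms]]) simp
  then show ?thesis by (simp add: cf_def exp_of_real[symmetric])
qed

lemma orthonormal_combination_norm:
  assumes "orthonormal d u"
  shows "(\<lambda>x. \<Sum>i<d. t i * u i x) \<in> L2 Rplus" "(L2_norm Rplus (\<lambda>x. \<Sum>i<d. t i * u i x))\<^sup>2 = (\<Sum>i<d. (t i)\<^sup>2)"
proof -
  have u: "u i \<in> L2 Rplus" if "i < d" for i using assms that by (simp add: orthonormal_def)
  have uu: "L2_inner Rplus (u i) (u j) = of_bool (i = j)" if "i < d" "j < d" for i j
    using assms that by (simp add: orthonormal_def)
  let ?h = "\<lambda>x. \<Sum>i<d. t i * u i x"
  show h: "?h \<in> L2 Rplus" using u by (auto intro!: L2_sum L2_scale)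
  have "(L2_norm Rplus ?h)\<^sup>2 = (\<Sum>i<d. t i * L2_inner Rplus (u i) ?h)"
    unfolding L2_norm_sq by (rule L2_inner_sum_left) (use u h in auto)
  also have "\<dots> = (\<Sum>i<d. t i * (\<Sum>j<d. t j * L2_inner Rplus (u i) (u j)))"
    by (intro sum.cong refl arg_cong2[of _ _ _ _ "(*)"] L2_inner_sum_right) (use u in auto)
  also have "\<dots> = (\<Sum>i<d. t i * (\<Sum>j<d. if i = j then t j else 0))"
    by (intro sum.cong refl arg_cong2[of _ _ _ _ "(*)"]) (auto simp: uu)
  also have "\<dots> = (\<Sum>i<d. (t i)\<^sup>2)" by (simp add: power2_eq_square)
  finally show "(L2_norm Rplus ?h)\<^sup>2 = (\<Sum>i<d. (t i)\<^sup>2)" .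
qed

text \<open>The combination is the Wiener integral of a combination, hence normal. By orthonormality
  its variance is a sum over \<open>i\<close>, which yields the factorization that Kac's theorem
  asks for.\<close>

lemma J_joint_cf:
  assumes "orthonormal d u"
  shows "(CLINT \<omega>|M. iexp (\<Sum>i<d. t i * J (u i) \<omega>)) = exp (- of_real (\<Sum>i<d. (t i)\<^sup>2) / 2)"
proof -
  have u: "u i \<in> L2 Rplus" if "i < d" for i using assms that by (simp add: orthonormal_def)
  let ?h = "\<lambda>x. \<Sum>i<d. t i * u i x"
  have m: "(\<lambda>\<omega>. \<Sum>i<d. t i * J (u i) \<omega>) \<in> borel_measurable M" "J ?h \<in> borel_measurable M"
    using u orthonormal_combination_norm(1)[OF assms] by auto
  have "(CLINT \<omega>|M. iexp (\<Sum>i<d. t i * J (u i) \<omega>)) = (CLINT \<omega>|M. iexp (J ?h \<omega>))"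
  proof (rule integral_cong_AE)
    show "AE \<omega> in M. iexp (\<Sum>i<d. t i * J (u i) \<omega>) = iexp (J ?h \<omega>)"
      using J_sum[of d u t, OF u] by auto
  qed (use m in measurable)
  then show ?thesis
    unfolding J_iexp_mean[OF orthonormal_combination_norm(1)[OF assms]] orthonormal_combination_norm(2)[OF assms] .
qed

lemma J_single_cf:
  assumes "orthonormal d u" "i < d"
  shows "(CLINT \<omega>|M. iexp (t * J (u i) \<omega>)) = exp (- of_real (t\<^sup>2) / 2)"
proof -
  have "(\<Sum>j<d. (if j = i then t else 0) * J (u j) \<omega>) = t * J (u i) \<omega>" for \<omega>
  proof -
    have "(\<Sum>j<d. (if j = i then t else 0) * J (u j) \<omega>) = (\<Sum>j<d. if j = i then t * J (u j) \<omega> else 0)"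
      by (intro sum.cong) auto
    then show ?thesis using assms(2) by simp
  qed
  moreover have "(\<Sum>j<d. (if j = i then t else 0)\<^sup>2) = t\<^sup>2"
  proof -
    have "(\<Sum>j<d. (if j = i then t else 0)\<^sup>2) = (\<Sum>j<d. if j = i then t\<^sup>2 else 0)"
      by (intro sum.cong) auto
    then show ?thesis using assms(2) by simp
  qed
  ultimately show ?thesis using J_joint_cf[OF assms(1), of "\<lambda>j. if j = i then t else 0"] by simp
qed

lemma J_square_cf:
  assumes h: "h \<in> L2 Rplus" "L2_inner Rplus h h = 1"
  shows "(CLINT \<omega>|M. iexp (s * ((J h \<omega>)\<^sup>2 - 1))) = exp (log_chi s)"
proof -
  have d: "distr M borel (J h) = distr std_normal_distribution borel (\<lambda>x. sqrt 1 * x)"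
    using J_normal[OF h(1)] h(2) by (simp add: L2_norm_sq normal_law_eq_distr)
  have "(CLINT \<omega>|M. iexp (s * ((J h \<omega>)\<^sup>2 - 1))) = (CLINT x|distr M borel (J h). iexp (s * (x\<^sup>2 - 1)))"
    using h by (subst integral_distr) auto
  also have "\<dots> = (CLINT x|std_normal_distribution. iexp (s * (x\<^sup>2 - 1)))"
    unfolding d by (subst integral_distr) auto
  also have "\<dots> = (CLINT x|std_normal_distribution. iexp (- s) * iexp (s * x\<^sup>2))"
    by (intro Bochner_Integration.integral_cong) (simp_all add: algebra_simps flip: exp_add)
  also have "\<dots> = exp (log_chi s)" unfolding exp_log_chi normal_square_cf_def by (rule integral_mult_right_zero)
  finally show ?thesis .
qed

theorem cf_I2_spectral:
  assumes s: "spectral f d l u"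
  shows "cf M (I2 f) t = exp (log_cf d l t)"
proof -
  have on: "orthonormal d u" and f: "f \<in> L2_sym"
    and eq: "AE z in Rplus2. f z = (\<Sum>i<d. l i * tensor (u i) (u i) z)"
    using s by (auto simp: spectral_def)
  have u: "u i \<in> L2 Rplus" "L2_inner Rplus (u i) (u i) = 1" if "i < d" for i
    using on that by (auto simp: orthonormal_def)
  have I2_eq: "AE \<omega> in M. I2 f \<omega> = (\<Sum>i<d. l i * ((J (u i) \<omega>)\<^sup>2 - (L2_norm Rplus (u i))\<^sup>2))"
    by (rule I2_lincomb_tensor[OF _ f eq]) (rule u(1))
  have n1: "(L2_norm Rplus (u i))\<^sup>2 = 1" if "i < d" for i using u that by (simp add: L2_norm_sq)
  \<comment> \<open>Each factor depends on one variable only, and the product of all is the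
    exponential of the whole quadratic expression.\<close>
  define g where "g i x = iexp (t * l i * (x\<^sup>2 - 1))" for i and x :: real
  have "cf M (I2 f) t = (CLINT \<omega>|M. \<Prod>i<d. g i (J (u i) \<omega>))"
    unfolding cf_def
  proof (rule integral_cong_AE)
    show "(\<lambda>\<omega>. iexp (t * I2 f \<omega>)) \<in> borel_measurable M"
      using I2_L2[OF f, THEN L2_measurable] by measurable
    show "(\<lambda>\<omega>. \<Prod>i<d. g i (J (u i) \<omega>)) \<in> borel_measurable M"
      unfolding g_def using u by (intro borel_measurable_prod) auto
    show "AE \<omega> in M. iexp (t * I2 f \<omega>) = (\<Prod>i<d. g i (J (u i) \<omega>))"
      using I2_eq
    proof eventually_elim
      case (elim \<omega>)
      have "t * I2 f \<omega> = (\<Sum>i<d. t * l i * ((J (u i) \<omega>)\<^sup>2 - 1))"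
        unfolding elim sum_distrib_left using n1 by (intro sum.cong) (auto simp: mult.assoc)
      then show ?case unfolding g_def by (simp add: exp_sum sum_distrib_left)
    qed
  qed
  also have "\<dots> = (\<Prod>i<d. CLINT \<omega>|M. g i (J (u i) \<omega>))"
  proof (rule factor_joint_cf)
    show "(CLINT \<omega>|M. iexp (\<Sum>i<d. t i * J (u i) \<omega>)) = (\<Prod>i<d. CLINT \<omega>|M. iexp (t i * J (u i) \<omega>))" for t
    proof -
      have "(\<Prod>i<d. CLINT \<omega>|M. iexp (t i * J (u i) \<omega>)) = (\<Prod>i<d. exp (- of_real ((t i)\<^sup>2) / 2))"
        by (intro prod.cong refl) (simp only: J_single_cf[OF on] lessThan_iff)
      also have "\<dots> = exp (\<Sum>i<d. - of_real ((t i)\<^sup>2) / 2)" by (rule exp_sum[symmetric]) simp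
      also have "(\<Sum>i<d. - complex_of_real ((t i)\<^sup>2) / 2) = - of_real (\<Sum>i<d. (t i)\<^sup>2) / 2"
        by (simp add: sum_negf sum_divide_distrib)
      finally show ?thesis unfolding J_joint_cf[OF on] ..
    qed
    show "g i \<in> borel_measurable borel" for i unfolding g_def by measurable
    show "cmod (g i x) \<le> 1" for i x
      unfolding g_def by (simp del: of_real_mult of_real_diff of_real_power)
  qed (use u in auto)
  also have "\<dots> = (\<Prod>i<d. exp (log_chi (t * l i)))"
    unfolding g_def by (intro prod.cong refl J_square_cf u) auto
  also have "\<dots> = exp (log_cf d l t)" by (simp add: log_cf_def exp_sum)
  finally show ?thesis .
qed

end

text \<open>\<open>M\<close> may carry too little randomness for \<open>N\<close>, so
  \<open>N\<close> lives on \<open>M'\<close>; the projection \<open>pr\<close> preserves the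
  measure and transports \<open>W\<close> and its integrals.\<close>

locale independent_gaussian = brownian M W
  for M :: "'a measure" and W +
  fixes M' :: "'b measure" and pr :: "'b \<Rightarrow> 'a" and N :: "'b \<Rightarrow> real" and v :: real
  assumes prob_M': "prob_space M'" and pr: "pr \<in> M' \<rightarrow>\<^sub>M M" and distr_pr: "distr M' M pr = M"
    and N: "N \<in> borel_measurable M'" and N_law: "distr M' borel N = normal_law 0 v" and v: "0 \<le> v"
    and indep: "indep_of_process M' N (\<lambda>t \<omega>. W t (pr \<omega>))"
begin

sublocale M': prob_space M' by (rule prob_M')

lemma measurable_pr: "X \<in> borel_measurable M \<Longrightarrow> (\<lambda>\<omega>. X (pr \<omega>)) \<in> borel_measurable M'"
  using measurable_compose[OF pr] .

lemma AE_pr: "AE \<omega> in M. P \<omega> \<Longrightarrow> AE \<omega> in M'. P (pr \<omega>)"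
proof -
  assume "AE \<omega> in M. P \<omega>"
  then have "AE \<omega> in distr M' M pr. P \<omega>" by (subst distr_pr)
  then show ?thesis by (rule AE_distrD[OF pr])
qed

lemma integral_pr:
  fixes k :: "'a \<Rightarrow> 'c::{banach, second_countable_topology}"
  shows "k \<in> borel_measurable M \<Longrightarrow> (\<integral>\<omega>. k (pr \<omega>) \<partial>M') = (\<integral>\<omega>. k \<omega> \<partial>M)"
  using integral_distr[OF pr, of k] by (simp add: distr_pr)

lemma L2_pr:
  assumes "X \<in> L2 M"
  shows "(\<lambda>\<omega>. X (pr \<omega>)) \<in> L2 M'" "L2_norm M' (\<lambda>\<omega>. X (pr \<omega>)) = L2_norm M X"
proof -
  have X: "X \<in> borel_measurable M" using assms by (rule L2_measurable)
  have "integrable (distr M' M pr) (\<lambda>\<omega>. (X \<omega>)\<^sup>2)" using L2_integrable_square[OF assms] by (simp add: distr_pr)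
  then have "integrable M' (\<lambda>\<omega>. (X (pr \<omega>))\<^sup>2)" by (rule integrable_distr[OF pr])
  then show "(\<lambda>\<omega>. X (pr \<omega>)) \<in> L2 M'" using measurable_pr[OF X] by (intro L2I)
  show "L2_norm M' (\<lambda>\<omega>. X (pr \<omega>)) = L2_norm M X"
    using integral_pr[of "\<lambda>\<omega>. (X \<omega>)\<^sup>2"] X by (simp add: L2_norm_def)
qed

lemma N_iexp_mean: "(CLINT \<omega>|M'. iexp (s * N \<omega>)) = exp (- of_real (v * s\<^sup>2) / 2)"
  using M'.normal_variable(5)[OF N v N_law, of s] by (simp add: cf_def exp_of_real[symmetric])

text \<open>Independence is given for the \<sigma>-algebra \<open>?F\<close> of the whole path; a
  finite combination of values is measurable for \<open>?F\<close> and generates a smaller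
  one.\<close>

lemma lincomb_W_indep:
  assumes xs: "snd ` set xs \<subseteq> {0..}"
  shows "(CLINT \<omega>|M'. iexp (s * N \<omega> + lincomb W xs (pr \<omega>))) =
    (CLINT \<omega>|M'. iexp (s * N \<omega>)) * (CLINT \<omega>|M. iexp (lincomb W xs \<omega>))"
proof -
  let ?Y = "\<lambda>\<omega>. lincomb W xs (pr \<omega>)"
  let ?P = "\<lambda>\<omega>. \<lambda>t\<in>{0..}. W t (pr \<omega>)"
  let ?F = "vimage_algebra (space M') ?P (\<Pi>\<^sub>M t\<in>{0..}. borel)"
  have m: "lincomb W xs \<in> borel_measurable M"
    using wiener_frame.lincomb_psi_L2[OF xs] by (rule L2_measurable)
  have P: "?P \<in> ?F \<rightarrow>\<^sub>M (\<Pi>\<^sub>M t\<in>{0::real..}. borel)"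
    by (rule measurable_vimage_algebra1) (auto simp: space_PiM)
  have Wt: "(\<lambda>\<omega>. W t (pr \<omega>)) \<in> borel_measurable ?F" if "0 \<le> t" for t
  proof -
    have "(\<lambda>\<omega>. ?P \<omega> t) \<in> borel_measurable ?F"
      by (rule measurable_compose[OF P measurable_component_singleton]) (use that in simp)
    then show ?thesis using that by simp
  qed
  have "lincomb (\<lambda>t \<omega>. W t (pr \<omega>)) xs \<in> borel_measurable ?F"
    using xs
  proof (induction xs)
    case (Cons y ys)
    obtain c t where y: "y = (c, t)" by fastforce
    with Cons.prems have t: "0 \<le> t" and ys: "snd ` set ys \<subseteq> {0..}" by auto
    show ?case unfolding y lincomb_Cons
      by (intro borel_measurable_add borel_measurable_times borel_measurable_const Wt t Cons.IH ys)
  qed simp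
  moreover have "lincomb (\<lambda>t \<omega>. W t (pr \<omega>)) xs = ?Y" by (simp add: lincomb_def fun_eq_iff)
  ultimately have YF: "?Y \<in> borel_measurable ?F" by simp
  have sub: "sets (vimage_algebra (space M') ?Y borel) \<subseteq> sets ?F"
    using YF by (intro sets_vimage_algebra2[THEN equalityD1] subsetI) (auto simp: sets_vimage_algebra2 measurable_sets dest!: measurable_sets)
  have "M'.indep_set (sets (vimage_algebra (space M') N borel)) (sets (vimage_algebra (space M') ?Y borel))"
    using indep unfolding indep_of_process_def M'.indep_set_def
    by (rule M'.indep_sets_mono_sets) (use sub in \<open>auto split: bool.split\<close>)
  then have "M'.indep_var borel N borel ?Y"
    unfolding M'.indep_var_eq using N measurable_pr[OF m]
    by (simp add: sets_vimage_algebra)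
  then have ind: "M'.indep_var borel (\<lambda>\<omega>. s * N \<omega>) borel (\<lambda>\<omega>. 1 * ?Y \<omega>)"
    using M'.indep_var_compose[of borel N borel ?Y "\<lambda>x. s * x" borel "\<lambda>x. 1 * x" borel] by (simp add: o_def)
  have sN: "(\<lambda>\<omega>. s * N \<omega>) \<in> borel_measurable M'" using N by measurable
  have Ym: "?Y \<in> borel_measurable M'" by (rule measurable_pr[OF m])
  have sum: "(\<lambda>\<omega>. s * N \<omega> + ?Y \<omega>) \<in> borel_measurable M'" using sN Ym by measurable
  have "cf M' (\<lambda>\<omega>. s * N \<omega> + ?Y \<omega>) 1 = cf M' (\<lambda>\<omega>. s * N \<omega>) 1 * cf M' ?Y 1"
    using M'.char_distr_add[OF ind, of 1] char_distr_eq_cf[OF sN] char_distr_eq_cf[OF Ym] char_distr_eq_cf[OF sum]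
    by simp
  moreover have "cf M' ?Y 1 = cf M (lincomb W xs) 1"
    unfolding cf_def by (rule integral_pr[of "\<lambda>\<omega>. iexp (1 * lincomb W xs \<omega>)"]) (use m in measurable)
  ultimately show ?thesis by (simp add: cf_def)
qed

text \<open>A Wiener integral is chosen only up to null sets and need not be measurable for the
  \<sigma>-algebra of the path. Independence therefore passes to it through characteristic functions
  and L2 limits.\<close>

lemma J_indep:
  assumes h: "h \<in> L2 Rplus"
  shows "(CLINT \<omega>|M'. iexp (s * N \<omega> + J h (pr \<omega>))) =
    (CLINT \<omega>|M'. iexp (s * N \<omega>)) * (CLINT \<omega>|M. iexp (J h \<omega>))"
proof -
  obtain xs where xs: "\<And>n. snd ` set (xs n) \<subseteq> {0..}"
    "(\<lambda>n. L2_norm M (\<lambda>x. lincomb W (xs n) x - J h x)) \<longlonglongrightarrow> 0"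
    using wiener_frame.R_sequence[OF J_graph[OF h]] by blast
  have L: "lincomb W (xs n) \<in> L2 M" for n by (rule wiener_frame.lincomb_psi_L2[OF xs(1)])
  have LJ: "J h \<in> L2 M" by (rule J_L2[OF h])
  have D: "(\<lambda>\<omega>. lincomb W (xs n) \<omega> - J h \<omega>) \<in> L2 M" for n by (intro L2_diff L LJ)
  have m: "(\<lambda>\<omega>. s * N \<omega> + X (pr \<omega>)) \<in> borel_measurable M'" if "X \<in> L2 M" for X
    using N measurable_pr[OF L2_measurable[OF that]] by measurable
  have "(\<lambda>n. (CLINT \<omega>|M'. iexp (s * N \<omega> + lincomb W (xs n) (pr \<omega>))) - (CLINT \<omega>|M'. iexp (s * N \<omega> + J h (pr \<omega>)))) \<longlonglongrightarrow> 0"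
  proof (rule Lim_null_comparison[OF always_eventually xs(2)], rule allI)
    fix n
    have "L2_norm M' (\<lambda>\<omega>. (s * N \<omega> + lincomb W (xs n) (pr \<omega>)) - (s * N \<omega> + J h (pr \<omega>))) =
        L2_norm M (\<lambda>x. lincomb W (xs n) x - J h x)"
      using L2_pr(2)[OF D, of n] by simp
    moreover have "(\<lambda>\<omega>. (s * N \<omega> + lincomb W (xs n) (pr \<omega>)) - (s * N \<omega> + J h (pr \<omega>))) \<in> L2 M'"
      using L2_pr(1)[OF D, of n] by simp
    ultimately show "norm ((CLINT \<omega>|M'. iexp (s * N \<omega> + lincomb W (xs n) (pr \<omega>))) - (CLINT \<omega>|M'. iexp (s * N \<omega> + J h (pr \<omega>)))) \<le>
        L2_norm M (\<lambda>x. lincomb W (xs n) x - J h x)"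
      using M'.iexp_mean_close[OF m[OF L] m[OF LJ], of n] by metis
  qed
  then have 1: "(\<lambda>n. CLINT \<omega>|M'. iexp (s * N \<omega> + lincomb W (xs n) (pr \<omega>))) \<longlonglongrightarrow> (CLINT \<omega>|M'. iexp (s * N \<omega> + J h (pr \<omega>)))"
    by (simp only: LIM_zero_iff)
  have "(\<lambda>n. cf M (lincomb W (xs n)) 1) \<longlonglongrightarrow> cf M (J h) 1"
    by (rule cf_L2_limit[OF L LJ xs(2)])
  then have "(\<lambda>n. (CLINT \<omega>|M'. iexp (s * N \<omega>)) * (CLINT \<omega>|M. iexp (lincomb W (xs n) \<omega>))) \<longlonglongrightarrow>
      (CLINT \<omega>|M'. iexp (s * N \<omega>)) * (CLINT \<omega>|M. iexp (J h \<omega>))"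
    by (intro tendsto_mult tendsto_const) (simp add: cf_def)
  then have 2: "(\<lambda>n. CLINT \<omega>|M'. iexp (s * N \<omega> + lincomb W (xs n) (pr \<omega>))) \<longlonglongrightarrow>
      (CLINT \<omega>|M'. iexp (s * N \<omega>)) * (CLINT \<omega>|M. iexp (J h \<omega>))"
    by (simp only: lincomb_W_indep[OF xs(1)])
  show ?thesis by (rule LIMSEQ_unique[OF 1 2])
qed

theorem cf_sum_spectral:
  assumes s: "spectral f d l u"
  shows "cf M' (\<lambda>\<omega>. N \<omega> + I2 f (pr \<omega>)) t = exp (log_cf d l t - of_real (v * t\<^sup>2) / 2)"
proof -
  have on: "orthonormal d u" and f: "f \<in> L2_sym"
    and eq: "AE z in Rplus2. f z = (\<Sum>i<d. l i * tensor (u i) (u i) z)"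
    using s by (auto simp: spectral_def)
  have u: "u i \<in> L2 Rplus" "L2_inner Rplus (u i) (u i) = 1" if "i < d" for i
    using on that by (auto simp: orthonormal_def)
  have I2_eq: "AE \<omega> in M. I2 f \<omega> = (\<Sum>i<d. l i * ((J (u i) \<omega>)\<^sup>2 - (L2_norm Rplus (u i))\<^sup>2))"
    by (rule I2_lincomb_tensor[OF _ f eq]) (rule u(1))
  have n1: "(L2_norm Rplus (u i))\<^sup>2 = 1" if "i < d" for i using u that by (simp add: L2_norm_sq)
  \<comment> \<open>Slot \<open>d\<close> holds \<open>N\<close> and the slots below it the Wiener
    integrals, so one application of Kac's theorem covers all \<open>Suc d\<close>
    variables.\<close>
  define X where "X i \<omega> = (if i = d then N \<omega> else J (u i) (pr \<omega>))" for i \<omega>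
  define g where "g i x = (if i = d then iexp (t * x) else iexp (t * l i * (x\<^sup>2 - 1)))" for i and x :: real
  have Xm: "X i \<in> borel_measurable M'" if "i < Suc d" for i
    using that N measurable_pr[OF J_measurable[OF u(1)]] by (cases "i = d") (auto simp: X_def[abs_def])
  have XN: "X d = N" and XJ: "i < d \<Longrightarrow> X i = (\<lambda>\<omega>. J (u i) (pr \<omega>))" for i
    by (auto simp: X_def[abs_def])
  have Jpr: "(CLINT \<omega>|M'. k (J (u i) (pr \<omega>))) = (CLINT \<omega>|M. k (J (u i) \<omega>))"
    if "k \<in> borel_measurable borel" "i < d" for k :: "real \<Rightarrow> complex" and i
    using integral_pr[OF measurable_compose[OF J_measurable[OF u(1)[OF that(2)]] that(1)]] .
  have "cf M' (\<lambda>\<omega>. N \<omega> + I2 f (pr \<omega>)) t = (CLINT \<omega>|M'. \<Prod>i<Suc d. g i (X i \<omega>))"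
    unfolding cf_def
  proof (rule integral_cong_AE)
    show "(\<lambda>\<omega>. iexp (t * (N \<omega> + I2 f (pr \<omega>)))) \<in> borel_measurable M'"
      using measurable_pr[OF I2_L2[OF f, THEN L2_measurable]] N by measurable
    show "(\<lambda>\<omega>. \<Prod>i<Suc d. g i (X i \<omega>)) \<in> borel_measurable M'"
    proof (rule borel_measurable_prod)
      fix i assume i: "i \<in> {..<Suc d}"
      have "g i \<in> borel_measurable borel" unfolding g_def[abs_def] by measurable
      then show "(\<lambda>\<omega>. g i (X i \<omega>)) \<in> borel_measurable M'"
        using measurable_compose[OF Xm] i by simp
    qed
    show "AE \<omega> in M'. iexp (t * (N \<omega> + I2 f (pr \<omega>))) = (\<Prod>i<Suc d. g i (X i \<omega>))"
      using AE_pr[OF I2_eq]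
    proof eventually_elim
      case (elim \<omega>)
      have "t * (N \<omega> + I2 f (pr \<omega>)) = (\<Sum>i<d. t * l i * ((J (u i) (pr \<omega>))\<^sup>2 - 1)) + t * N \<omega>"
        unfolding elim distrib_left sum_distrib_left using n1 by (subst add.commute, intro arg_cong2[of _ _ _ _ "(+)"] sum.cong) (auto simp: mult.assoc)
      then have "iexp (t * (N \<omega> + I2 f (pr \<omega>))) = (\<Prod>i<d. iexp (t * l i * ((J (u i) (pr \<omega>))\<^sup>2 - 1))) * iexp (t * N \<omega>)"
        by (simp add: exp_add exp_sum sum_distrib_left distrib_left)
      also have "\<dots> = (\<Prod>i<Suc d. g i (X i \<omega>))" unfolding g_def X_def by simp
      finally show ?case .
    qed
  qed
  also have "\<dots> = (\<Prod>i<Suc d. CLINT \<omega>|M'. g i (X i \<omega>))"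
  proof (rule M'.factor_joint_cf[OF Xm])
    fix a :: "nat \<Rightarrow> real"
    let ?h = "\<lambda>x. \<Sum>i<d. a i * u i x"
    have h: "?h \<in> L2 Rplus" by (rule orthonormal_combination_norm(1)[OF on])
    have J_eq: "AE \<omega> in M. J ?h \<omega> = (\<Sum>i<d. a i * J (u i) \<omega>)"
      by (rule J_sum) (rule u(1))
    have "(CLINT \<omega>|M'. iexp (\<Sum>i<Suc d. a i * X i \<omega>)) = (CLINT \<omega>|M'. iexp (a d * N \<omega> + J ?h (pr \<omega>)))"
    proof (rule integral_cong_AE)
      show "AE \<omega> in M'. iexp (\<Sum>i<Suc d. a i * X i \<omega>) = iexp (a d * N \<omega> + J ?h (pr \<omega>))"
        using AE_pr[OF J_eq]
      proof eventually_elim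
        case (elim \<omega>)
        have "(\<Sum>i<Suc d. a i * X i \<omega>) = (\<Sum>i<d. a i * J (u i) (pr \<omega>)) + a d * N \<omega>"
          by (simp add: X_def)
        then show ?case unfolding elim by (simp add: add.commute)
      qed
    next
      have "(\<lambda>\<omega>. \<Sum>i<Suc d. a i * X i \<omega>) \<in> borel_measurable M'"
        using Xm by (intro borel_measurable_sum borel_measurable_times) auto
      then show "(\<lambda>\<omega>. iexp (\<Sum>i<Suc d. a i * X i \<omega>)) \<in> borel_measurable M'" by measurable
      show "(\<lambda>\<omega>. iexp (a d * N \<omega> + J ?h (pr \<omega>))) \<in> borel_measurable M'"
        using N measurable_pr[OF J_measurable[OF h]] by measurable
    qed
    also have "\<dots> = (CLINT \<omega>|M'. iexp (a d * N \<omega>)) * (\<Prod>i<d. exp (- of_real ((a i)\<^sup>2) / 2))"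
      unfolding J_indep[OF h] J_iexp_mean[OF h] orthonormal_combination_norm(2)[OF on]
      by (simp add: exp_sum[symmetric] sum_negf sum_divide_distrib)
    also have "(\<Prod>i<d. exp (- of_real ((a i)\<^sup>2) / 2)) = (\<Prod>i<d. CLINT \<omega>|M'. iexp (a i * X i \<omega>))"
    proof (rule prod.cong[OF refl])
      fix i assume "i \<in> {..<d}"
      then have i: "i < d" by simp
      have "(CLINT \<omega>|M'. iexp (a i * X i \<omega>)) = (CLINT \<omega>|M. iexp (a i * J (u i) \<omega>))"
        unfolding XJ[OF i] by (rule Jpr[OF _ i]) measurable
      then show "exp (- of_real ((a i)\<^sup>2) / 2) = (CLINT \<omega>|M'. iexp (a i * X i \<omega>))"
        unfolding J_single_cf[OF on i] by simp
    qed
    finally show "(CLINT \<omega>|M'. iexp (\<Sum>i<Suc d. a i * X i \<omega>)) = (\<Prod>i<Suc d. CLINT \<omega>|M'. iexp (a i * X i \<omega>))"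
      by (simp add: XN mult.commute)
  next
    show "g i \<in> borel_measurable borel" for i unfolding g_def[abs_def] by measurable
    show "cmod (g i x) \<le> 1" for i x
      unfolding g_def by (simp del: of_real_mult of_real_diff of_real_power)
  qed
  also have "\<dots> = (\<Prod>i<d. exp (log_chi (t * l i))) * exp (- of_real (v * t\<^sup>2) / 2)"
  proof -
    have "(CLINT \<omega>|M'. g i (X i \<omega>)) = exp (log_chi (t * l i))" if i: "i < d" for i
    proof -
      have gi: "g i = (\<lambda>x. iexp (t * l i * (x\<^sup>2 - 1)))" using i by (simp add: g_def fun_eq_iff)
      have "(CLINT \<omega>|M'. g i (X i \<omega>)) = (CLINT \<omega>|M. iexp (t * l i * ((J (u i) \<omega>)\<^sup>2 - 1)))"
        unfolding XJ[OF i] gi by (rule Jpr[OF _ i]) measurable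
      then show ?thesis unfolding J_square_cf[OF u(1)[OF i] u(2)[OF i]] .
    qed
    moreover have "(CLINT \<omega>|M'. g d (X d \<omega>)) = exp (- of_real (v * t\<^sup>2) / 2)"
      using N_iexp_mean[of t] by (simp add: g_def XN)
    ultimately show ?thesis by simp
  qed
  also have "(\<Prod>i<d. exp (log_chi (t * l i))) = exp (log_cf d l t)"
    unfolding log_cf_def by (rule exp_sum[symmetric]) simp
  also have "exp (log_cf d l t) * exp (- of_real (v * t\<^sup>2) / 2) = exp (log_cf d l t - of_real (v * t\<^sup>2) / 2)"
    unfolding exp_add[symmetric] by simp
  finally show ?thesis .
qed

end

section \<open>Spectral decomposition of finite-rank kernels\<close>

lemma orthonormal_inner_sum:
  assumes "orthonormal d e" "k < d"
  shows "L2_inner Rplus (\<lambda>x. \<Sum>j<d. c j * e j x) (e k) = c k"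
proof -
  have e: "e j \<in> L2 Rplus" if "j < d" for j using assms(1) that by (simp add: orthonormal_def)
  have "L2_inner Rplus (\<lambda>x. \<Sum>j<d. c j * e j x) (e k) = (\<Sum>j<d. c j * L2_inner Rplus (e j) (e k))"
    by (rule L2_inner_sum_left) (use e assms in auto)
  also have "\<dots> = (\<Sum>j<d. if k = j then c j else 0)"
    using assms by (intro sum.cong) (auto simp: orthonormal_def)
  also have "\<dots> = c k" using assms(2) by simp
  finally show ?thesis .
qed

text \<open>A residual of norm 0 adds no vector, so the given family may be dependent and
  \<open>d\<close> smaller than \<open>n\<close>.\<close>

lemma gram_schmidt:
  fixes n :: nat
  assumes "\<And>i. i < n \<Longrightarrow> h i \<in> L2 Rplus"
  shows "\<exists>d e b. orthonormal d e \<and> (\<forall>i<n. AE x in Rplus. h i x = (\<Sum>j<d. b i j * e j x))"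
  using assms
proof (induction n)
  case 0
  show ?case by (intro exI[of _ 0]) (simp add: orthonormal_def)
next
  case (Suc n)
  then obtain d e b where on: "orthonormal d e"
    and b: "\<And>i. i < n \<Longrightarrow> AE x in Rplus. h i x = (\<Sum>j<d. b i j * e j x)" by auto
  have e: "e j \<in> L2 Rplus" if "j < d" for j using on that by (simp add: orthonormal_def)
  have hn: "h n \<in> L2 Rplus" using Suc.prems by simp
  define c where "c j = L2_inner Rplus (h n) (e j)" for j
  let ?p = "\<lambda>x. \<Sum>j<d. c j * e j x"
  define r where "r x = h n x - ?p x" for x
  have p: "?p \<in> L2 Rplus" using e by (auto intro!: L2_sum L2_scale)
  have r: "r \<in> L2 Rplus" unfolding r_def using hn p by (rule L2_diff)
  have re: "L2_inner Rplus r (e k) = 0" if "k < d" for k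
  proof -
    have "L2_inner Rplus (\<lambda>x. 1 * h n x + (- 1) * ?p x) (e k) = 1 * c k + (- 1) * c k"
      unfolding L2_inner_lincomb_left[OF hn p e[OF that]] orthonormal_inner_sum[OF on that] by (simp add: c_def)
    then show ?thesis by (simp add: r_def[abs_def])
  qed
  show ?case
  proof (cases "L2_norm Rplus r = 0")
    case True
    then have "AE x in Rplus. r x = 0" using L2_norm_eq_0_iff[OF r] by simp
    then have "AE x in Rplus. h n x = ?p x" by eventually_elim (simp add: r_def)
    then have "\<forall>i<Suc n. AE x in Rplus. h i x = (\<Sum>j<d. (if i = n then c j else b i j) * e j x)"
      using b by (auto simp: less_Suc_eq)
    then show ?thesis using on by (intro exI[of _ d] exI[of _ e] exI[of _ "\<lambda>i j. if i = n then c j else b i j"]) simp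
  next
    case False
    define w where "w x = (1 / L2_norm Rplus r) * r x" for x
    have w: "w \<in> L2 Rplus" unfolding w_def using r by (rule L2_scale)
    have rr: "L2_inner Rplus r r = (L2_norm Rplus r)\<^sup>2" by (simp add: L2_norm_sq)
    have sc: "L2_inner Rplus w g = (1 / L2_norm Rplus r) * L2_inner Rplus r g" if "g \<in> L2 Rplus" for g
      using L2_inner_lincomb_left[OF r r that, of "1 / L2_norm Rplus r" 0] by (simp add: w_def[abs_def])
    have ww: "L2_inner Rplus w w = 1"
      unfolding sc[OF w] L2_inner_commute[of _ r w] sc[OF r] rr using False by (simp add: power2_eq_square)
    have we: "L2_inner Rplus w (e k) = 0" if "k < d" for k unfolding sc[OF e[OF that]] re[OF that] by simp
    have we': "L2_inner Rplus (e k) w = 0" if "k < d" for k using we[OF that] by (simp add: L2_inner_commute)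
    define e' where "e' = e(d := w)"
    have "orthonormal (Suc d) e'"
      using on w ww we we' by (auto simp: orthonormal_def e'_def less_Suc_eq)
    moreover have "AE x in Rplus. h i x = (\<Sum>j<Suc d. (if i = n then (if j = d then L2_norm Rplus r else c j)
        else if j = d then 0 else b i j) * e' j x)" if "i < Suc n" for i
    proof (cases "i = n")
      case True
      have "h n x = ?p x + L2_norm Rplus r * w x" for x using False by (simp add: w_def r_def)
      then show ?thesis using True by (simp add: e'_def)
    next
      case False
      then have "AE x in Rplus. h i x = (\<Sum>j<d. b i j * e j x)" using b that by simp
      then show ?thesis using False by (simp add: e'_def)
    qed
    ultimately show ?thesis
      by (intro exI[of _ "Suc d"] exI[of _ e'] exI[of _ "\<lambda>i j. if i = n then (if j = d then L2_norm Rplus r else c j)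
        else if j = d then 0 else b i j"]) simp
  qed
qed

text \<open>A maximizer \<open>v\<close> of the absolute value of the quadratic form on the unit sphere is an
  eigenvector.\<close>

lemma symmetric_matrix_eigenvector:
  fixes a :: "nat \<Rightarrow> nat \<Rightarrow> real"
  assumes sym: "\<And>i j. a i j = a j i" and nz: "\<exists>i<d. \<exists>j<d. a i j \<noteq> 0"
  shows "\<exists>v \<mu>. \<mu> \<noteq> 0 \<and> (\<Sum>i<d. (v i)\<^sup>2) = 1 \<and> (\<forall>i<d. (\<Sum>j<d. a i j * v j) = \<mu> * v i)"
proof -
  define q where "q v = (\<Sum>i<d. \<Sum>j<d. a i j * v i * v j)" for v :: "nat \<Rightarrow> real"
  define B where "B u v = (\<Sum>i<d. \<Sum>j<d. a i j * u i * v j)" for u v :: "nat \<Rightarrow> real"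
  define nn where "nn v = (\<Sum>i<d. (v i)\<^sup>2)" for v :: "nat \<Rightarrow> real"
  have Bsym: "B u v = B v u" for u v
    unfolding B_def by (subst sum.swap) (simp add: sym mult_ac)
  have q_lin: "q (\<lambda>i. u i + e * v i) = q u + 2 * e * B v u + e\<^sup>2 * q v" for u v e
  proof -
    have "q (\<lambda>i. u i + e * v i) = q u + e * B u v + e * B v u + e\<^sup>2 * q v"
      unfolding q_def B_def sum_distrib_left sum.distrib[symmetric]
      by (intro sum.cong refl) (simp add: algebra_simps power2_eq_square)
    then show ?thesis using Bsym[of u v] by simp
  qed
  have q_scale: "q (\<lambda>i. c * v i) = c\<^sup>2 * q v" for c v
    unfolding q_def sum_distrib_left by (intro sum.cong refl) (simp add: power2_eq_square)
  have n_lin: "nn (\<lambda>i. u i + e * v i) = nn u + 2 * e * (\<Sum>i<d. v i * u i) + e\<^sup>2 * nn v" for u v e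
    unfolding nn_def sum_distrib_left sum.distrib[symmetric]
    by (intro sum.cong refl) (simp add: algebra_simps power2_eq_square)
  have n_scale: "nn (\<lambda>i. c * v i) = c\<^sup>2 * nn v" for c v
    unfolding nn_def sum_distrib_left by (intro sum.cong refl) (simp add: power_mult_distrib)
  have n0: "0 \<le> nn v" for v unfolding nn_def by (simp add: sum_nonneg)
  \<comment> \<open>\<open>nn\<close> sees only the coordinates below \<open>d\<close>; confining
    all of them to \<open>{-1..1}\<close> makes the set compact by Tychonoff's theorem.\<close>
  define S where "S = (PiE UNIV (\<lambda>_. {-1..1})) \<inter> {v. nn v = 1}"
  have "compactin (product_topology (\<lambda>_::nat. euclidean) UNIV) (PiE UNIV (\<lambda>_. {-1..1::real}))"
    unfolding compactin_PiE by (simp add: compactin_euclidean_iff)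
  then have cube: "compact (PiE UNIV (\<lambda>_::nat. {-1..1::real}))"
    by (simp add: euclidean_product_topology compactin_euclidean_iff)
  have coord: "continuous_on A (\<lambda>v::nat \<Rightarrow> real. v i)" for A i
    by (rule continuous_on_subset[OF continuous_on_product_coordinates]) simp
  have cn: "continuous_on UNIV nn" unfolding nn_def by (intro continuous_intros coord)
  have "closed {v. nn v = 1}"
    using continuous_closed_preimage_constant[OF cn closed_UNIV, of 1] by simp
  with cube have compact: "compact S" unfolding S_def by (rule compact_Int_closed)
  have cq: "continuous_on S (\<lambda>v. \<bar>q v\<bar>)" unfolding q_def by (intro continuous_intros coord)
  obtain i0 j0 where ij: "i0 < d" "j0 < d" "a i0 j0 \<noteq> 0" using nz by blast
  have "(\<lambda>i. if i = i0 then 1 else 0) \<in> S"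
    using ij by (auto simp: S_def nn_def if_distrib[of "\<lambda>x. x\<^sup>2"] cong: if_cong)
  then have "S \<noteq> {}" by blast
  from continuous_attains_sup[OF compact this cq] obtain v
    where v: "v \<in> S" and max: "\<And>w. w \<in> S \<Longrightarrow> \<bar>q w\<bar> \<le> \<bar>q v\<bar>" by blast
  have nv: "nn v = 1" using v by (simp add: S_def)
  have bound: "\<bar>q w\<bar> \<le> \<bar>q v\<bar> * nn w" for w
  proof (cases "nn w = 0")
    case True
    then have "w i = 0" if "i < d" for i
      using that unfolding nn_def by (simp add: sum_nonneg_eq_0_iff)
    then have "q w = 0" by (simp add: q_def)
    then show ?thesis using True by simp
  next
    case False
    then have pos: "0 < nn w" using n0[of w] by simp
    \<comment> \<open>Cut off beyond \<open>d\<close> in order to stay in the cube; this changes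
      neither \<open>q\<close> nor \<open>nn\<close>.\<close>
    define w' where "w' i = (if i < d then (1 / sqrt (nn w)) * w i else 0)" for i
    have nw': "nn w' = 1"
    proof -
      have "nn w' = nn (\<lambda>i. (1 / sqrt (nn w)) * w i)"
        unfolding nn_def[of w'] nn_def[of "\<lambda>i. (1 / sqrt (nn w)) * w i"]
        by (intro sum.cong) (auto simp: w'_def)
      also have "\<dots> = 1" unfolding n_scale using pos by (simp add: power_divide)
      finally show ?thesis .
    qed
    have "\<bar>w' i\<bar> \<le> 1" for i
    proof (cases "i < d")
      case True
      then have "(w' i)\<^sup>2 \<le> nn w'" unfolding nn_def by (intro member_le_sum) auto
      then show ?thesis unfolding nw' by (simp add: abs_square_le_1)
    qed (simp add: w'_def)
    then have "w' i \<in> {-1..1}" for i using abs_le_iff[of "w' i" 1] by fastforce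
    then have "w' \<in> S" using nw' by (auto simp: S_def)
    then have "\<bar>q w'\<bar> \<le> \<bar>q v\<bar>" by (rule max)
    moreover have "q w' = q (\<lambda>i. (1 / sqrt (nn w)) * w i)" unfolding q_def by (intro sum.cong) (auto simp: w'_def)
    then have "q w' = q w / nn w" unfolding q_scale using pos by (simp add: power_divide)
    ultimately show ?thesis using pos by (simp add: abs_div_pos[symmetric] divide_le_eq)
  qed
  \<comment> \<open>If the maximum were 0, then \<open>q\<close> would vanish identically, and
    polarization would make the entry at \<open>i0\<close>, \<open>j0\<close> vanish too.\<close>
  have qv: "q v \<noteq> 0"
  proof
    assume "q v = 0"
    then have q0: "q w = 0" for w using bound[of w] by simp
    let ?\<delta> = "\<lambda>k i. if i = k then 1 else 0 :: real"
    have "B (?\<delta> i0) (?\<delta> j0) = 0"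
      using q_lin[of "?\<delta> j0" 1 "?\<delta> i0"] by (simp add: q0)
    moreover have "B (?\<delta> i0) (?\<delta> j0) = a i0 j0"
    proof -
      have "B (?\<delta> i0) (?\<delta> j0) = (\<Sum>i<d. if i = i0 then \<Sum>j<d. if j = j0 then a i j else 0 else 0)"
        unfolding B_def by (intro sum.cong refl) (simp add: if_distrib[of "\<lambda>x. _ * x"] cong: if_cong)
      also have "\<dots> = (\<Sum>j<d. if j = j0 then a i0 j else 0)" using ij by simp
      also have "\<dots> = a i0 j0" using ij by simp
      finally show ?thesis .
    qed
    ultimately show False using ij by simp
  qed
  define s where "s = sgn (q v)"
  have s2: "s * s = 1" using qv by (simp add: s_def sgn_if)
  have sq: "s * q v = \<bar>q v\<bar>" by (simp add: s_def sgn_mult_abs mult.commute abs_sgn)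
  \<comment> \<open>The form \<open>\<bar>q v\<bar> * nn - s * q\<close> is nonnegative and vanishes
    at \<open>v\<close>, so its derivative \<open>2 * ?D\<close> in the direction \<open>u\<close>
    must be 0.\<close>
  have key: "B u v = q v * (\<Sum>i<d. u i * v i)" for u
  proof -
    let ?D = "\<bar>q v\<bar> * (\<Sum>i<d. u i * v i) - s * B u v"
    let ?C = "\<bar>q v\<bar> * nn u - s * q u"
    have nonneg: "0 \<le> 2 * e * ?D + e\<^sup>2 * ?C" for e
    proof -
      have "s * q (\<lambda>i. v i + e * u i) \<le> \<bar>q (\<lambda>i. v i + e * u i)\<bar>"
        using qv by (auto simp: s_def sgn_if)
      also have "\<dots> \<le> \<bar>q v\<bar> * nn (\<lambda>i. v i + e * u i)" by (rule bound)
      finally have "0 \<le> \<bar>q v\<bar> * (nn v + 2 * e * (\<Sum>i<d. u i * v i) + e\<^sup>2 * nn u) -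
          s * (q v + 2 * e * B u v + e\<^sup>2 * q u)"
        unfolding q_lin n_lin by simp
      then show ?thesis using sq nv by (simp add: algebra_simps)
    qed
    have "?D = 0"
    proof (rule ccontr)
      assume D: "?D \<noteq> 0"
      \<comment> \<open>So small that the linear term wins: the value becomes
        \<open>e\<^sup>2 * (?C - 2 * (1 + \<bar>?C\<bar>))\<close>, which is negative.\<close>
      define e where "e = - ?D / (1 + \<bar>?C\<bar>)"
      have pos: "0 < 1 + \<bar>?C\<bar>" by simp
      have eD: "e * (1 + \<bar>?C\<bar>) = - ?D" unfolding e_def using pos by simp
      have "e \<noteq> 0" using D eD by auto
      have eq: "2 * e * ?D + e\<^sup>2 * ?C = e\<^sup>2 * (?C - 2 * (1 + \<bar>?C\<bar>))"
      proof -
        have "2 * e * ?D = - (2 * e * (e * (1 + \<bar>?C\<bar>)))" unfolding eD by (simp add: algebra_simps)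
        then show ?thesis by (simp add: power2_eq_square algebra_simps)
      qed
      have "x - 2 * (1 + \<bar>x\<bar>) < 0" for x :: real by (simp add: abs_if)
      then have neg: "?C - 2 * (1 + \<bar>?C\<bar>) < 0" .
      from neg have "e\<^sup>2 * (?C - 2 * (1 + \<bar>?C\<bar>)) < 0" using \<open>e \<noteq> 0\<close> by (simp add: mult_pos_neg)
      then show False using nonneg[of e] unfolding eq by linarith
    qed
    then have "s * (s * B u v) = s * (\<bar>q v\<bar> * (\<Sum>i<d. u i * v i))" by simp
    moreover have "s * \<bar>q v\<bar> = q v" by (simp add: s_def sgn_mult_abs)
    ultimately show ?thesis using s2 by (simp flip: mult.assoc)
  qed
  have "(\<Sum>j<d. a i j * v j) = q v * v i" if "i < d" for i
  proof -
    let ?\<delta> = "\<lambda>k. if k = i then 1 else 0 :: real"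
    have "B ?\<delta> v = (\<Sum>k<d. if k = i then \<Sum>j<d. a k j * v j else 0)"
      unfolding B_def by (intro sum.cong refl) (auto intro!: sum.cong)
    also have "\<dots> = (\<Sum>j<d. a i j * v j)" using that by simp
    finally have 1: "B ?\<delta> v = (\<Sum>j<d. a i j * v j)" .
    have "(\<Sum>k<d. ?\<delta> k * v k) = (\<Sum>k<d. if k = i then v k else 0)" by (intro sum.cong refl) auto
    also have "\<dots> = v i" using that by simp
    finally show ?thesis using key[of ?\<delta>] 1 by simp
  qed
  then show ?thesis using nv qv by (intro exI[of _ v] exI[of _ "q v"]) (simp add: nn_def)
qed

text \<open>Deflation: as long as \<open>a - \<Sum> l\<^sub>k v\<^sub>k v\<^sub>k\<^sup>T\<close> is not zero, it has a further eigenvector for a nonzero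
  eigenvalue, which is orthogonal to the previous ones; Bessel's inequality bounds their number.\<close>

lemma symmetric_matrix_diagonalization:
  fixes a :: "nat \<Rightarrow> nat \<Rightarrow> real"
  assumes sym: "\<And>i j. a i j = a j i"
  shows "\<exists>(n::nat) l v. (\<forall>p<n. \<forall>q<n. (\<Sum>i<d. v p i * v q i) = of_bool (p = q)) \<and> (\<forall>p<n. l p \<noteq> 0) \<and>
    (\<forall>i<d. \<forall>j<d. a i j = (\<Sum>p<n. l p * v p i * v p j))"
proof -
  \<comment> \<open>\<open>P\<close> only collects orthonormal eigenvectors of \<open>a\<close>;
    that they already represent \<open>a\<close> is the stopping condition.\<close>
  define P where "P n l v \<longleftrightarrow> (\<forall>p<n. \<forall>q<n. (\<Sum>i<d. v p i * v q i) = of_bool (p = q)) \<and> (\<forall>p<n. l p \<noteq> 0) \<and>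
    (\<forall>p<n. \<forall>i<d. (\<Sum>j<d. a i j * v p j) = l p * v p i)" for n and l :: "nat \<Rightarrow> real" and v :: "nat \<Rightarrow> nat \<Rightarrow> real"
  have bessel: "n \<le> d" if "P n l v" for n l v
  proof -
    have on: "(\<Sum>i<d. v p i * v q i) = of_bool (p = q)" if "p < n" "q < n" for p q
      using \<open>P n l v\<close> that by (simp add: P_def)
    \<comment> \<open>Bessel's inequality for the unit vector with index \<open>i\<close>; summed
      over \<open>i < d\<close> it gives \<open>n \<le> d\<close>.\<close>
    have le1: "(\<Sum>p<n. (v p i)\<^sup>2) \<le> 1" if i: "i < d" for i
    proof -
      let ?c = "\<lambda>p. v p i"
      let ?s = "\<lambda>k. \<Sum>p<n. ?c p * v p k"
      have cross: "(\<Sum>k<d. (if k = i then 1 else 0) * ?s k) = (\<Sum>p<n. (v p i)\<^sup>2)"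
      proof -
        have "(\<Sum>k<d. (if k = i then 1 else 0) * ?s k) = (\<Sum>k<d. if k = i then ?s k else 0)"
          by (intro sum.cong) auto
        then show ?thesis using i by (simp add: power2_eq_square)
      qed
      have "(\<Sum>k<d. ?s k * ?s k) = (\<Sum>k<d. \<Sum>p<n. \<Sum>q<n. ?c p * ?c q * (v p k * v q k))"
        by (intro sum.cong refl) (simp add: sum_product mult_ac)
      also have "\<dots> = (\<Sum>p<n. \<Sum>k<d. \<Sum>q<n. ?c p * ?c q * (v p k * v q k))" by (rule sum.swap)
      also have "\<dots> = (\<Sum>p<n. \<Sum>q<n. \<Sum>k<d. ?c p * ?c q * (v p k * v q k))"
        by (intro sum.cong refl sum.swap)
      also have "\<dots> = (\<Sum>p<n. \<Sum>q<n. if p = q then ?c p * ?c q else 0)"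
        by (intro sum.cong refl) (simp add: on flip: sum_distrib_left)
      also have "\<dots> = (\<Sum>p<n. (v p i)\<^sup>2)" by (simp add: power2_eq_square)
      finally have sq: "(\<Sum>k<d. ?s k * ?s k) = (\<Sum>p<n. (v p i)\<^sup>2)" .
      have "0 \<le> (\<Sum>k<d. ((if k = i then 1 else 0) - ?s k)\<^sup>2)" by (intro sum_nonneg) simp
      also have "\<dots> = (\<Sum>k<d. (if k = i then 1 else 0) - 2 * ((if k = i then 1 else 0) * ?s k) + ?s k * ?s k)"
        by (intro sum.cong refl) (simp add: power2_eq_square algebra_simps)
      also have "\<dots> = 1 - 2 * (\<Sum>p<n. (v p i)\<^sup>2) + (\<Sum>p<n. (v p i)\<^sup>2)"
        unfolding sum.distrib sum_subtractf sum_distrib_left[symmetric] cross sq using i by simp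
      finally show ?thesis by simp
    qed
    have "real n = (\<Sum>p<n. \<Sum>i<d. (v p i)\<^sup>2)" using on by (simp add: power2_eq_square)
    also have "\<dots> = (\<Sum>i<d. \<Sum>p<n. (v p i)\<^sup>2)" by (rule sum.swap)
    also have "\<dots> \<le> (\<Sum>i<d. 1)" by (intro sum_mono le1) simp
    finally show ?thesis by simp
  qed
  have step: "\<exists>l' v'. P (Suc n) l' v'"
    if P: "P n l v" and ne: "\<not> (\<forall>i<d. \<forall>j<d. a i j = (\<Sum>p<n. l p * v p i * v p j))" for n l v
  proof -
    have on: "(\<Sum>i<d. v p i * v q i) = of_bool (p = q)" if "p < n" "q < n" for p q
      using P that by (simp add: P_def)
    have eig: "(\<Sum>j<d. a i j * v p j) = l p * v p i" if "p < n" "i < d" for p i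
      using P that by (simp add: P_def)
    define b where "b i j = a i j - (\<Sum>p<n. l p * v p i * v p j)" for i j
    have bsym: "b i j = b j i" for i j by (simp add: b_def sym[of i j] mult_ac)
    have "\<exists>i<d. \<exists>j<d. b i j \<noteq> 0" using ne by (auto simp: b_def)
    from symmetric_matrix_eigenvector[OF bsym this] obtain w m where m: "m \<noteq> 0"
      and w1: "(\<Sum>i<d. (w i)\<^sup>2) = 1" and w: "\<And>i. i < d \<Longrightarrow> (\<Sum>j<d. b i j * w j) = m * w i" by blast
    have bv: "(\<Sum>j<d. b i j * x j) = (\<Sum>j<d. a i j * x j) - (\<Sum>p<n. l p * v p i * (\<Sum>j<d. v p j * x j))" for i x
    proof -
      have "(\<Sum>j<d. b i j * x j) = (\<Sum>j<d. a i j * x j) - (\<Sum>j<d. \<Sum>p<n. l p * v p i * v p j * x j)"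
        by (simp add: b_def left_diff_distrib sum_subtractf sum_distrib_right)
      also have "(\<Sum>j<d. \<Sum>p<n. l p * v p i * v p j * x j) = (\<Sum>p<n. \<Sum>j<d. l p * v p i * v p j * x j)"
        by (rule sum.swap)
      finally show ?thesis by (simp add: sum_distrib_left mult.assoc)
    qed
    have bv0: "(\<Sum>j<d. b i j * v p j) = 0" if "p < n" "i < d" for p i
    proof -
      have "(\<Sum>k<n. l k * v k i * (\<Sum>j<d. v k j * v p j)) = (\<Sum>k<n. if k = p then l k * v k i else 0)"
        using that by (intro sum.cong refl) (simp add: on)
      then show ?thesis unfolding bv eig[OF that] using that by simp
    qed
    \<comment> \<open>\<open>b\<close> is symmetric and kills the earlier eigenvectors, so an
      eigenvector of \<open>b\<close> for \<open>m \<noteq> 0\<close> is orthogonal to them. On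
      vectors orthogonal to them \<open>a\<close> and \<open>b\<close> agree.\<close>
    have orth: "(\<Sum>i<d. w i * v p i) = 0" if p: "p < n" for p
    proof -
      have "m * (\<Sum>i<d. w i * v p i) = (\<Sum>i<d. (m * w i) * v p i)" by (simp add: sum_distrib_left mult.assoc)
      also have "\<dots> = (\<Sum>i<d. (\<Sum>j<d. b i j * w j) * v p i)" by (intro sum.cong refl) (simp add: w)
      also have "\<dots> = (\<Sum>i<d. \<Sum>j<d. b i j * w j * v p i)" by (simp add: sum_distrib_right)
      also have "\<dots> = (\<Sum>j<d. \<Sum>i<d. b i j * w j * v p i)" by (rule sum.swap)
      also have "\<dots> = (\<Sum>j<d. w j * (\<Sum>i<d. b j i * v p i))"
        unfolding sum_distrib_left by (intro sum.cong refl) (subst bsym, simp add: mult_ac)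
      also have "\<dots> = 0" by (intro sum.neutral ballI) (simp add: bv0[OF p])
      finally show ?thesis using m by simp
    qed
    have aw: "(\<Sum>j<d. a i j * w j) = m * w i" if "i < d" for i
    proof -
      have "(\<Sum>p<n. l p * v p i * (\<Sum>j<d. v p j * w j)) = 0"
        by (intro sum.neutral ballI) (simp add: orth mult.commute[of "v _ _" "w _"])
      then show ?thesis using bv[of i w] w[OF that] by simp
    qed
    have "P (Suc n) (l(n := m)) (v(n := w))"
      using P m w1 aw orth on unfolding P_def
      by (auto simp: less_Suc_eq power2_eq_square mult.commute[of "v _ _" "w _"])
    then show ?thesis by blast
  qed
  have "\<exists>n l v. P n l v \<and> (\<forall>i<d. \<forall>j<d. a i j = (\<Sum>p<n. l p * v p i * v p j))"
  proof (rule ccontr)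
    assume *: "\<not> ?thesis"
    have "\<exists>l v. P n l v" for n
    proof (induction n)
      case 0 then show ?case by (simp add: P_def)
    next
      case (Suc n) then show ?case using step * by blast
    qed
    from this[of "Suc d"] show False using bessel by fastforce
  qed
  then obtain n l v where "P n l v" "\<forall>i<d. \<forall>j<d. a i j = (\<Sum>p<n. l p * v p i * v p j)" by blast
  then show ?thesis unfolding P_def by (intro exI[of _ n] exI[of _ l] exI[of _ v]) simp
qed

lemma AE_Rplus2I:
  assumes "AE x in Rplus. AE y in Rplus. f (x, y) = g (x, y)"
    and f: "f \<in> borel_measurable Rplus2" and g: "g \<in> borel_measurable Rplus2"
  shows "AE z in Rplus2. f z = (g z :: real)"
proof (rule Rplus2.AE_pair_measure)
  show "{z \<in> space Rplus2. f z = g z} \<in> sets Rplus2" using f g by measurable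
qed (use assms in simp)

lemma orthonormal_tensor_inner:
  assumes on: "orthonormal d e" and g: "g \<in> L2 Rplus" and h: "h \<in> L2 Rplus"
  shows "L2_inner Rplus2 (\<lambda>z. \<Sum>j<d. \<Sum>k<d. a j k * tensor (e j) (e k) z) (tensor g h) =
    (\<Sum>j<d. \<Sum>k<d. a j k * (L2_inner Rplus (e j) g * L2_inner Rplus (e k) h))"
proof -
  have e: "e j \<in> L2 Rplus" if "j < d" for j using on that by (simp add: orthonormal_def)
  have t: "tensor (e j) (e k) \<in> L2 Rplus2" if "j < d" "k < d" for j k using e that by (intro tensor_L2)
  have gh: "tensor g h \<in> L2 Rplus2" using g h by (rule tensor_L2)
  have inner: "L2_inner Rplus2 (\<lambda>z. \<Sum>k<d. a j k * tensor (e j) (e k) z) (tensor g h) =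
      (\<Sum>k<d. a j k * (L2_inner Rplus (e j) g * L2_inner Rplus (e k) h))" if "j < d" for j
    using t e g h that by (subst L2_inner_sum_left) (auto simp: gh L2_inner_tensor)
  have "L2_inner Rplus2 (\<lambda>z. \<Sum>j<d. 1 * (\<Sum>k<d. a j k * tensor (e j) (e k) z)) (tensor g h) =
      (\<Sum>j<d. 1 * L2_inner Rplus2 (\<lambda>z. \<Sum>k<d. a j k * tensor (e j) (e k) z) (tensor g h))"
    using t gh by (intro L2_inner_sum_left) (auto intro!: L2_sum L2_scale)
  then show ?thesis using inner by simp
qed

text \<open>The eigenvectors of the coefficient matrix combine the system \<open>e\<close> into a
  system \<open>u\<close> in which the kernel is diagonal.\<close>

lemma spectral_of_symmetric_matrix:
  assumes f: "f \<in> L2_sym" and on: "orthonormal d e" and sym: "\<And>j k. a j k = a k j"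
    and eq: "AE z in Rplus2. f z = (\<Sum>j<d. \<Sum>k<d. a j k * tensor (e j) (e k) z)"
  shows "\<exists>n l u. spectral f n l u \<and> (\<forall>i<n. l i \<noteq> 0)"
proof -
  obtain n :: nat and l v where v: "\<And>p q. p < n \<Longrightarrow> q < n \<Longrightarrow> (\<Sum>i<d. v p i * v q i) = of_bool (p = q)"
    and l: "\<And>p. p < n \<Longrightarrow> l p \<noteq> 0"
    and a: "\<And>i j. i < d \<Longrightarrow> j < d \<Longrightarrow> a i j = (\<Sum>p<n. l p * v p i * v p j)"
    using symmetric_matrix_diagonalization[where a = a and d = d, OF sym] by blast
  define u where "u p x = (\<Sum>i<d. v p i * e i x)" for p x
  have e: "e j \<in> L2 Rplus" if "j < d" for j using on that by (simp add: orthonormal_def)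
  have u: "u p \<in> L2 Rplus" for p unfolding u_def using e by (auto intro!: L2_sum L2_scale)
  have "L2_inner Rplus (u p) (u q) = of_bool (p = q)" if "p < n" "q < n" for p q
  proof -
    have "L2_inner Rplus (u p) (u q) = (\<Sum>i<d. v q i * L2_inner Rplus (u p) (e i))"
      unfolding u_def[of q] by (rule L2_inner_sum_right) (use e u in auto)
    also have "\<dots> = (\<Sum>i<d. v q i * v p i)"
      unfolding u_def[of p] by (intro sum.cong refl arg_cong2[of _ _ _ _ "(*)"] orthonormal_inner_sum[OF on]) simp
    finally show ?thesis using v[OF that] by (simp add: mult.commute)
  qed
  then have "orthonormal n u" using u by (simp add: orthonormal_def)
  moreover have "(\<Sum>j<d. \<Sum>k<d. a j k * tensor (e j) (e k) z) = (\<Sum>p<n. l p * tensor (u p) (u p) z)" for z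
  proof (cases z)
    case (Pair x y)
    have "(\<Sum>j<d. \<Sum>k<d. a j k * (e j x * e k y)) = (\<Sum>j<d. \<Sum>k<d. \<Sum>p<n. l p * (v p j * e j x) * (v p k * e k y))"
      by (intro sum.cong refl) (simp add: a sum_distrib_left sum_distrib_right mult_ac)
    also have "\<dots> = (\<Sum>j<d. \<Sum>p<n. \<Sum>k<d. l p * (v p j * e j x) * (v p k * e k y))"
      by (intro sum.cong refl sum.swap)
    also have "\<dots> = (\<Sum>p<n. \<Sum>j<d. \<Sum>k<d. l p * (v p j * e j x) * (v p k * e k y))" by (rule sum.swap)
    also have "\<dots> = (\<Sum>p<n. l p * (u p x * u p y))"
      unfolding u_def sum_product unfolding sum_distrib_left by (intro sum.cong refl) (simp add: mult.assoc)
    finally show ?thesis using Pair by (simp add: tensor_apply)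
  qed
  ultimately have "spectral f n l u" using f eq by (simp add: spectral_def)
  then show ?thesis using l by blast
qed

text \<open>Gram--Schmidt makes the vectors orthonormal at the price of mixed terms; these have
  symmetric coefficients, which can be diagonalised.\<close>

lemma spectral_of_finite_sum:
  fixes n :: nat
  assumes f: "f \<in> L2_sym" and h: "\<And>i. i < n \<Longrightarrow> h i \<in> L2 Rplus"
    and eq: "AE z in Rplus2. f z = (\<Sum>i<n. c i * tensor (h i) (h i) z)"
  shows "\<exists>d l u. spectral f d l u \<and> (\<forall>i<d. l i \<noteq> 0)"
proof -
  obtain d e b where on: "orthonormal d e"
    and b: "\<And>i. i < n \<Longrightarrow> AE x in Rplus. h i x = (\<Sum>j<d. b i j * e j x)"
    using gram_schmidt[of n h, OF h] by blast
  have e: "e j \<in> L2 Rplus" if "j < d" for j using on that by (simp add: orthonormal_def)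
  define a where "a j k = (\<Sum>i<n. c i * b i j * b i k)" for j k
  have allb: "AE x in Rplus. \<forall>i<n. h i x = (\<Sum>j<d. b i j * e j x)"
    using b by (simp add: AE_all_countable)
  have hm: "tensor (h i) (h i) \<in> borel_measurable Rplus2" if "i < n" for i
    using h[OF that] by (intro tensor_measurable L2_measurable)
  have em: "tensor (e j) (e k) \<in> borel_measurable Rplus2" if "j < d" "k < d" for j k
    using e that by (intro tensor_measurable L2_measurable)
  have "AE z in Rplus2. (\<Sum>i<n. c i * tensor (h i) (h i) z) = (\<Sum>j<d. \<Sum>k<d. a j k * tensor (e j) (e k) z)"
  proof (rule AE_Rplus2I)
    show "AE x in Rplus. AE y in Rplus. (\<Sum>i<n. c i * tensor (h i) (h i) (x, y)) =
        (\<Sum>j<d. \<Sum>k<d. a j k * tensor (e j) (e k) (x, y))"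
      using allb
    proof eventually_elim
      case (elim x)
      show ?case using allb
      proof eventually_elim
        case (elim y)
        have "(\<Sum>i<n. c i * tensor (h i) (h i) (x, y)) =
            (\<Sum>i<n. c i * ((\<Sum>j<d. b i j * e j x) * (\<Sum>k<d. b i k * e k y)))"
          by (intro sum.cong refl)
            (use \<open>\<forall>i<n. h i x = (\<Sum>j<d. b i j * e j x)\<close> elim in \<open>simp add: tensor_apply\<close>)
        also have "\<dots> = (\<Sum>i<n. \<Sum>j<d. \<Sum>k<d. c i * b i j * b i k * (e j x * e k y))"
          unfolding sum_product unfolding sum_distrib_left by (intro sum.cong refl) (simp add: mult_ac)
        also have "\<dots> = (\<Sum>j<d. \<Sum>i<n. \<Sum>k<d. c i * b i j * b i k * (e j x * e k y))" by (rule sum.swap)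
        also have "\<dots> = (\<Sum>j<d. \<Sum>k<d. \<Sum>i<n. c i * b i j * b i k * (e j x * e k y))"
          by (intro sum.cong refl sum.swap)
        also have "\<dots> = (\<Sum>j<d. \<Sum>k<d. a j k * tensor (e j) (e k) (x, y))"
          by (simp add: a_def sum_distrib_right tensor_apply)
        finally show ?case .
      qed
    qed
  qed (use hm em in \<open>auto intro!: borel_measurable_sum borel_measurable_times\<close>)
  with eq have "AE z in Rplus2. f z = (\<Sum>j<d. \<Sum>k<d. a j k * tensor (e j) (e k) z)"
    by eventually_elim simp
  moreover have "a j k = a k j" for j k by (simp add: a_def mult_ac)
  ultimately show ?thesis using spectral_of_symmetric_matrix[OF f on] by blast
qed

text \<open>Combinations of tensor squares are dense among symmetric kernels, and each is
  diagonalised by linear algebra in finitely many vectors.\<close>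

lemma spectral_approximation:
  assumes f: "f \<in> L2_sym" and "e > 0"
  shows "\<exists>g d l u. spectral g d l u \<and> L2_norm Rplus2 (\<lambda>z. g z - f z) < e"
proof -
  obtain xs where xs: "snd ` set xs \<subseteq> L2 Rplus"
    "L2_norm Rplus2 (\<lambda>z. lincomb (\<lambda>h. tensor h h) xs z - f z) < e"
    using dense_span_tensor_sym f \<open>e > 0\<close> unfolding dense_span_def by blast
  let ?g = "lincomb (\<lambda>h. tensor h h) xs"
  have gS: "?g \<in> L2_sym" using xs(1)
  proof (induction xs)
    case Nil
    show ?case using L2_sym_lincomb[OF f f, of 0 0] by simp
  next
    case (Cons y ys)
    obtain c t where y: "y = (c, t)" by (cases y)
    show ?case unfolding y lincomb_Cons by (rule L2_sym_lincomb[OF tensor_sym]) (use Cons y in auto)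
  qed
  have g_eq: "?g z = (\<Sum>i<length xs. fst (xs ! i) * tensor (snd (xs ! i)) (snd (xs ! i)) z)" for z
    unfolding lincomb_def by (simp add: sum_list_sum_nth split_def atLeast0LessThan)
  have "snd (xs ! i) \<in> L2 Rplus" if "i < length xs" for i using xs(1) that by auto
  moreover have "AE z in Rplus2. ?g z = (\<Sum>i<length xs. fst (xs ! i) * tensor (snd (xs ! i)) (snd (xs ! i)) z)"
    by (rule AE_I2) (rule g_eq)
  ultimately have "\<exists>d l u. spectral ?g d l u \<and> (\<forall>i<d. l i \<noteq> 0)"
    by (rule spectral_of_finite_sum[OF gS])
  then show ?thesis using xs(2) by blast
qed

section \<open>Integral operators of finite rank\<close>

lemma HS_op_L2:
  assumes f: "f \<in> L2 Rplus2" and g: "g \<in> L2 Rplus"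
  shows "HS_op f g \<in> L2 Rplus"
proof (rule L2I)
  have fm [measurable]: "f \<in> borel_measurable Rplus2" using f by (rule L2_measurable)
  have gm [measurable]: "g \<in> borel_measurable Rplus" using g by (rule L2_measurable)
  show m [measurable]: "HS_op f g \<in> borel_measurable Rplus"
    unfolding HS_op_def[abs_def] by measurable
  have int: "integrable Rplus (\<lambda>x. (\<integral>y. (f (x, y))\<^sup>2 \<partial>Rplus) * (L2_norm Rplus g)\<^sup>2)"
    by (intro integrable_mult_left Rplus2.integrable_fst' L2_integrable_square[OF f])
  show "integrable Rplus (\<lambda>x. (HS_op f g x)\<^sup>2)"
  proof (rule Bochner_Integration.integrable_bound[OF int])
    show "AE x in Rplus. norm ((HS_op f g x)\<^sup>2) \<le> norm ((\<integral>y. (f (x, y))\<^sup>2 \<partial>Rplus) * (L2_norm Rplus g)\<^sup>2)"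
      using Rplus2.AE_integrable_fst'[OF L2_integrable_square[OF f]] AE_space
    proof eventually_elim
      case (elim x)
      have "(\<lambda>y. f (x, y)) \<in> L2 Rplus" using elim by (intro L2I) auto
      from L2_Cauchy_Schwarz[OF this g]
      have "\<bar>HS_op f g x\<bar>\<^sup>2 \<le> (L2_norm Rplus (\<lambda>y. f (x, y)) * L2_norm Rplus g)\<^sup>2"
        by (intro power_mono) (auto simp: HS_op_def L2_inner_def)
      then show ?case by (simp add: power_mult_distrib L2_norm_def)
    qed
  qed measurable
qed

lemma L2_inner_HS_op:
  assumes f: "f \<in> L2 Rplus2" and g: "g \<in> L2 Rplus" and h: "h \<in> L2 Rplus"
  shows "L2_inner Rplus h (HS_op f g) = L2_inner Rplus2 f (tensor h g)"
proof -
  have "L2_inner Rplus2 f (tensor h g) = (\<integral>x. (\<integral>y. f (x, y) * tensor h g (x, y) \<partial>Rplus) \<partial>Rplus)"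
    unfolding L2_inner_def by (rule Rplus2.integral_fst'[symmetric]) (rule L2_integrable_mult[OF f tensor_L2[OF h g]])
  also have "\<dots> = (\<integral>x. h x * HS_op f g x \<partial>Rplus)"
  proof (rule Bochner_Integration.integral_cong[OF refl])
    fix x
    have "(\<integral>y. f (x, y) * tensor h g (x, y) \<partial>Rplus) = (\<integral>y. h x * (f (x, y) * g y) \<partial>Rplus)"
      by (simp add: tensor_apply mult_ac)
    then show "(\<integral>y. f (x, y) * tensor h g (x, y) \<partial>Rplus) = h x * HS_op f g x"
      by (simp add: HS_op_def)
  qed
  finally show ?thesis by (simp add: L2_inner_def)
qed

lemma L2_inner_tensor_sym:
  assumes f: "f \<in> L2_sym" and g: "g \<in> L2 Rplus" and h: "h \<in> L2 Rplus"
  shows "L2_inner Rplus2 f (tensor g h) = L2_inner Rplus2 f (tensor h g)"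
proof -
  have fm [measurable]: "f \<in> borel_measurable Rplus2" using f L2_sym_subset L2_measurable by blast
  have gm [measurable]: "g \<in> borel_measurable Rplus" using g by (rule L2_measurable)
  have hm [measurable]: "h \<in> borel_measurable Rplus" using h by (rule L2_measurable)
  have "L2_inner Rplus2 f (tensor g h) = (\<integral>(x, y). (\<lambda>z. f z * tensor g h z) (y, x) \<partial>Rplus2)"
    unfolding L2_inner_def by (rule Rplus2.integral_product_swap[symmetric]) measurable
  also have "\<dots> = (\<integral>z. f z * tensor h g z \<partial>Rplus2)"
  proof (rule integral_cong_AE)
    have "AE z in Rplus2. case z of (x, y) \<Rightarrow> f (x, y) = f (y, x)" using f by (simp add: L2_sym_def)
    then show "AE z in Rplus2. (case z of (x, y) \<Rightarrow> f (y, x) * tensor g h (y, x)) = f z * tensor h g z"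
      by eventually_elim (auto simp: tensor_apply split: prod.splits)
  qed measurable
  finally show ?thesis by (simp add: L2_inner_def)
qed

lemma L2_eqI_inner:
  assumes "g \<in> L2 M" "h \<in> L2 M" "\<And>w. w \<in> L2 M \<Longrightarrow> L2_inner M w g = L2_inner M w h"
  shows "AE x in M. g x = h x"
proof -
  have d: "(\<lambda>x. 1 * g x + (- 1) * h x) \<in> L2 M" using assms by (intro L2_lincomb)
  have "L2_inner M (\<lambda>x. 1 * g x + (- 1) * h x) (\<lambda>x. 1 * g x + (- 1) * h x) = 0"
    using assms d by (subst L2_inner_lincomb_right) auto
  then have "L2_norm M (\<lambda>x. 1 * g x + (- 1) * h x) = 0" by (simp add: L2_norm_eq_sqrt_inner)
  then have "AE x in M. 1 * g x + (- 1) * h x = 0" using L2_norm_eq_0_iff[OF d] by blast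
  then show ?thesis by auto
qed

text \<open>The difference of the two kernels is orthogonal to all tensors, whose span is
  dense.\<close>

lemma L2_Rplus2_eqI_tensor:
  assumes f: "f \<in> L2 Rplus2" and g: "g \<in> L2 Rplus2"
    and eq: "\<And>h k. h \<in> L2 Rplus \<Longrightarrow> k \<in> L2 Rplus \<Longrightarrow> L2_inner Rplus2 f (tensor h k) = L2_inner Rplus2 g (tensor h k)"
  shows "AE z in Rplus2. f z = g z"
proof -
  let ?T = "L2 Rplus \<times> L2 Rplus" and ?\<phi> = "\<lambda>(h, k). tensor h k :: real \<times> real \<Rightarrow> real"
  define D where "D z = 1 * f z + (- 1) * g z" for z
  have D: "D \<in> L2 Rplus2" unfolding D_def using f g by (rule L2_lincomb)
  have ten: "?\<phi> t \<in> L2 Rplus2" if "t \<in> ?T" for t using that by (auto intro: tensor_L2)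
  have DT: "L2_inner Rplus2 (?\<phi> t) D = 0" if "t \<in> ?T" for t
    using that f g ten[OF that] eq unfolding D_def by (subst L2_inner_lincomb_right) (auto simp: L2_inner_commute)
  have orth: "L2_inner Rplus2 (lincomb ?\<phi> xs) D = 0" if "snd ` set xs \<subseteq> ?T" for xs using that
  proof (induction xs)
    case Nil then show ?case by (simp add: L2_inner_def)
  next
    case (Cons y ys)
    obtain c t where y: "y = (c, t)" by (cases y)
    with Cons.prems have t: "t \<in> ?T" and ys: "snd ` set ys \<subseteq> ?T" by auto
    have "lincomb ?\<phi> ys \<in> L2 Rplus2" by (rule lincomb_L2[OF ys]) (rule ten)
    then have "L2_inner Rplus2 (lincomb ?\<phi> ((c, t) # ys)) D =
        c * L2_inner Rplus2 (?\<phi> t) D + 1 * L2_inner Rplus2 (lincomb ?\<phi> ys) D"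
      unfolding lincomb_Cons using D ten[OF t] by (intro L2_inner_lincomb_left)
    then show ?case using DT[OF t] Cons.IH[OF ys] y by simp
  qed
  have "L2_norm Rplus2 D \<le> e" if e: "e > 0" for e
  proof -
    obtain xs where xs: "snd ` set xs \<subseteq> ?T" "L2_norm Rplus2 (\<lambda>z. lincomb ?\<phi> xs z - D z) < e"
      using dense_span_tensor D e unfolding dense_span_def by blast
    have l: "lincomb ?\<phi> xs \<in> L2 Rplus2" by (rule lincomb_L2[OF xs(1)]) (rule ten)
    have "L2_inner Rplus2 (\<lambda>z. 1 * lincomb ?\<phi> xs z + (- 1) * D z) D = - (L2_norm Rplus2 D)\<^sup>2"
      using l D by (subst L2_inner_lincomb_left) (auto simp: orth[OF xs(1)] L2_norm_sq)
    then have "L2_inner Rplus2 (\<lambda>z. lincomb ?\<phi> xs z - D z) D = - (L2_norm Rplus2 D)\<^sup>2" by simp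
    then have "(L2_norm Rplus2 D)\<^sup>2 \<le> L2_norm Rplus2 (\<lambda>z. lincomb ?\<phi> xs z - D z) * L2_norm Rplus2 D"
      using L2_Cauchy_Schwarz[OF L2_diff[OF l D] D] by simp
    also have "\<dots> \<le> e * L2_norm Rplus2 D" using xs(2) by (intro mult_right_mono) auto
    finally have le: "L2_norm Rplus2 D * L2_norm Rplus2 D \<le> e * L2_norm Rplus2 D" by (simp add: power2_eq_square)
    show ?thesis
    proof (cases "L2_norm Rplus2 D = 0")
      case True
      then show ?thesis using e by simp
    next
      case False
      then have "0 < L2_norm Rplus2 D" using L2_norm_nonneg[of Rplus2 D] by linarith
      with le show ?thesis by (rule mult_right_le_imp_le)
    qed
  qed
  then have "L2_norm Rplus2 D \<le> 0" by (rule field_le_epsilon) simp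
  then have "L2_norm Rplus2 D = 0" using L2_norm_nonneg[of Rplus2 D] by linarith
  then have "AE z in Rplus2. D z = 0" using L2_norm_eq_0_iff[OF D] by blast
  then show ?thesis unfolding D_def by auto
qed

lemma HS_op_spectral:
  assumes s: "spectral f d l u" and g: "g \<in> L2 Rplus"
  shows "AE x in Rplus. HS_op f g x = (\<Sum>i<d. (l i * L2_inner Rplus (u i) g) * u i x)"
proof (rule L2_eqI_inner)
  have fL: "f \<in> L2 Rplus2" using s L2_sym_subset by (auto simp: spectral_def)
  have u: "u i \<in> L2 Rplus" if "i < d" for i using s that by (simp add: spectral_def orthonormal_def)
  have ten: "tensor (u i) (u i) \<in> L2 Rplus2" if "i < d" for i using u that by (intro tensor_L2)
  show "HS_op f g \<in> L2 Rplus" by (rule HS_op_L2[OF fL g])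
  show sumL: "(\<lambda>x. \<Sum>i<d. (l i * L2_inner Rplus (u i) g) * u i x) \<in> L2 Rplus"
    using u by (auto intro!: L2_sum L2_scale)
  fix w assume w: "w \<in> L2 Rplus"
  let ?f = "\<lambda>z. \<Sum>i<d. l i * tensor (u i) (u i) z"
  have f'L: "?f \<in> L2 Rplus2" using ten by (auto intro!: L2_sum L2_scale)
  have wg: "tensor w g \<in> L2 Rplus2" using w g by (rule tensor_L2)
  have "L2_inner Rplus w (HS_op f g) = L2_inner Rplus2 ?f (tensor w g)"
    unfolding L2_inner_HS_op[OF fL g w] using s fL f'L wg
    by (intro L2_inner_cong_AE) (auto simp: spectral_def intro: L2_measurable)
  also have "\<dots> = (\<Sum>i<d. l i * L2_inner Rplus2 (tensor (u i) (u i)) (tensor w g))"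
    using ten wg by (intro L2_inner_sum_left) auto
  also have "\<dots> = (\<Sum>i<d. (l i * L2_inner Rplus (u i) g) * L2_inner Rplus w (u i))"
    using u w g by (intro sum.cong refl) (simp add: L2_inner_tensor L2_inner_commute[of _ w])
  also have "\<dots> = L2_inner Rplus w (\<lambda>x. \<Sum>i<d. (l i * L2_inner Rplus (u i) g) * u i x)"
    using u w by (intro L2_inner_sum_right[symmetric]) auto
  finally show "L2_inner Rplus w (HS_op f g) = L2_inner Rplus w (\<lambda>x. \<Sum>i<d. (l i * L2_inner Rplus (u i) g) * u i x)" .
qed

text \<open>An eigenfunction for a nonzero value outside the list would be orthogonal to every
  \<open>u i\<close> and hence annihilated by the operator.\<close>

lemma nonzero_eigenvalues_spectral:
  assumes s: "spectral f d l u" and l: "\<And>i. i < d \<Longrightarrow> l i \<noteq> 0"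
  shows "nonzero_eigenvalues f = l ` {..<d}"
proof -
  have on: "orthonormal d u" and fL: "f \<in> L2 Rplus2"
    using s L2_sym_subset by (auto simp: spectral_def)
  have u: "u i \<in> L2 Rplus" and uu: "L2_inner Rplus (u i) (u i) = 1" if "i < d" for i
    using on that by (simp_all add: orthonormal_def)
  have um: "u i \<in> borel_measurable Rplus" if "i < d" for i using u[OF that] by (rule L2_measurable)
  show ?thesis
  proof (intro equalityI subsetI)
    fix m assume "m \<in> l ` {..<d}"
    then obtain i where i: "i < d" "m = l i" by auto
    have "AE x in Rplus. HS_op f (u i) x = m * u i x"
      using HS_op_spectral[OF s u[OF i(1)]]
    proof eventually_elim
      case (elim x)
      have "(\<Sum>j<d. (l j * L2_inner Rplus (u j) (u i)) * u j x) = (\<Sum>j<d. if j = i then l j * u j x else 0)"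
        using on i by (intro sum.cong) (auto simp: orthonormal_def)
      then show ?case using elim i by simp
    qed
    moreover have "\<not> (AE x in Rplus. u i x = 0)"
      using uu[OF i(1)] L2_norm_eq_0_iff[OF u[OF i(1)]] by (auto simp: L2_norm_eq_sqrt_inner)
    moreover have "m \<noteq> 0" using l i by simp
    ultimately show "m \<in> nonzero_eigenvalues f"
      unfolding nonzero_eigenvalues_def by (intro CollectI conjI bexI[of _ "u i"] u i(1))
  next
    fix m assume "m \<in> nonzero_eigenvalues f"
    then obtain g where m: "m \<noteq> 0" and g: "g \<in> L2 Rplus" "\<not> (AE x in Rplus. g x = 0)"
      "AE x in Rplus. HS_op f g x = m * g x" unfolding nonzero_eigenvalues_def by blast
    show "m \<in> l ` {..<d}"
    proof (rule ccontr)
      assume nm: "m \<notin> l ` {..<d}"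
      let ?c = "\<lambda>i. l i * L2_inner Rplus (u i) g"
      have sumL: "(\<lambda>x. \<Sum>i<d. ?c i * u i x) \<in> L2 Rplus" using u by (auto intro!: L2_sum L2_scale)
      have ae: "AE x in Rplus. m * g x = (\<Sum>i<d. ?c i * u i x)"
        using HS_op_spectral[OF s g(1)] g(3) by eventually_elim simp
      have "L2_inner Rplus (u i) g = 0" if i: "i < d" for i
      proof -
        have "L2_inner Rplus (\<lambda>x. m * g x) (u i) = L2_inner Rplus (\<lambda>x. \<Sum>i<d. ?c i * u i x) (u i)"
          using ae L2_scale[OF g(1), of m] sumL um[OF i] by (intro L2_inner_cong_AE) (auto intro: L2_measurable)
        moreover have "L2_inner Rplus (\<lambda>x. m * g x) (u i) = m * L2_inner Rplus g (u i)"
          using L2_inner_lincomb_left[OF g(1) g(1) u[OF i], of m 0] by simp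
        ultimately have "m * L2_inner Rplus (u i) g = l i * L2_inner Rplus (u i) g"
          using orthonormal_inner_sum[OF on i, of ?c] by (simp add: L2_inner_commute)
        then show ?thesis using nm i by auto
      qed
      then have "AE x in Rplus. m * g x = 0" using ae by simp
      then show False using g(2) m by simp
    qed
  qed
qed

text \<open>A maximal family with independent images spans the range, which gives a finite expansion
  in the first variable; symmetry of the kernel gives one in the second. Together they express the
  kernel as a matrix in an orthonormal system whose span contains the range.\<close>

theorem finite_rank_spectral:
  assumes f: "f \<in> L2_sym" and rank: "kernel_rank f < \<infinity>"
  shows "\<exists>d l u. spectral f d l u \<and> (\<forall>i<d. l i \<noteq> 0)"
proof -
  have fL: "f \<in> L2 Rplus2" using f L2_sym_subset by auto
  define Rk where "Rk = {enat n | n. \<exists>g. (\<forall>i<n. g i \<in> L2 Rplus) \<and> lin_indep_AE Rplus n (\<lambda>i. HS_op f (g i))}"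
  define K where "K = {n. \<exists>g. (\<forall>i<n. g i \<in> L2 Rplus) \<and> lin_indep_AE Rplus n (\<lambda>i. HS_op f (g i))}"
  have "Sup Rk < \<infinity>" using rank by (simp add: kernel_rank_def Rk_def)
  then obtain b where b: "Sup Rk = enat b" by (metis less_infinityE)
  have K_le: "n \<le> b" if "n \<in> K" for n
  proof -
    have "enat n \<in> Rk" using that by (auto simp: Rk_def K_def)
    then have "enat n \<le> enat b" unfolding b[symmetric] by (rule Sup_upper)
    then show ?thesis by simp
  qed
  have K0: "0 \<in> K" by (auto simp: K_def lin_indep_AE_def)
  define n where "n = Max K"
  have finK: "finite K" using K_le by (meson finite_nat_set_iff_bounded_le)
  have nK: "n \<in> K" and nmax: "\<And>m. m \<in> K \<Longrightarrow> m \<le> n"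
    using finK K0 by (auto simp: n_def intro: Max_in)
  obtain g where g: "\<And>i. i < n \<Longrightarrow> g i \<in> L2 Rplus" and ind: "lin_indep_AE Rplus n (\<lambda>i. HS_op f (g i))"
    using nK by (auto simp: K_def)
  \<comment> \<open>By maximality the family extended by \<open>w\<close> has dependent images, and
    the coefficient of \<open>w\<close> cannot vanish since the old images are independent.\<close>
  have range: "\<exists>c. AE x in Rplus. HS_op f w x = (\<Sum>i<n. c i * HS_op f (g i) x)" if w: "w \<in> L2 Rplus" for w
  proof -
    have "Suc n \<notin> K" using nmax[of "Suc n"] by auto
    moreover have "\<forall>i<Suc n. (g(n := w)) i \<in> L2 Rplus" using g w by (simp add: less_Suc_eq)
    ultimately have "\<not> lin_indep_AE Rplus (Suc n) (\<lambda>i. HS_op f ((g(n := w)) i))"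
      unfolding K_def by blast
    then obtain c where c: "AE x in Rplus. (\<Sum>i<Suc n. c i * HS_op f ((g(n := w)) i) x) = 0"
      and nz: "\<exists>i<Suc n. c i \<noteq> 0" unfolding lin_indep_AE_def by blast
    have c': "AE x in Rplus. (\<Sum>i<n. c i * HS_op f (g i) x) + c n * HS_op f w x = 0" using c by simp
    have "c n \<noteq> 0"
    proof
      assume c0: "c n = 0"
      then have "AE x in Rplus. (\<Sum>i<n. c i * HS_op f (g i) x) = 0" using c' by simp
      then have "\<forall>i<n. c i = 0" using ind unfolding lin_indep_AE_def by blast
      then show False using nz c0 by (auto simp: less_Suc_eq)
    qed
    have "AE x in Rplus. HS_op f w x = (\<Sum>i<n. (- c i / c n) * HS_op f (g i) x)"
      using c'
    proof eventually_elim
      case (elim x)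
      have "(\<Sum>i<n. (- c i / c n) * HS_op f (g i) x) = - (\<Sum>i<n. c i * HS_op f (g i) x) / c n"
        by (simp add: sum_negf sum_divide_distrib)
      also have "\<dots> = HS_op f w x" using elim \<open>c n \<noteq> 0\<close> by (simp add: field_simps eq_neg_iff_add_eq_0)
      finally show ?case ..
    qed
    then show ?thesis by (intro exI[of _ "\<lambda>i. - c i / c n"])
  qed
  obtain d e b where on: "orthonormal d e"
    and b: "\<And>i. i < n \<Longrightarrow> AE x in Rplus. HS_op f (g i) x = (\<Sum>j<d. b i j * e j x)"
    using gram_schmidt[of n "\<lambda>i. HS_op f (g i)"] HS_op_L2[OF fL] g by blast
  have e: "e j \<in> L2 Rplus" if "j < d" for j using on that by (simp add: orthonormal_def)
  have em: "e j \<in> borel_measurable Rplus" if "j < d" for j using e[OF that] by (rule L2_measurable)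
  have T: "AE x in Rplus. HS_op f w x = (\<Sum>j<d. L2_inner Rplus (e j) (HS_op f w) * e j x)"
    if w: "w \<in> L2 Rplus" for w
  proof -
    obtain c where c: "AE x in Rplus. HS_op f w x = (\<Sum>i<n. c i * HS_op f (g i) x)" using range[OF w] by blast
    define k where "k j = (\<Sum>i<n. c i * b i j)" for j
    have "AE x in Rplus. \<forall>i<n. HS_op f (g i) x = (\<Sum>j<d. b i j * e j x)"
      using b by (simp add: AE_all_countable)
    with c have ae: "AE x in Rplus. HS_op f w x = (\<Sum>j<d. k j * e j x)"
    proof eventually_elim
      case (elim x)
      have "HS_op f w x = (\<Sum>i<n. \<Sum>j<d. c i * b i j * e j x)"
        using elim by (simp add: sum_distrib_left mult.assoc)
      also have "\<dots> = (\<Sum>j<d. \<Sum>i<n. c i * b i j * e j x)" by (rule sum.swap)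
      finally show ?case by (simp add: k_def sum_distrib_right)
    qed
    have kL: "(\<lambda>x. \<Sum>j<d. k j * e j x) \<in> L2 Rplus" using e by (auto intro!: L2_sum L2_scale)
    have "L2_inner Rplus (e j) (HS_op f w) = k j" if j: "j < d" for j
    proof -
      have "L2_inner Rplus (HS_op f w) (e j) = L2_inner Rplus (\<lambda>x. \<Sum>j<d. k j * e j x) (e j)"
        using ae HS_op_L2[OF fL w] kL em[OF j] by (intro L2_inner_cong_AE) (auto intro: L2_measurable)
      then show ?thesis using orthonormal_inner_sum[OF on j] by (simp add: L2_inner_commute)
    qed
    then show ?thesis using ae by simp
  qed
  \<comment> \<open>The zero function replaces \<open>e j\<close> for \<open>j \<ge> d\<close>, so
    that \<open>a\<close> is symmetric for all indices, as
    \<open>spectral_of_symmetric_matrix\<close> requires.\<close>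
  define a where "a j k = L2_inner Rplus2 f (tensor (if j < d then e j else (\<lambda>_. 0)) (if k < d then e k else (\<lambda>_. 0)))" for j k
  have asym: "a j k = a k j" for j k
    unfolding a_def using e by (intro L2_inner_tensor_sym[OF f]) auto
  have ten: "tensor (e j) (e k) \<in> L2 Rplus2" if "j < d" "k < d" for j k using e that by (intro tensor_L2)
  have inner_T: "L2_inner Rplus h (HS_op f w) =
      (\<Sum>j<d. L2_inner Rplus2 f (tensor (e j) w) * L2_inner Rplus (e j) h)"
    if h: "h \<in> L2 Rplus" and w: "w \<in> L2 Rplus" for h w
  proof -
    have sumL: "(\<lambda>x. \<Sum>j<d. L2_inner Rplus (e j) (HS_op f w) * e j x) \<in> L2 Rplus"
      using e by (auto intro!: L2_sum L2_scale)
    have "L2_inner Rplus h (HS_op f w) = L2_inner Rplus h (\<lambda>x. \<Sum>j<d. L2_inner Rplus (e j) (HS_op f w) * e j x)"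
      using T[OF w] HS_op_L2[OF fL w] sumL h by (intro L2_inner_cong_AE) (auto intro: L2_measurable)
    also have "\<dots> = (\<Sum>j<d. L2_inner Rplus (e j) (HS_op f w) * L2_inner Rplus h (e j))"
      using e h by (intro L2_inner_sum_right) auto
    also have "\<dots> = (\<Sum>j<d. L2_inner Rplus2 f (tensor (e j) w) * L2_inner Rplus (e j) h)"
      using e w by (intro sum.cong refl) (simp add: L2_inner_HS_op[OF fL] L2_inner_commute[of _ h])
    finally show ?thesis .
  qed
  have "AE z in Rplus2. f z = (\<Sum>j<d. \<Sum>k<d. a j k * tensor (e j) (e k) z)"
  proof (rule L2_Rplus2_eqI_tensor[OF fL])
    show "(\<lambda>z. \<Sum>j<d. \<Sum>k<d. a j k * tensor (e j) (e k) z) \<in> L2 Rplus2"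
      using ten by (auto intro!: L2_sum L2_scale)
    fix h w assume h: "h \<in> L2 Rplus" and w: "w \<in> L2 Rplus"
    have "L2_inner Rplus2 f (tensor h w) = (\<Sum>j<d. L2_inner Rplus2 f (tensor (e j) w) * L2_inner Rplus (e j) h)"
      unfolding L2_inner_HS_op[OF fL w h, symmetric] by (rule inner_T[OF h w])
    also have "\<dots> = (\<Sum>j<d. \<Sum>k<d. a j k * (L2_inner Rplus (e j) h * L2_inner Rplus (e k) w))"
    proof (rule sum.cong[OF refl])
      fix j assume "j \<in> {..<d}"
      then have j: "j < d" by simp
      \<comment> \<open>Symmetry of \<open>f\<close> puts \<open>e j\<close> under the operator, so
        that the expansion of the range also applies to the second variable.\<close>
      have "L2_inner Rplus2 f (tensor (e j) w) = L2_inner Rplus w (HS_op f (e j))"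
        unfolding L2_inner_HS_op[OF fL e[OF j] w] by (rule L2_inner_tensor_sym[OF f e[OF j] w])
      also have "\<dots> = (\<Sum>k<d. a j k * L2_inner Rplus (e k) w)"
        unfolding inner_T[OF w e[OF j]] asym[of j] using j by (intro sum.cong refl) (simp add: a_def)
      finally have eq: "L2_inner Rplus2 f (tensor (e j) w) = (\<Sum>k<d. a j k * L2_inner Rplus (e k) w)" .
      show "L2_inner Rplus2 f (tensor (e j) w) * L2_inner Rplus (e j) h =
          (\<Sum>k<d. a j k * (L2_inner Rplus (e j) h * L2_inner Rplus (e k) w))"
        unfolding eq sum_distrib_right by (intro sum.cong refl) (simp add: mult_ac)
    qed
    also have "\<dots> = L2_inner Rplus2 (\<lambda>z. \<Sum>j<d. \<Sum>k<d. a j k * tensor (e j) (e k) z) (tensor h w)"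
      by (rule orthonormal_tensor_inner[OF on h w, symmetric])
    finally show "L2_inner Rplus2 f (tensor h w) = L2_inner Rplus2 (\<lambda>z. \<Sum>j<d. \<Sum>k<d. a j k * tensor (e j) (e k) z) (tensor h w)" .
  qed
  then show ?thesis by (rule spectral_of_symmetric_matrix[OF f on asym])
qed

section \<open>Cumulants and power sums\<close>

text \<open>Taylor coefficients of \<open>log_chi\<close> at 0; the centring of the square cancels
  the linear term of the logarithm.\<close>

definition chi_coeff :: "nat \<Rightarrow> complex" where
  "chi_coeff k = (if k < 2 then 0 else (2 * \<i>) ^ k / (2 * of_nat k))"

lemma norm_chi_coeff_le: "cmod (chi_coeff k) \<le> 2 ^ k"
proof (cases "k < 2")
  case False
  then have "cmod (chi_coeff k) = 2 ^ k / (2 * real k)"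
    by (simp add: chi_coeff_def norm_divide norm_mult norm_power)
  also have "\<dots> \<le> 2 ^ k / 1" using False by (intro divide_left_mono) auto
  finally show ?thesis by simp
qed (simp add: chi_coeff_def)

lemma log_chi_sums:
  assumes "\<bar>x\<bar> < 1 / 2"
  shows "(\<lambda>k. chi_coeff k * of_real x ^ k) sums log_chi x"
proof -
  let ?w = "2 * \<i> * of_real x"
  have "cmod (- ?w) < 1" using assms by (simp add: norm_mult)
  from Ln_series'[OF this] have "(\<lambda>n. - (?w ^ n) / of_nat n) sums Ln (1 - ?w)" by simp
  then have 1: "(\<lambda>n. (- 1 / 2) * (- (?w ^ n) / of_nat n)) sums ((- 1 / 2) * Ln (1 - ?w))"
    by (rule sums_mult)
  have 2: "(\<lambda>n. if n = 1 then - (\<i> * of_real x) else 0) sums (- (\<i> * of_real x))"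
    using sums_single[of 1 "\<lambda>_. - (\<i> * of_real x)"] by simp
  have eq: "(- 1 / 2) * (- (?w ^ n) / of_nat n) + (if n = 1 then - (\<i> * of_real x) else 0) = chi_coeff n * of_real x ^ n" for n
  proof -
    consider "n = 0" | "n = 1" | "n \<ge> 2" by linarith
    then show ?thesis
      by cases (auto simp: chi_coeff_def power_mult_distrib)
  qed
  have "(- 1 / 2) * Ln (1 - ?w) + - (\<i> * of_real x) = log_chi x" by (simp add: log_chi_def)
  with sums_add[OF 1 2] show ?thesis unfolding eq by simp
qed

lemma log_cf_sums:
  assumes "\<And>i. i < d \<Longrightarrow> \<bar>t * l i\<bar> < 1 / 2"
  shows "(\<lambda>k. (chi_coeff k * of_real (psum d l k)) * of_real t ^ k) sums log_cf d l t"
proof -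
  have "(\<lambda>k. \<Sum>i<d. chi_coeff k * of_real (t * l i) ^ k) sums (\<Sum>i<d. log_chi (t * l i))"
    by (intro sums_sum log_chi_sums assms) simp
  moreover have "(\<Sum>i<d. chi_coeff k * of_real (t * l i) ^ k) = (chi_coeff k * of_real (psum d l k)) * of_real t ^ k" for k
    by (simp add: psum_def power_mult_distrib sum_distrib_left sum_distrib_right mult_ac)
  ultimately show ?thesis by (simp add: log_cf_def)
qed

text \<open>The second power sum bounds every entry, and
  \<open>\<bar>x\<bar> ^ r \<le> B ^ (r - 2) * x\<^sup>2\<close> for
  \<open>\<bar>x\<bar> \<le> B\<close> reduces higher orders to order 2.\<close>

lemma psum_bounds:
  assumes "psum d l 2 \<le> B\<^sup>2" "0 \<le> B"
  shows "i < d \<Longrightarrow> \<bar>l i\<bar> \<le> B" "2 \<le> r \<Longrightarrow> \<bar>psum d l r\<bar> \<le> B ^ r"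
proof -
  have le: "\<bar>l i\<bar> \<le> B" if "i < d" for i
  proof -
    have "(l i)\<^sup>2 \<le> psum d l 2" unfolding psum_def using that by (intro member_le_sum) auto
    then have "\<bar>l i\<bar>\<^sup>2 \<le> B\<^sup>2" using assms by simp
    then show ?thesis using assms(2) by (rule power2_le_imp_le)
  qed
  show "i < d \<Longrightarrow> \<bar>l i\<bar> \<le> B" by (rule le)
  assume r: "2 \<le> r"
  have "\<bar>psum d l r\<bar> \<le> (\<Sum>i<d. \<bar>l i\<bar> ^ r)" unfolding psum_def by (rule order_trans[OF sum_abs]) (simp add: power_abs)
  also have "\<dots> \<le> (\<Sum>i<d. B ^ (r - 2) * (l i)\<^sup>2)"
  proof (rule sum_mono)
    fix i assume "i \<in> {..<d}"
    have "r - 2 + 2 = r" using r by simp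
    then have "\<bar>l i\<bar> ^ r = \<bar>l i\<bar> ^ ((r - 2) + 2)" by (simp only:)
    also have "\<dots> = \<bar>l i\<bar> ^ (r - 2) * \<bar>l i\<bar>\<^sup>2" by (rule power_add)
    also have "\<dots> \<le> B ^ (r - 2) * \<bar>l i\<bar>\<^sup>2"
      using le \<open>i \<in> {..<d}\<close> by (intro mult_right_mono power_mono) auto
    finally show "\<bar>l i\<bar> ^ r \<le> B ^ (r - 2) * (l i)\<^sup>2" by simp
  qed
  also have "\<dots> = B ^ (r - 2) * psum d l 2" by (simp add: psum_def sum_distrib_left)
  also have "\<dots> \<le> B ^ (r - 2) * B\<^sup>2" using assms by (intro mult_left_mono) auto
  also have "\<dots> = B ^ (r - 2 + 2)" by (rule power_add[symmetric])
  also have "r - 2 + 2 = r" using r by simp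
  finally show "\<bar>psum d l r\<bar> \<le> B ^ r" .
qed

text \<open>A geometric tail whose ratio \<open>A * \<bar>t\<bar>\<close> is at most 1/2, whence the
  factor 2.\<close>

lemma powser_tail_bound:
  fixes c :: "nat \<Rightarrow> complex"
  assumes c: "\<And>k. cmod (c k) \<le> A ^ k" and A: "0 \<le> A" and t: "A * \<bar>t\<bar> \<le> 1 / 2"
    and s: "(\<lambda>k. c k * of_real t ^ k) sums G"
  shows "cmod (G - (\<Sum>j<n. c j * of_real t ^ j)) \<le> 2 * (A * \<bar>t\<bar>) ^ n"
proof -
  let ?x = "A * \<bar>t\<bar>"
  have x: "0 \<le> ?x" "?x < 1" using A t by auto
  have 1: "(\<lambda>k. c (k + n) * of_real t ^ (k + n)) sums (G - (\<Sum>j<n. c j * of_real t ^ j))"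
    using sums_split_initial_segment[OF s, of n] by simp
  have 2: "(\<lambda>k. ?x ^ n * ?x ^ k) sums (?x ^ n * (1 / (1 - ?x)))"
    using x by (intro sums_mult geometric_sums) simp
  have le: "cmod (c (k + n) * of_real t ^ (k + n)) \<le> ?x ^ n * ?x ^ k" for k
  proof -
    have "cmod (c (k + n) * of_real t ^ (k + n)) \<le> A ^ (k + n) * \<bar>t\<bar> ^ (k + n)"
      unfolding norm_mult norm_power norm_of_real by (intro mult_right_mono c) simp
    then show ?thesis by (simp add: power_mult_distrib power_add mult_ac)
  qed
  have "cmod (G - (\<Sum>j<n. c j * of_real t ^ j)) \<le> (\<Sum>k. ?x ^ n * ?x ^ k)"
    unfolding sums_unique[OF 1] by (rule norm_suminf_le[OF le]) (rule sums_summable[OF 2])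
  also have "\<dots> = ?x ^ n * (1 / (1 - ?x))" using 2 by (simp add: sums_iff)
  also have "\<dots> \<le> ?x ^ n * 2" using x t by (intro mult_left_mono zero_le_power) (auto simp: field_simps)
  finally show ?thesis by (simp add: mult.commute)
qed

text \<open>Convergence is known on a real interval only, so the coefficients are peeled off one by
  one rather than by contour integrals: once those below \<open>k\<close> converge, the remainder
  divided by \<open>t ^ k\<close> is close to \<open>c m k\<close> for small \<open>t\<close>,
  uniformly in \<open>m\<close>.\<close>

lemma powser_coeff_limit:
  fixes c :: "nat \<Rightarrow> nat \<Rightarrow> complex"
  assumes c: "\<And>m k. cmod (c m k) \<le> A ^ k" and A: "0 < A" and \<rho>: "0 < \<rho>" "A * \<rho> \<le> 1 / 2"
    and s: "\<And>m t. \<bar>t\<bar> \<le> \<rho> \<Longrightarrow> (\<lambda>k. c m k * of_real t ^ k) sums G m t"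
    and lim: "\<And>t. \<bar>t\<bar> \<le> \<rho> \<Longrightarrow> (\<lambda>m. G m t) \<longlonglongrightarrow> H t"
  shows "\<exists>q. (\<forall>k. (\<lambda>m. c m k) \<longlonglongrightarrow> q k) \<and> (\<forall>t. \<bar>t\<bar> \<le> \<rho> \<longrightarrow> (\<lambda>k. q k * of_real t ^ k) sums H t)"
proof -
  have conv: "convergent (\<lambda>m. c m k)" for k
  proof (induction k rule: less_induct)
    case (less k)
    have "Cauchy (\<lambda>m. c m k)"
    proof (rule metric_CauchyI)
      fix e :: real assume e: "e > 0"
      \<comment> \<open>The quotient \<open>R m\<close> is within \<open>2 * A ^ (k + 1) * t\<close>
        of \<open>c m k\<close>; this \<open>t\<close> makes the distance at most
        \<open>e / 4\<close>.\<close>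
      define t where "t = min \<rho> (e / (8 * A ^ (k + 1)))"
      have t: "0 < t" "t \<le> \<rho>" "t \<le> e / (8 * A ^ (k + 1))" using \<rho> e A by (auto simp: t_def)
      then have At: "A * \<bar>t\<bar> \<le> 1 / 2" 
      proof -
        have "A * \<bar>t\<bar> \<le> A * \<rho>" using t A by (intro mult_left_mono) auto
        then show ?thesis using \<rho>(2) by linarith
      qed
      define R where "R m = (G m t - (\<Sum>j<k. c m j * of_real t ^ j)) / of_real t ^ k" for m
      have near: "cmod (R m - c m k) \<le> e / 4" for m
      proof -
        have "R m - c m k = (G m t - (\<Sum>j<Suc k. c m j * of_real t ^ j)) / of_real t ^ k"
          using t(1) by (simp add: R_def field_simps)
        then have "cmod (R m - c m k) = cmod (G m t - (\<Sum>j<Suc k. c m j * of_real t ^ j)) / t ^ k"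
          using t(1) by (simp add: norm_divide norm_power)
        also have "\<dots> \<le> 2 * (A * t) ^ Suc k / t ^ k"
          using powser_tail_bound[OF c less_imp_le[OF A] At s, of m "Suc k"] t by (intro divide_right_mono) auto
        also have "\<dots> = 2 * A ^ (k + 1) * t" using t(1) by (simp add: power_mult_distrib field_simps)
        also have "\<dots> \<le> 2 * A ^ (k + 1) * (e / (8 * A ^ (k + 1)))" using t(3) A by (intro mult_left_mono) auto
        also have "\<dots> = e / 4" using A by simp
        finally show ?thesis .
      qed
      have "convergent R"
      proof -
        obtain q where q: "\<And>j. j < k \<Longrightarrow> (\<lambda>m. c m j) \<longlonglongrightarrow> q j"
          using less unfolding convergent_def by metis
        have "R \<longlonglongrightarrow> (H t - (\<Sum>j<k. q j * of_real t ^ j)) / of_real t ^ k"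
          unfolding R_def[abs_def] using t by (intro tendsto_intros lim q) auto
        then show ?thesis by (rule convergentI)
      qed
      then have "Cauchy R" by (rule convergent_Cauchy)
      then obtain M where M: "\<And>m n. m \<ge> M \<Longrightarrow> n \<ge> M \<Longrightarrow> dist (R m) (R n) < e / 4"
        using e unfolding Cauchy_def by (meson divide_pos_pos zero_less_numeral)
      have "dist (c m k) (c n k) < e" if "m \<ge> M" "n \<ge> M" for m n
      proof -
        have "dist (c m k) (c n k) \<le> dist (c m k) (R m) + (dist (R m) (R n) + dist (R n) (c n k))"
          by (intro order_trans[OF dist_triangle[of _ _ "R m"]] add_left_mono dist_triangle)
        also have "\<dots> < e / 4 + (e / 4 + e / 4) + e / 4"
          using near[of m] near[of n] M[OF that] e by (simp add: dist_norm norm_minus_commute)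
        finally show ?thesis by simp
      qed
      then show "\<exists>M. \<forall>m\<ge>M. \<forall>n\<ge>M. dist (c m k) (c n k) < e" by blast
    qed
    then show ?case by (rule Cauchy_convergent)
  qed
  then obtain q where q: "\<And>k. (\<lambda>m. c m k) \<longlonglongrightarrow> q k" unfolding convergent_def by metis
  have "(\<lambda>k. q k * of_real t ^ k) sums H t" if t: "\<bar>t\<bar> \<le> \<rho>" for t
  proof -
    have At: "A * \<bar>t\<bar> \<le> 1 / 2" 
    proof -
      have "A * \<bar>t\<bar> \<le> A * \<rho>" using t A by (intro mult_left_mono) auto
      then show ?thesis using \<rho>(2) by linarith
    qed
    show ?thesis unfolding sums_def
    proof (rule LIMSEQ_I)
      have "(\<lambda>m. cmod (G m t - (\<Sum>j<n. c m j * of_real t ^ j))) \<longlonglongrightarrow> cmod (H t - (\<Sum>j<n. q j * of_real t ^ j))" for n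
        by (intro tendsto_intros lim t q)
      then have bd: "cmod (H t - (\<Sum>j<n. q j * of_real t ^ j)) \<le> 2 * (1 / 2) ^ n" for n
      proof (rule LIMSEQ_le_const2)
        have "cmod (G m t - (\<Sum>j<n. c m j * of_real t ^ j)) \<le> 2 * (1 / 2) ^ n" for m
        proof -
          have "(A * \<bar>t\<bar>) ^ n \<le> (1 / 2) ^ n" using At A by (intro power_mono) auto
          then show ?thesis
            using powser_tail_bound[OF c less_imp_le[OF A] At s[OF t], of m n] by linarith
        qed
        then show "\<exists>N. \<forall>m\<ge>N. cmod (G m t - (\<Sum>j<n. c m j * of_real t ^ j)) \<le> 2 * (1 / 2) ^ n" by blast
      qed
      fix r :: real assume "r > 0"
      have "(\<lambda>n. 2 * (1 / 2 :: real) ^ n) \<longlonglongrightarrow> 2 * 0" by (intro tendsto_intros LIMSEQ_realpow_zero) auto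
      then have "\<forall>\<^sub>F n in sequentially. 2 * (1 / 2 :: real) ^ n < r"
        using \<open>r > 0\<close> by (intro order_tendstoD(2)) auto
      then obtain N where N: "\<And>n. n \<ge> N \<Longrightarrow> 2 * (1 / 2 :: real) ^ n < r"
        unfolding eventually_sequentially by blast
      show "\<exists>N. \<forall>n\<ge>N. norm ((\<Sum>j<n. q j * of_real t ^ j) - H t) < r"
      proof (intro exI[of _ N] allI impI)
        fix n assume "N \<le> n"
        then show "norm ((\<Sum>j<n. q j * of_real t ^ j) - H t) < r"
          using bd[of n] N[of n] by (simp add: norm_minus_commute)
      qed
    qed
  qed
  with q show ?thesis by blast
qed

text \<open>The cumulant as a functional of the characteristic function, so that it can be evaluated
  at an explicit formula or at a pointwise limit.\<close>

definition kappa :: "(real \<Rightarrow> complex) \<Rightarrow> nat \<Rightarrow> real" where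
  "kappa \<phi> r = Re ((- \<i>) ^ r * ((\<lambda>g t. vector_derivative g (at t)) ^^ r) (\<lambda>t. Ln (\<phi> t)) 0)"

lemma cumulant_eq_kappa:
  assumes "X \<in> borel_measurable M"
  shows "cumulant M X r = kappa (cf M X) r"
  using assms by (simp add: cumulant_def kappa_def char_distr_eq_cf)

lemma funpow_diffs: "(diffs ^^ r) q n = of_real (fact (n + r) / fact n) * (q (n + r) :: complex)"
proof (induction r arbitrary: n)
  case (Suc r)
  have "(diffs ^^ Suc r) q n = of_nat (Suc n) * (of_real (fact (Suc n + r) / fact (Suc n)) * q (Suc n + r))"
    by (simp add: diffs_def Suc.IH)
  also have "\<dots> = of_real (real (Suc n) * (fact (Suc n + r) / fact (Suc n))) * q (n + Suc r)"
    by (simp only: of_real_mult of_real_of_nat_eq mult.assoc add_Suc add_Suc_right)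
  also have "real (Suc n) * (fact (Suc n + r) / fact (Suc n)) = fact (n + Suc r) / fact n"
  proof -
    have f: "fact (Suc n) = real (Suc n) * (fact n :: real)" by (rule fact_Suc)
    show ?thesis unfolding f add_Suc add_Suc_right by (simp del: fact_Suc of_nat_Suc)
  qed
  finally show ?case .
qed simp

text \<open>An iterated derivative at 0 needs the lower ones in a neighbourhood, so termwise
  differentiation is carried out for all \<open>\<bar>t\<bar> < \<rho>\<close>.\<close>

lemma kappa_power_series:
  assumes \<rho>: "0 < \<rho>" and s: "\<And>t. \<bar>t\<bar> < \<rho> \<Longrightarrow> (\<lambda>k. q k * of_real t ^ k) sums Ln (\<phi> t)"
  shows "kappa \<phi> r = Re ((- \<i>) ^ r * (fact r * q r))"
proof -
  let ?D = "\<lambda>g t. vector_derivative g (at t) :: complex"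
  have sm: "summable (\<lambda>k. (diffs ^^ r) q k * z ^ k)" if "cmod z < \<rho>" for r z
    using that
  proof (induction r arbitrary: z)
    case 0
    obtain t where t: "cmod z < t" "t < \<rho>" using dense[OF 0] by blast
    then have "\<bar>t\<bar> < \<rho>" using norm_ge_zero[of z] by linarith
    then have "summable (\<lambda>k. q k * of_real t ^ k)" using s by (blast intro: sums_summable)
    then have "summable (\<lambda>k. q k * z ^ k)" by (rule powser_inside) (use t norm_ge_zero[of z] in auto)
    then show ?case by simp
  next
    case (Suc r)
    show ?case using termdiff_converges[OF Suc.prems Suc.IH] by simp
  qed
  have D: "(?D ^^ r) (\<lambda>t. Ln (\<phi> t)) t = (\<Sum>k. (diffs ^^ r) q k * of_real t ^ k)" if "\<bar>t\<bar> < \<rho>" for r t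
    using that
  proof (induction r arbitrary: t)
    case 0
    then show ?case using s[OF 0] by (simp add: sums_iff)
  next
    case (Suc r)
    have "((\<lambda>z. \<Sum>k. (diffs ^^ r) q k * z ^ k) has_field_derivative (\<Sum>k. diffs ((diffs ^^ r) q) k * of_real t ^ k)) (at (of_real t))"
      by (rule termdiffs_strong'[OF sm]) (use Suc.prems in auto)
    then have "((\<lambda>t. \<Sum>k. (diffs ^^ r) q k * of_real t ^ k) has_vector_derivative (\<Sum>k. (diffs ^^ Suc r) q k * of_real t ^ k)) (at t)"
      using has_vector_derivative_real_field by fastforce
    then have "((?D ^^ r) (\<lambda>t. Ln (\<phi> t)) has_vector_derivative (\<Sum>k. (diffs ^^ Suc r) q k * of_real t ^ k)) (at t)"
    proof (rule has_vector_derivative_transform_within_open)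
      show "open {-\<rho><..<\<rho>}" by simp
      show "t \<in> {-\<rho><..<\<rho>}" using Suc.prems by auto
      fix x assume "x \<in> {-\<rho><..<\<rho>}"
      then have "\<bar>x\<bar> < \<rho>" by auto
      then show "(\<Sum>k. (diffs ^^ r) q k * of_real x ^ k) = (?D ^^ r) (\<lambda>t. Ln (\<phi> t)) x" using Suc.IH by simp
    qed
    then show ?case by (simp add: vector_derivative_at)
  qed
  have "(?D ^^ r) (\<lambda>t. Ln (\<phi> t)) 0 = (diffs ^^ r) q 0"
    using D[of 0 r] \<rho> powser_zero[of "(diffs ^^ r) q"] by simp
  also have "\<dots> = fact r * q r" by (simp add: funpow_diffs)
  finally show ?thesis by (simp add: kappa_def)
qed

lemma Ln_exp_small: "cmod z \<le> 1 \<Longrightarrow> Ln (exp z) = z"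
  using abs_Im_le_cmod[of z] pi_gt3 by (intro Ln_exp) auto

text \<open>The power of \<open>- \<i>\<close> cancels the power of \<open>\<i>\<close> in
  \<open>chi_coeff r\<close> and leaves \<open>2 ^ r * fact r / (2 * r)\<close>.\<close>

lemma kappa_coeff:
  assumes "2 \<le> r"
  shows "Re ((- \<i>) ^ r * (fact r * (chi_coeff r * of_real p))) = 2 ^ (r - 1) * fact (r - 1) * p"
proof -
  have c: "chi_coeff r = (2 * \<i>) ^ r / (2 * of_nat r)" using assms by (simp add: chi_coeff_def)
  have pw: "(- \<i>) ^ r * (2 * \<i>) ^ r = 2 ^ r"
  proof -
    have "(- \<i>) * (2 * \<i>) = 2" by (simp add: complex_eq_iff)
    then show ?thesis unfolding power_mult_distrib[symmetric] by simp
  qed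
  have eq: "(- \<i>) ^ r * (fact r * (chi_coeff r * of_real p)) = ((- \<i>) ^ r * (2 * \<i>) ^ r) * (fact r / (2 * of_nat r)) * of_real p"
    unfolding c by (simp only: divide_inverse mult_ac)
  have f: "fact r / (2 * of_nat r) = (fact (r - 1) / 2 :: complex)"
    using assms fact_reduce[of r, where 'a = complex] by simp
  have t: "2 ^ r = (2 * 2 ^ (r - 1) :: complex)" using assms by (simp flip: power_Suc)
  have "(- \<i>) ^ r * (fact r * (chi_coeff r * of_real p)) = of_real (2 ^ (r - 1) * fact (r - 1) * p)"
    unfolding eq pw f t by simp
  then show ?thesis by (simp only: Re_complex_of_real)
qed

lemma kappa_spectral:
  assumes r: "2 \<le> r"
  shows "kappa (\<lambda>t. exp (log_cf d l t - of_real (v * t\<^sup>2) / 2)) r =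
    2 ^ (r - 1) * fact (r - 1) * psum d l r + of_bool (r = 2) * v"
proof -
  define q where "q k = chi_coeff k * of_real (psum d l k) + (if k = 2 then - of_real v / 2 else 0)" for k
  \<comment> \<open>The summand 1 keeps \<open>B\<close> positive even if all \<open>l i\<close>
    vanish.\<close>
  define B where "B = sqrt (psum d l 2) + 1"
  have p0: "0 \<le> psum d l 2" by (simp add: psum_def sum_nonneg)
  have B: "psum d l 2 \<le> B\<^sup>2" "1 \<le> B" using p0 by (auto simp: B_def power2_sum)
  have lB: "\<bar>l i\<bar> \<le> B" if "i < d" for i using psum_bounds(1)[OF B(1) _ that] B(2) by simp
  have sums: "(\<lambda>k. q k * of_real t ^ k) sums (log_cf d l t - of_real (v * t\<^sup>2) / 2)" if t: "\<bar>t\<bar> < 1 / (4 * B)" for t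
  proof -
    have "\<bar>t * l i\<bar> < 1 / 2" if "i < d" for i
    proof -
      have "\<bar>t\<bar> * \<bar>l i\<bar> \<le> 1 / (4 * B) * B" using t lB[OF that] B(2) by (intro mult_mono) auto
      also have "\<dots> < 1 / 2" using B(2) by simp
      finally show ?thesis by (simp add: abs_mult)
    qed
    from log_cf_sums[OF this]
    have 1: "(\<lambda>k. (chi_coeff k * of_real (psum d l k)) * of_real t ^ k) sums log_cf d l t" .
    have 2: "(\<lambda>k. if k = 2 then - of_real v / 2 * of_real t ^ 2 else 0) sums (- of_real v / 2 * of_real t ^ 2 :: complex)"
      using sums_single[of 2 "\<lambda>_. - of_real v / 2 * of_real t ^ 2 :: complex"] by simp
    have "(\<lambda>k. q k * of_real t ^ k) = (\<lambda>k. (chi_coeff k * of_real (psum d l k)) * of_real t ^ k +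
        (if k = 2 then - of_real v / 2 * of_real t ^ 2 else 0))"
      by (auto simp: q_def fun_eq_iff algebra_simps)
    then show ?thesis using sums_add[OF 1 2] by (simp add: algebra_simps)
  qed
  \<comment> \<open>Continuity at 0 and \<open>q 0 = 0\<close> keep the series below 1 in modulus
    near 0, where \<open>Ln\<close> inverts \<open>exp\<close>.\<close>
  have "isCont (\<lambda>t. \<Sum>k. q k * t ^ k) (0::complex)"
  proof (rule isCont_powser)
    define K where "K = 1 / (8 * B)"
    have "0 < K" "K < 1 / (4 * B)" using B(2) by (auto simp: K_def field_simps)
    then show "summable (\<lambda>k. q k * of_real K ^ k)" using sums[of K] by (auto intro: sums_summable)
    show "norm (0::complex) < norm (complex_of_real K)" using \<open>0 < K\<close> by simp
  qed
  then have "((\<lambda>t. \<Sum>k. q k * t ^ k) \<longlongrightarrow> q 0) (at 0)" by (simp add: isCont_def powser_zero)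
  moreover have "q 0 = 0" by (simp add: q_def chi_coeff_def)
  ultimately have lim0: "((\<lambda>t. \<Sum>k. q k * t ^ k) \<longlongrightarrow> 0) (at (0::complex))" by simp
  obtain e where e: "e > 0" "\<And>z. z \<noteq> 0 \<Longrightarrow> cmod z < e \<Longrightarrow> cmod (\<Sum>k. q k * z ^ k) < 1"
    using LIM_D[OF lim0, of 1] by auto
  define \<rho> where "\<rho> = min e (1 / (4 * B))"
  have \<rho>: "0 < \<rho>" using e B(2) by (simp add: \<rho>_def)
  have "kappa (\<lambda>t. exp (log_cf d l t - of_real (v * t\<^sup>2) / 2)) r = Re ((- \<i>) ^ r * (fact r * q r))"
  proof (rule kappa_power_series[OF \<rho>])
    fix t assume t: "\<bar>t\<bar> < \<rho>"
    then have s: "(\<lambda>k. q k * of_real t ^ k) sums (log_cf d l t - of_real (v * t\<^sup>2) / 2)"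
      by (intro sums) (simp add: \<rho>_def)
    have "cmod (log_cf d l t - of_real (v * t\<^sup>2) / 2) \<le> 1"
    proof (cases "t = 0")
      case True then show ?thesis by (simp add: log_cf_def log_chi_def)
    next
      case False
      then have "cmod (\<Sum>k. q k * of_real t ^ k) < 1" using t by (intro e) (auto simp: \<rho>_def)
      then show ?thesis using s by (simp add: sums_iff)
    qed
    then show "(\<lambda>k. q k * of_real t ^ k) sums Ln (exp (log_cf d l t - of_real (v * t\<^sup>2) / 2))"
      using s by (simp add: Ln_exp_small)
  qed
  also have "\<dots> = 2 ^ (r - 1) * fact (r - 1) * psum d l r + of_bool (r = 2) * v"
  proof (cases "r = 2")
    case True
    have "(- \<i>) ^ r * (fact r * q r) = (- \<i>) ^ r * (fact r * (chi_coeff r * of_real (psum d l r))) +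
        (- \<i>) ^ 2 * (fact 2 * (- of_real v / 2))"
      unfolding q_def True by (simp only: distrib_left if_True simp_thms)
    also have "(- \<i>) ^ 2 * (fact 2 * (- of_real v / 2)) = (of_real v :: complex)" by (simp add: fact_2)
    finally have "(- \<i>) ^ r * (fact r * q r) = (- \<i>) ^ r * (fact r * (chi_coeff r * of_real (psum d l r))) + of_real v" .
    then have "Re ((- \<i>) ^ r * (fact r * q r)) = Re ((- \<i>) ^ r * (fact r * (chi_coeff r * of_real (psum d l r)))) + v"
      by (simp only: plus_complex.sel Re_complex_of_real)
    then show ?thesis unfolding kappa_coeff[OF r] using True by simp
  next
    case False
    then show ?thesis using kappa_coeff[OF r] by (simp add: q_def)
  qed
  finally show ?thesis .
qed

text \<open>A positive bound that is the same along a sequence survives the limit and keeps it off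
  the branch cut of \<open>Ln\<close>.\<close>

lemma Re_exp_ge:
  assumes "cmod z \<le> 1 / 2"
  shows "exp (- 1 / 2) * cos (1 / 2) \<le> Re (exp z)"
proof -
  have c: "0 < cos (1 / 2 :: real)" using pi_gt3 by (intro cos_gt_zero_pi) auto
  have "cos (1 / 2) \<le> cos \<bar>Im z\<bar>"
    using abs_Im_le_cmod[of z] assms pi_gt3 by (intro cos_monotone_0_pi_le) auto
  moreover have "exp (- 1 / 2) \<le> exp (Re z)" using abs_Re_le_cmod[of z] assms by simp
  ultimately have "exp (- 1 / 2) * cos (1 / 2) \<le> exp (Re z) * cos \<bar>Im z\<bar>"
    using c by (intro mult_mono) auto
  then show ?thesis by (simp add: Re_exp)
qed

text \<open>The limit \<open>\<phi>\<close> is arbitrary: this serves both for finite-rank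
  approximations of one fixed kernel and for a sequence that converges in law.\<close>

lemma psum_limit_kappa:
  assumes bound: "\<And>m. psum (d m) (l m) 2 \<le> B\<^sup>2" and B: "0 < B"
    and lim: "\<And>t. (\<lambda>m. exp (log_cf (d m) (l m) t)) \<longlonglongrightarrow> \<phi> t" and r: "2 \<le> r"
  shows "(\<lambda>m. 2 ^ (r - 1) * fact (r - 1) * psum (d m) (l m) r) \<longlonglongrightarrow> kappa \<phi> r"
proof -
  define c where "c m k = chi_coeff k * of_real (psum (d m) (l m) k)" for m k
  \<comment> \<open>Makes \<open>2 * B * \<rho>\<close> equal to 1/4. The logarithms are then at
    most \<open>2 * (1 / 4)\<^sup>2\<close>, well inside the region where \<open>Ln\<close> inverts
    \<open>exp\<close>.\<close>
  define \<rho> where "\<rho> = 1 / (8 * B)"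
  have \<rho>: "0 < \<rho>" "(2 * B) * \<rho> \<le> 1 / 2" using B by (auto simp: \<rho>_def)
  have c_le: "cmod (c m k) \<le> (2 * B) ^ k" for m k
  proof (cases "k < 2")
    case True then show ?thesis using B by (simp add: c_def chi_coeff_def)
  next
    case False
    then have "\<bar>psum (d m) (l m) k\<bar> \<le> B ^ k" using psum_bounds(2)[OF bound] B by auto
    then have "cmod (c m k) \<le> 2 ^ k * B ^ k"
      unfolding c_def norm_mult norm_of_real by (intro mult_mono norm_chi_coeff_le) auto
    then show ?thesis by (simp add: power_mult_distrib)
  qed
  have s: "(\<lambda>k. c m k * of_real t ^ k) sums log_cf (d m) (l m) t" if t: "\<bar>t\<bar> \<le> \<rho>" for m t
    unfolding c_def
  proof (rule log_cf_sums)
    fix i assume "i < d m"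
    then have "\<bar>t\<bar> * \<bar>l m i\<bar> \<le> \<rho> * B" using t psum_bounds(1)[OF bound] B \<rho> by (intro mult_mono) auto
    also have "\<dots> < 1 / 2" using B by (simp add: \<rho>_def)
    finally show "\<bar>t * l m i\<bar> < 1 / 2" by (simp add: abs_mult)
  qed
  have small: "cmod (log_cf (d m) (l m) t) \<le> 1 / 2" if t: "\<bar>t\<bar> \<le> \<rho>" for m t
  proof -
    have x: "2 * B * \<bar>t\<bar> \<le> 1 / 4"
    proof -
      have "2 * B * \<bar>t\<bar> \<le> 2 * B * \<rho>" using t B by (intro mult_left_mono) auto
      then show ?thesis using B by (simp add: \<rho>_def)
    qed
    have "cmod (log_cf (d m) (l m) t - (\<Sum>j<2. c m j * of_real t ^ j)) \<le> 2 * (2 * B * \<bar>t\<bar>) ^ 2"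
      by (rule powser_tail_bound[OF c_le _ _ s[OF t]]) (use B x in auto)
    moreover have "(\<Sum>j<2. c m j * of_real t ^ j) = 0" by (simp add: c_def chi_coeff_def)
    moreover have "(2 * B * \<bar>t\<bar>) ^ 2 \<le> (1 / 4) ^ 2" using x B by (intro power_mono) auto
    ultimately show ?thesis by (simp add: power2_eq_square)
  qed
  have lim2: "(\<lambda>m. log_cf (d m) (l m) t) \<longlonglongrightarrow> Ln (\<phi> t)" if t: "\<bar>t\<bar> \<le> \<rho>" for t
  proof -
    have "0 < exp (- 1 / 2) * cos (1 / 2 :: real)" using pi_gt3 by (intro mult_pos_pos cos_gt_zero_pi) auto
    also have "\<dots> \<le> Re (\<phi> t)"
      using Re_exp_ge[OF small[OF t]] by (intro LIMSEQ_le_const[OF tendsto_Re[OF lim]]) auto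
    finally have "\<phi> t \<notin> \<real>\<^sub>\<le>\<^sub>0" by (auto simp: complex_nonpos_Reals_iff)
    then have "(\<lambda>m. Ln (exp (log_cf (d m) (l m) t))) \<longlonglongrightarrow> Ln (\<phi> t)"
      by (intro tendsto_Ln lim)
    moreover have "Ln (exp (log_cf (d m) (l m) t)) = log_cf (d m) (l m) t" for m
      using small[OF t, of m] by (intro Ln_exp_small) linarith
    ultimately show ?thesis by simp
  qed
  obtain q where q: "\<And>k. (\<lambda>m. c m k) \<longlonglongrightarrow> q k"
    and qs: "\<And>t. \<bar>t\<bar> \<le> \<rho> \<Longrightarrow> (\<lambda>k. q k * of_real t ^ k) sums Ln (\<phi> t)"
    using powser_coeff_limit[OF c_le _ \<rho> s lim2] B by auto
  have "kappa \<phi> r = Re ((- \<i>) ^ r * (fact r * q r))"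
    by (rule kappa_power_series[OF \<rho>(1)]) (simp add: qs)
  moreover have "(\<lambda>m. Re ((- \<i>) ^ r * (fact r * c m r))) \<longlonglongrightarrow> Re ((- \<i>) ^ r * (fact r * q r))"
    by (intro tendsto_intros q)
  moreover have "Re ((- \<i>) ^ r * (fact r * c m r)) = 2 ^ (r - 1) * fact (r - 1) * psum (d m) (l m) r" for m
    unfolding c_def by (rule kappa_coeff[OF r])
  ultimately show ?thesis by simp
qed

section \<open>Convergence of power sums and weak convergence\<close>

text \<open>The modulus is that of \<open>1 - 2 * \<i> * x\<close> to the power -1/2; the fourth
  power removes both roots.\<close>

lemma norm_exp_log_chi: "cmod (exp (log_chi x)) ^ 4 = 1 / (1 + 4 * x\<^sup>2)"
proof -
  let ?z = "1 - 2 * \<i> * of_real x"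
  have nz: "?z \<noteq> 0" by (simp add: complex_eq_iff)
  have "exp (log_chi x) ^ 2 = iexp (- 2 * x) * exp (- Ln ?z)"
    by (simp add: log_chi_def power2_eq_square algebra_simps flip: exp_add)
  also have "\<dots> = iexp (- 2 * x) / ?z" using nz by (simp add: exp_minus divide_inverse)
  finally have "cmod (exp (log_chi x)) ^ 2 = cmod (iexp (- 2 * x) / ?z)" by (simp only: norm_power[symmetric])
  then have "cmod (exp (log_chi x)) ^ 2 = 1 / cmod ?z" by (simp only: norm_divide norm_exp_i_times)
  then have "(cmod (exp (log_chi x)) ^ 2) ^ 2 = 1 / (cmod ?z)\<^sup>2" by (simp add: power_divide)
  moreover have "(cmod ?z)\<^sup>2 = 1 + 4 * x\<^sup>2" by (simp add: cmod_power2 power_mult_distrib)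
  ultimately show ?thesis by (simp flip: power_mult)
qed

lemma prod_one_plus_ge:
  fixes a :: "nat \<Rightarrow> real"
  assumes "\<And>i. i < d \<Longrightarrow> 0 \<le> a i"
  shows "1 + (\<Sum>i<d. a i) \<le> (\<Prod>i<d. 1 + a i)"
  using assms
proof (induction d)
  case (Suc d)
  have s: "0 \<le> (\<Sum>i<d. a i)" using Suc.prems by (intro sum_nonneg) auto
  have "1 + (\<Sum>i<Suc d. a i) \<le> (1 + (\<Sum>i<d. a i)) * (1 + a d)"
    using s Suc.prems[of d] by (simp add: algebra_simps)
  also have "\<dots> \<le> (\<Prod>i<d. 1 + a i) * (1 + a d)"
    using Suc by (intro mult_right_mono) auto
  finally show ?case by simp
qed simp

lemma psum_le_log_cf: "(1 + 4 * psum d l 2) * cmod (exp (log_cf d l 1)) ^ 4 \<le> 1"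
proof -
  let ?P = "\<Prod>i<d. 1 + 4 * (l i)\<^sup>2"
  have pos: "0 < ?P" by (intro prod_pos) (simp add: add_pos_nonneg)
  have "cmod (exp (log_cf d l 1)) ^ 4 = (\<Prod>i<d. cmod (exp (log_chi (l i))) ^ 4)"
    by (simp add: log_cf_def exp_sum prod_norm[symmetric] prod_power_distrib)
  also have "\<dots> = (\<Prod>i<d. 1 / (1 + 4 * (l i)\<^sup>2))" by (simp only: norm_exp_log_chi)
  also have "\<dots> = 1 / ?P" by (simp add: prod_dividef)
  finally have eq: "cmod (exp (log_cf d l 1)) ^ 4 = 1 / ?P" .
  have "1 + (\<Sum>i<d. 4 * (l i)\<^sup>2) \<le> ?P" by (rule prod_one_plus_ge) simp
  then show ?thesis unfolding eq using pos by (simp add: psum_def sum_distrib_left)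
qed

lemma psum_bounded_of_limit:
  assumes lim: "(\<lambda>m. exp (log_cf (d m) (l m) 1)) \<longlonglongrightarrow> z" and "z \<noteq> 0"
  shows "\<exists>B>0. \<forall>m. psum (d m) (l m) 2 \<le> B\<^sup>2"
proof -
  let ?w = "\<lambda>m. cmod (exp (log_cf (d m) (l m) 1)) ^ 4"
  have "?w \<longlonglongrightarrow> cmod z ^ 4" by (intro tendsto_intros lim)
  then have "(\<lambda>m. inverse (?w m)) \<longlonglongrightarrow> inverse (cmod z ^ 4)"
    using \<open>z \<noteq> 0\<close> by (intro tendsto_inverse) auto
  then have "Bseq (\<lambda>m. inverse (?w m))" by (rule convergent_imp_Bseq[OF convergentI])
  then obtain K where K: "K > 0" "\<And>m. norm (inverse (?w m)) \<le> K" unfolding Bseq_def by auto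
  have "psum (d m) (l m) 2 \<le> (sqrt K)\<^sup>2" for m
  proof -
    have w: "0 < ?w m" by simp
    have "1 + 4 * psum (d m) (l m) 2 \<le> inverse (?w m)"
      using psum_le_log_cf[of "d m" "l m"] w by (simp add: field_simps)
    also have "\<dots> \<le> K" using K(2)[of m] by simp
    finally have "1 + 4 * psum (d m) (l m) 2 \<le> K" .
    moreover have "0 \<le> psum (d m) (l m) 2" by (simp add: psum_def sum_nonneg)
    ultimately show ?thesis using K(1) by simp
  qed
  then show ?thesis using K(1) by (intro exI[of _ "sqrt K"]) auto
qed

text \<open>The measures \<open>\<Sum> x\<^sub>i\<^sup>2 \<delta>\<^bsub>x\<^sub>i\<^esub>\<close> live on a fixed compact interval and their moments converge, hence
  they converge weakly; an atom \<open>v / 2\<close> at \<open>0\<close> may appear in the limit.\<close>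

lemma weighted_sum_limit:
  fixes k :: "real \<Rightarrow> real"
  assumes bound: "\<And>m. psum (d m) (l m) 2 \<le> B\<^sup>2" "psum d' l' 2 \<le> B\<^sup>2" and B: "0 < B" and v: "0 \<le> v"
    and p2: "(\<lambda>m. psum (d m) (l m) 2) \<longlonglongrightarrow> psum d' l' 2 + v / 2"
    and pr: "\<And>r. 3 \<le> r \<Longrightarrow> (\<lambda>m. psum (d m) (l m) r) \<longlonglongrightarrow> psum d' l' r"
    and k: "continuous_on {-B..B} k"
  shows "(\<lambda>m. \<Sum>i<d m. (l m i)\<^sup>2 * k (l m i)) \<longlonglongrightarrow> (\<Sum>i<d'. (l' i)\<^sup>2 * k (l' i)) + v / 2 * k 0"
proof (rule LIMSEQ_I)
  fix e :: real assume e: "e > 0"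
  \<comment> \<open>Collects the errors: \<open>\<delta> * B\<^sup>2\<close> for each of the two
    lists, \<open>\<delta>\<close> for the polynomial sums and \<open>v / 2 * \<delta>\<close> for
    the atom.\<close>
  define C where "C = 3 * (B\<^sup>2 + v + 1)"
  have C: "0 < C" using v by (simp add: C_def add_nonneg_pos)
  define \<delta> where "\<delta> = e / C"
  have \<delta>: "0 < \<delta>" using e C by (simp add: \<delta>_def)
  obtain g where g: "real_polynomial_function g" "\<And>x. x \<in> {-B..B} \<Longrightarrow> \<bar>k x - g x\<bar> < \<delta>"
    using Stone_Weierstrass_real_polynomial_function[OF compact_Icc k \<delta>] by blast
  from g(1) obtain a n where ga: "g = (\<lambda>x. \<Sum>j\<le>n. a j * x ^ j)"
    unfolding real_polynomial_function_iff_sum by blast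
  \<comment> \<open>Against the weight \<open>x\<^sup>2\<close> a polynomial integrates to power
    sums of order at least 2.\<close>
  have sumg: "(\<Sum>i<D. (L i)\<^sup>2 * g (L i)) = (\<Sum>j\<le>n. a j * psum D L (j + 2))" for D and L :: "nat \<Rightarrow> real"
  proof -
    have "(\<Sum>i<D. (L i)\<^sup>2 * g (L i)) = (\<Sum>i<D. \<Sum>j\<le>n. a j * L i ^ (j + 2))"
      unfolding ga sum_distrib_left by (intro sum.cong refl) (simp add: power_add power2_eq_square mult_ac)
    also have "\<dots> = (\<Sum>j\<le>n. \<Sum>i<D. a j * L i ^ (j + 2))" by (rule sum.swap)
    finally show ?thesis by (simp add: psum_def sum_distrib_left)
  qed
  have near: "\<bar>(\<Sum>i<D. (L i)\<^sup>2 * k (L i)) - (\<Sum>i<D. (L i)\<^sup>2 * g (L i))\<bar> \<le> \<delta> * B\<^sup>2"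
    if "psum D L 2 \<le> B\<^sup>2" for D L
  proof -
    have "\<bar>(\<Sum>i<D. (L i)\<^sup>2 * k (L i)) - (\<Sum>i<D. (L i)\<^sup>2 * g (L i))\<bar> \<le> (\<Sum>i<D. \<bar>(L i)\<^sup>2 * (k (L i) - g (L i))\<bar>)"
      unfolding sum_subtractf[symmetric] right_diff_distrib[symmetric] by (rule sum_abs)
    also have "\<dots> \<le> (\<Sum>i<D. (L i)\<^sup>2 * \<delta>)"
    proof (rule sum_mono)
      fix i assume "i \<in> {..<D}"
      then have "\<bar>L i\<bar> \<le> B" using psum_bounds(1)[OF that] B by auto
      then have "L i \<in> {-B..B}" by auto
      then have "\<bar>k (L i) - g (L i)\<bar> \<le> \<delta>" using g(2) by (intro less_imp_le)
      then show "\<bar>(L i)\<^sup>2 * (k (L i) - g (L i))\<bar> \<le> (L i)\<^sup>2 * \<delta>"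
        unfolding abs_mult by (simp add: mult_left_mono)
    qed
    also have "\<dots> = \<delta> * psum D L 2" by (simp add: psum_def sum_distrib_left mult.commute)
    also have "\<dots> \<le> \<delta> * B\<^sup>2" using that \<delta> by (intro mult_left_mono) auto
    finally show ?thesis .
  qed
  have lim: "(\<lambda>m. \<Sum>i<d m. (l m i)\<^sup>2 * g (l m i)) \<longlonglongrightarrow> (\<Sum>i<d'. (l' i)\<^sup>2 * g (l' i)) + v / 2 * g 0"
  proof -
    have "(\<lambda>m. \<Sum>j\<le>n. a j * psum (d m) (l m) (j + 2)) \<longlonglongrightarrow>
        (\<Sum>j\<le>n. a j * (psum d' l' (j + 2) + (if j = 0 then v / 2 else 0)))"
    proof (intro tendsto_intros)
      fix j
      \<comment> \<open>Only the constant coefficient meets the second power sum, where the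
        additional mass \<open>v / 2\<close> sits.\<close>
      show "(\<lambda>m. psum (d m) (l m) (j + 2)) \<longlonglongrightarrow> psum d' l' (j + 2) + (if j = 0 then v / 2 else 0)"
        using p2 pr[of "j + 2"] by (cases "j = 0") (auto simp: numeral_2_eq_2)
    qed
    also have "(\<Sum>j\<le>n. a j * (psum d' l' (j + 2) + (if j = 0 then v / 2 else 0))) =
        (\<Sum>j\<le>n. a j * psum d' l' (j + 2)) + (\<Sum>j\<le>n. if j = 0 then a j * (v / 2) else 0)"
      unfolding sum.distrib[symmetric] by (intro sum.cong refl) (auto simp: distrib_left)
    also have "(\<Sum>j\<le>n. if j = 0 then a j * (v / 2) else 0) = v / 2 * a 0" by simp
    also have "a 0 = g 0"
    proof -
      have "g 0 = (\<Sum>j\<le>n. if j = 0 then a j else 0)" unfolding ga by (intro sum.cong refl) auto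
      then show ?thesis by simp
    qed
    finally show ?thesis unfolding sumg .
  qed
  obtain M where M: "\<And>m. m \<ge> M \<Longrightarrow> norm ((\<Sum>i<d m. (l m i)\<^sup>2 * g (l m i)) - ((\<Sum>i<d'. (l' i)\<^sup>2 * g (l' i)) + v / 2 * g 0)) < \<delta>"
    using LIMSEQ_D[OF lim \<delta>] by blast
  show "\<exists>M. \<forall>m\<ge>M. norm ((\<Sum>i<d m. (l m i)\<^sup>2 * k (l m i)) - ((\<Sum>i<d'. (l' i)\<^sup>2 * k (l' i)) + v / 2 * k 0)) < e"
  proof (intro exI[of _ M] allI impI)
    fix m assume m: "M \<le> m"
    have "\<bar>k 0 - g 0\<bar> < \<delta>" using B by (intro g(2)) auto
    then have "v / 2 * \<bar>k 0 - g 0\<bar> \<le> v / 2 * \<delta>" using v by (intro mult_left_mono) auto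
    then have k0: "\<bar>v / 2 * k 0 - v / 2 * g 0\<bar> \<le> v / 2 * \<delta>"
      unfolding right_diff_distrib[symmetric] abs_mult using v by simp
    have "norm ((\<Sum>i<d m. (l m i)\<^sup>2 * k (l m i)) - ((\<Sum>i<d'. (l' i)\<^sup>2 * k (l' i)) + v / 2 * k 0)) <
        \<delta> * B\<^sup>2 + \<delta> + \<delta> * B\<^sup>2 + v / 2 * \<delta>"
      using near[OF bound(1), of m] near[OF bound(2)] M[OF m] k0 by (simp only: real_norm_def)
    also have "\<dots> \<le> \<delta> * C"
      using \<delta> v by (simp add: C_def algebra_simps)
    also have "\<dots> = e" using C by (simp add: \<delta>_def)
    finally show "norm ((\<Sum>i<d m. (l m i)\<^sup>2 * k (l m i)) - ((\<Sum>i<d'. (l' i)\<^sup>2 * k (l' i)) + v / 2 * k 0)) < e" .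
  qed
qed

text \<open>Divided by \<open>x\<^sup>2\<close>, the logarithm extends continuously to 0. An atom
  \<open>v / 2\<close> there contributes \<open>- v * t\<^sup>2 / 2\<close>, the logarithm of a
  normal characteristic function.\<close>

lemma log_chi_quotient_tendsto:
  "((\<lambda>x. log_chi (t * x) / of_real (x\<^sup>2)) \<longlongrightarrow> - of_real (t\<^sup>2)) (at 0)"
proof (cases "t = 0")
  case True then show ?thesis by (simp add: log_chi_def)
next
  case False
  have bd: "cmod (log_chi y + of_real (y\<^sup>2)) \<le> 16 * \<bar>y\<bar> ^ 3" if "\<bar>y\<bar> \<le> 1 / 4" for y
  proof -
    have "cmod (log_chi y - (\<Sum>j<3. chi_coeff j * of_real y ^ j)) \<le> 2 * (2 * \<bar>y\<bar>) ^ 3"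
      by (rule powser_tail_bound[OF norm_chi_coeff_le]) (use that in \<open>auto intro: log_chi_sums\<close>)
    moreover have "(\<Sum>j<3. chi_coeff j * of_real y ^ j) = - of_real (y\<^sup>2)"
      by (simp add: chi_coeff_def eval_nat_numeral lessThan_Suc)
    ultimately show ?thesis by (simp add: power_mult_distrib)
  qed
  have "((\<lambda>x. log_chi (t * x) / of_real (x\<^sup>2) - (- of_real (t\<^sup>2))) \<longlongrightarrow> 0) (at 0)"
  proof (rule Lim_null_comparison)
    have "\<forall>\<^sub>F x in at 0. \<bar>x\<bar> < 1 / (4 * \<bar>t\<bar>)"
      using False by (auto simp: eventually_at dist_real_def intro!: exI[of _ "1 / (4 * \<bar>t\<bar>)"])
    moreover have "\<forall>\<^sub>F x in at 0. x \<noteq> (0::real)" by (rule eventually_neq_at_within)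
    ultimately show "\<forall>\<^sub>F x in at 0. norm (log_chi (t * x) / of_real (x\<^sup>2) - (- of_real (t\<^sup>2))) \<le> 16 * \<bar>t\<bar> ^ 3 * \<bar>x\<bar>"
    proof eventually_elim
      case (elim x)
      then have "\<bar>t * x\<bar> \<le> 1 / 4" using False by (simp add: abs_mult field_simps)
      then have b: "cmod (log_chi (t * x) + of_real ((t * x)\<^sup>2)) \<le> 16 * \<bar>t * x\<bar> ^ 3" by (rule bd)
      have "log_chi (t * x) / of_real (x\<^sup>2) - (- of_real (t\<^sup>2)) = (log_chi (t * x) + of_real ((t * x)\<^sup>2)) / of_real (x\<^sup>2)"
        using elim by (simp add: power_mult_distrib add_divide_distrib)
      then have "norm (log_chi (t * x) / of_real (x\<^sup>2) - (- of_real (t\<^sup>2))) = cmod (log_chi (t * x) + of_real ((t * x)\<^sup>2)) / x\<^sup>2"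
        by (simp add: norm_divide norm_power)
      also have "\<dots> \<le> 16 * \<bar>t * x\<bar> ^ 3 / x\<^sup>2" by (intro divide_right_mono b) simp
      also have "\<dots> = 16 * \<bar>t\<bar> ^ 3 * (\<bar>x\<bar> ^ 3 / \<bar>x\<bar> ^ 2)" by (simp add: abs_mult power_mult_distrib)
      also have "\<bar>x\<bar> ^ 3 / \<bar>x\<bar> ^ 2 = \<bar>x\<bar>" using elim by (simp add: power3_eq_cube power2_eq_square)
      finally show ?case .
    qed
    have "((\<lambda>x::real. 16 * \<bar>t\<bar> ^ 3 * \<bar>x\<bar>) \<longlongrightarrow> 16 * \<bar>t\<bar> ^ 3 * \<bar>0\<bar>) (at 0)" by (intro tendsto_intros)
    then show "((\<lambda>x::real. 16 * \<bar>t\<bar> ^ 3 * \<bar>x\<bar>) \<longlongrightarrow> 0) (at 0)" by simp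
  qed
  then show ?thesis by (rule LIM_zero_cancel)
qed

lemma log_cf_limit:
  assumes bound: "\<And>m. psum (d m) (l m) 2 \<le> B\<^sup>2" "psum d' l' 2 \<le> B\<^sup>2" and B: "0 < B" and v: "0 \<le> v"
    and p2: "(\<lambda>m. psum (d m) (l m) 2) \<longlonglongrightarrow> psum d' l' 2 + v / 2"
    and pr: "\<And>r. 3 \<le> r \<Longrightarrow> (\<lambda>m. psum (d m) (l m) r) \<longlonglongrightarrow> psum d' l' r"
  shows "(\<lambda>m. log_cf (d m) (l m) t) \<longlonglongrightarrow> log_cf d' l' t - of_real (v * t\<^sup>2) / 2"
proof -
  \<comment> \<open>The factor \<open>x\<^sup>2\<close> moves into the weight of the measure. The
    value at 0 makes \<open>k\<close> continuous and still gives \<open>log_chi\<close> after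
    multiplication, as both sides vanish there.\<close>
  define k where "k x = (if x = 0 then - of_real (t\<^sup>2) else log_chi (t * x) / of_real (x\<^sup>2))" for x
  have kc: "isCont k x" for x
  proof (cases "x = 0")
    case True
    have "(k \<longlongrightarrow> - of_real (t\<^sup>2)) (at 0)"
      by (rule Lim_transform_eventually[OF log_chi_quotient_tendsto])
        (auto simp: k_def eventually_at intro!: exI[of _ 1])
    then show ?thesis using True by (simp add: isCont_def k_def)
  next
    case False
    have nn: "1 - 2 * \<i> * of_real (t * x) \<notin> \<real>\<^sub>\<le>\<^sub>0" by (simp add: complex_nonpos_Reals_iff)
    have c: "isCont (\<lambda>x. log_chi (t * x) / of_real (x\<^sup>2)) x"
      unfolding log_chi_def using nn False by (intro continuous_intros) auto
    have ev: "\<forall>\<^sub>F y in nhds x. k y = log_chi (t * y) / of_real (y\<^sup>2)"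
      using t1_space_nhds[OF False] by eventually_elim (simp add: k_def)
    show ?thesis unfolding isCont_cong[OF ev] by (rule c)
  qed
  have sq: "(of_real ((y)\<^sup>2) :: complex) * k y = log_chi (t * y)" for y
    by (cases "y = 0") (auto simp: k_def log_chi_def)
  have sumk: "log_cf D L t = (\<Sum>i<D. of_real ((L i)\<^sup>2) * k (L i))" for D L
    by (simp only: log_cf_def sq)
  have k0: "k 0 = - of_real (t\<^sup>2)" by (simp add: k_def)
  have c: "continuous_on {-B..B} (\<lambda>x. Re (k x))" "continuous_on {-B..B} (\<lambda>x. Im (k x))"
    using kc by (auto intro!: continuous_at_imp_continuous_on continuous_intros)
  have re: "Re (log_cf D L t) = (\<Sum>i<D. (L i)\<^sup>2 * Re (k (L i)))"
    and im: "Im (log_cf D L t) = (\<Sum>i<D. (L i)\<^sup>2 * Im (k (L i)))" for D L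
    unfolding sumk by (simp_all del: of_real_power)
  have "(\<lambda>m. Re (log_cf (d m) (l m) t)) \<longlonglongrightarrow> Re (log_cf d' l' t - of_real (v * t\<^sup>2) / 2)"
    using weighted_sum_limit[OF bound B v p2 pr c(1)] unfolding re[symmetric] k0 by (simp add: field_simps del: of_real_power)
  moreover have "(\<lambda>m. Im (log_cf (d m) (l m) t)) \<longlonglongrightarrow> Im (log_cf d' l' t - of_real (v * t\<^sup>2) / 2)"
    using weighted_sum_limit[OF bound B v p2 pr c(2)] unfolding im[symmetric] k0 by (simp add: field_simps del: of_real_power)
  ultimately show ?thesis by (simp add: tendsto_complex_iff)
qed

section \<open>Power sums and the polynomial of the criterion\<close>

lemma sum_poly_eq_psum:
  "(\<Sum>i<d. l i ^ n * poly p (l i)) = (\<Sum>j\<le>degree p. coeff p j * psum d l (n + j))"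
proof -
  have "(\<Sum>i<d. l i ^ n * poly p (l i)) = (\<Sum>i<d. \<Sum>j\<le>degree p. coeff p j * l i ^ (n + j))"
    unfolding poly_altdef sum_distrib_left by (intro sum.cong refl) (simp add: power_add mult_ac)
  also have "\<dots> = (\<Sum>j\<le>degree p. \<Sum>i<d. coeff p j * l i ^ (n + j))" by (rule sum.swap)
  finally show ?thesis by (simp add: psum_def sum_distrib_left)
qed

text \<open>By Cauchy--Schwarz, the power sums satisfy asymptotically the linear recurrence with
  characteristic polynomial \<open>p\<close>; its leading and constant coefficients are nonzero, so convergence
  propagates in both directions from \<open>degree p\<close> consecutive terms.\<close>

lemma psum_recurrence:
  fixes p :: "real poly"
  assumes bound: "\<And>m. psum (d m) (l m) 2 \<le> B\<^sup>2" and B: "0 < B"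
    and lead: "lead_coeff p = 1" and const: "coeff p 0 \<noteq> 0"
    and roots: "\<And>i. i < d' \<Longrightarrow> poly p (l' i) = 0"
    and S: "(\<lambda>m. \<Sum>i<d m. poly (([:0, 1:] ^ e * p)\<^sup>2) (l m i)) \<longlonglongrightarrow> 0"
    and r0: "e + 1 \<le> r0"
    and conv: "\<And>r. r0 \<le> r \<Longrightarrow> r < r0 + degree p \<Longrightarrow> (\<lambda>m. psum (d m) (l m) r) \<longlonglongrightarrow> psum d' l' r"
    and r: "e + 1 \<le> r"
  shows "(\<lambda>m. psum (d m) (l m) r) \<longlonglongrightarrow> psum d' l' r"
proof -
  define a where "a = degree p"
  define err where "err m n = psum (d m) (l m) n - psum d' l' n" for m n
  have comb: "(\<lambda>m. \<Sum>j\<le>a. coeff p j * err m (n + j)) \<longlonglongrightarrow> 0" if n: "e + 1 \<le> n" for n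
  proof -
    \<comment> \<open>Of the \<open>n\<close> powers, \<open>e\<close> go with \<open>p\<close> into
      the factor controlled by \<open>S\<close> and \<open>s\<close> stay. As
      \<open>s \<ge> 1\<close>, the other factor of the Cauchy--Schwarz inequality is a power sum of
      order \<open>2 * s \<ge> 2\<close>, which is bounded.\<close>
    define s where "s = n - e"
    have s: "1 \<le> s" "n = s + e" using n by (auto simp: s_def)
    have zero: "(\<Sum>i<d'. l' i ^ n * poly p (l' i)) = 0" using roots by (intro sum.neutral) auto
    have eq: "(\<Sum>j\<le>a. coeff p j * err m (n + j)) = (\<Sum>i<d m. l m i ^ s * (l m i ^ e * poly p (l m i)))" for m
    proof -
      have "(\<Sum>j\<le>a. coeff p j * err m (n + j)) =
          (\<Sum>j\<le>a. coeff p j * psum (d m) (l m) (n + j)) - (\<Sum>j\<le>a. coeff p j * psum d' l' (n + j))"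
        by (simp add: err_def right_diff_distrib sum_subtractf)
      also have "\<dots> = (\<Sum>i<d m. l m i ^ n * poly p (l m i))"
        unfolding a_def sum_poly_eq_psum[symmetric] zero by simp
      finally show ?thesis by (simp add: s(2) power_add mult.assoc)
    qed
    have le: "(\<Sum>j\<le>a. coeff p j * err m (n + j))\<^sup>2 \<le>
        B ^ (2 * s) * (\<Sum>i<d m. poly (([:0, 1:] ^ e * p)\<^sup>2) (l m i))" for m
    proof -
      have "(\<Sum>j\<le>a. coeff p j * err m (n + j))\<^sup>2 \<le>
          (\<Sum>i<d m. (l m i ^ s)\<^sup>2) * (\<Sum>i<d m. (l m i ^ e * poly p (l m i))\<^sup>2)"
        unfolding eq by (rule Cauchy_Schwarz_ineq_sum)
      also have "\<dots> \<le> B ^ (2 * s) * (\<Sum>i<d m. (l m i ^ e * poly p (l m i))\<^sup>2)"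
      proof (rule mult_right_mono)
        have "(\<Sum>i<d m. (l m i ^ s)\<^sup>2) = psum (d m) (l m) (2 * s)"
          unfolding psum_def by (intro sum.cong refl) (simp add: mult.commute flip: power_mult)
        also have "\<dots> \<le> B ^ (2 * s)" using psum_bounds(2)[OF bound, of "2 * s" m] s(1) B by simp
        finally show "(\<Sum>i<d m. (l m i ^ s)\<^sup>2) \<le> B ^ (2 * s)" .
      qed (simp add: sum_nonneg)
      finally show ?thesis by simp
    qed
    have "(\<lambda>m. B ^ (2 * s) * (\<Sum>i<d m. poly (([:0, 1:] ^ e * p)\<^sup>2) (l m i))) \<longlonglongrightarrow> 0"
      using tendsto_mult_right_zero[OF S] by simp
    then have "(\<lambda>m. (\<Sum>j\<le>a. coeff p j * err m (n + j))\<^sup>2) \<longlonglongrightarrow> 0"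
    proof (rule Lim_null_comparison[rotated], intro always_eventually allI)
      fix m
      show "norm ((\<Sum>j\<le>a. coeff p j * err m (n + j))\<^sup>2) \<le>
          B ^ (2 * s) * (\<Sum>i<d m. poly (([:0, 1:] ^ e * p)\<^sup>2) (l m i))"
        unfolding real_norm_def abs_power2 by (rule le)
    qed
    then show ?thesis by simp
  qed
  have pa: "coeff p a = 1" using lead by (simp add: a_def)
  have up: "(\<lambda>m. err m n) \<longlonglongrightarrow> 0" if "r0 \<le> n" for n
    using that
  proof (induction n rule: less_induct)
    case (less n)
    show ?case
    proof (cases "n < r0 + a")
      case True
      then show ?thesis using conv[of n] less.prems by (simp add: err_def a_def LIM_zero_iff)
    next
      case False
      then have na: "e + 1 \<le> n - a" "r0 \<le> n - a" "a \<le> n" using r0 by auto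
      have "(\<lambda>m. (\<Sum>j\<le>a. coeff p j * err m (n - a + j)) - (\<Sum>j<a. coeff p j * err m (n - a + j))) \<longlonglongrightarrow> 0 - (\<Sum>j<a. coeff p j * 0)"
        using na by (intro tendsto_diff comb tendsto_sum tendsto_mult tendsto_const less.IH) auto
      moreover have "(\<Sum>j\<le>a. coeff p j * err m (n - a + j)) - (\<Sum>j<a. coeff p j * err m (n - a + j)) = err m n" for m
        using na pa by (simp flip: lessThan_Suc_atMost)
      ultimately show ?thesis by simp
    qed
  qed
  have "(\<lambda>m. err m n) \<longlonglongrightarrow> 0" if "e + 1 \<le> n" for n
    using that
  \<comment> \<open>Downwards from \<open>r0\<close> the recurrence is solved for its lowest term.
    It is valid from \<open>e + 1\<close> on, and there the descent ends.\<close>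
  proof (induction "r0 - n" arbitrary: n rule: less_induct)
    case less
    show ?case
    proof (cases "r0 \<le> n")
      case True then show ?thesis by (rule up)
    next
      case False
      have "(\<lambda>m. err m (n + Suc j)) \<longlonglongrightarrow> 0" for j
        using less.hyps[of "n + Suc j"] less.prems False by simp
      then have "(\<lambda>m. ((\<Sum>j\<le>a. coeff p j * err m (n + j)) - (\<Sum>j<a. coeff p (Suc j) * err m (n + Suc j))) / coeff p 0)
          \<longlonglongrightarrow> (0 - (\<Sum>j<a. coeff p (Suc j) * 0)) / coeff p 0"
        using less.prems by (intro tendsto_divide tendsto_diff comb tendsto_sum tendsto_mult tendsto_const const) auto
      moreover have "((\<Sum>j\<le>a. coeff p j * err m (n + j)) - (\<Sum>j<a. coeff p (Suc j) * err m (n + Suc j))) / coeff p 0 = err m n" for m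
        unfolding sum.atMost_shift using const by simp
      ultimately show ?thesis by simp
    qed
  qed
  from this[OF r] show ?thesis by (simp add: err_def LIM_zero_iff)
qed

lemma coeff_eq_higher_pderiv:
  fixes p :: "real poly"
  shows "poly ((pderiv ^^ r) p) 0 / fact r = coeff p r"
  by (simp add: poly_0_coeff_0 coeff_higher_pderiv pochhammer_fact[symmetric])

lemma Q_poly_eq_square:
  "Q_poly f \<mu> = ([:0, 1:] ^ (1 + of_bool (\<mu> \<noteq> 0)) * (\<Prod>l\<in>nonzero_eigenvalues f. [:- l, 1:]))\<^sup>2"
  by (simp only: Q_poly_def power_mult_distrib prod_power_distrib power_mult[symmetric] mult.commute[of 2])

text \<open>Keeps the orders 0 and 1, about which nothing is known, out of
  \<open>\<Sum> Q(l i)\<close>, and for \<open>e = 2\<close> also order 2.\<close>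

lemma coeff_square_X_power:
  fixes p :: "'a::comm_ring_1 poly"
  assumes "r < 2 * e"
  shows "coeff (([:0, 1:] ^ e * p)\<^sup>2) r = 0"
proof -
  have "([:0, 1:] ^ e * p)\<^sup>2 = monom 1 (2 * e) * p\<^sup>2"
    by (simp add: power_mult_distrib monom_altdef mult.commute[of 2] flip: power_mult)
  then show ?thesis using assms by (simp add: coeff_monom_mult)
qed

section \<open>From arbitrary kernels to finite lists\<close>

context brownian
begin

text \<open>One finite list has to serve for all \<open>t\<close> and for finitely many cumulants at
  once. That the cumulants of the approximations converge to those of \<open>I2 f\<close> is
  \<open>psum_limit_kappa\<close> for this single kernel; no moments are computed.\<close>

lemma chaos_approximation:
  assumes f: "f \<in> L2_sym" and e: "0 < e"
  shows "\<exists>d l. (\<forall>t. cmod (cf M (I2 f) t - exp (log_cf d l t)) \<le> \<bar>t\<bar> * e) \<and>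
    (\<forall>r\<in>{2..R}. \<bar>cumulant M (I2 f) r - 2 ^ (r - 1) * fact (r - 1) * psum d l r\<bar> \<le> e)"
proof -
  have "\<exists>g d l u. spectral g d l u \<and> L2_norm Rplus2 (\<lambda>z. g z - f z) < inverse (real (Suc m))" for m
    by (rule spectral_approximation[OF f]) simp
  then obtain g d l u where s: "\<And>m. spectral (g m) (d m) (l m) (u m)"
    and near: "\<And>m. L2_norm Rplus2 (\<lambda>z. g m z - f z) < inverse (real (Suc m))" by metis
  have gS: "g m \<in> L2_sym" for m using s by (simp add: spectral_def)
  have fL: "f \<in> L2 Rplus2" and gL: "g m \<in> L2 Rplus2" for m using f gS L2_sym_subset by auto
  have IL: "I2 f \<in> L2 M" and IgL: "I2 (g m) \<in> L2 M" for m using f gS by (auto intro: I2_L2)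
  have lim: "(\<lambda>m. L2_norm Rplus2 (\<lambda>z. g m z - f z)) \<longlonglongrightarrow> 0"
    by (rule tendsto_sandwich[OF _ _ tendsto_const LIMSEQ_inverse_real_of_nat])
      (auto intro!: always_eventually less_imp_le near simp del: of_nat_Suc)
  have limI: "(\<lambda>m. L2_norm M (\<lambda>\<omega>. I2 (g m) \<omega> - I2 f \<omega>)) \<longlonglongrightarrow> 0"
    using tendsto_mult_right_zero[OF lim, of "sqrt 2"] by (simp add: I2_diff_norm gS f)
  have cfg: "cf M (I2 (g m)) t = exp (log_cf (d m) (l m) t)" for m t by (rule cf_I2_spectral[OF s])
  \<comment> \<open>\<open>g m\<close> is within 1 of \<open>f\<close>, so its norm, the root of the
    second power sum, is at most \<open>B\<close>.\<close>
  define B where "B = L2_norm Rplus2 f + 1"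
  have B: "0 < B" by (simp add: B_def add_nonneg_pos)
  have bound: "psum (d m) (l m) 2 \<le> B\<^sup>2" for m
  proof -
    have "inverse (real (Suc m)) \<le> 1" by (simp add: inverse_le_1_iff)
    then have "L2_norm Rplus2 (g m) \<le> B"
      using L2_norm_diff_le[OF gL fL, of m] near[of m] by (simp add: B_def)
    then show ?thesis unfolding spectral_norm[OF s, symmetric] by (intro power_mono) auto
  qed
  have "(\<lambda>m. exp (log_cf (d m) (l m) t)) \<longlonglongrightarrow> cf M (I2 f) t" for t
    unfolding cfg[symmetric] by (rule cf_L2_limit[OF IgL IL limI])
  then have kap: "(\<lambda>m. 2 ^ (r - 1) * fact (r - 1) * psum (d m) (l m) r) \<longlonglongrightarrow> cumulant M (I2 f) r" if "2 \<le> r" for r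
    unfolding cumulant_eq_kappa[OF L2_measurable[OF IL]] by (rule psum_limit_kappa[OF bound B _ that])
  have "\<forall>\<^sub>F m in sequentially. \<bar>cumulant M (I2 f) r - 2 ^ (r - 1) * fact (r - 1) * psum (d m) (l m) r\<bar> < e" if "2 \<le> r" for r
    using tendstoD[OF kap[OF that] e] by eventually_elim (simp add: dist_real_def abs_minus_commute)
  then have "\<forall>\<^sub>F m in sequentially. \<forall>r\<in>{2..R}. \<bar>cumulant M (I2 f) r - 2 ^ (r - 1) * fact (r - 1) * psum (d m) (l m) r\<bar> < e"
    by (intro eventually_ball_finite) auto
  moreover have "\<forall>\<^sub>F m in sequentially. L2_norm M (\<lambda>\<omega>. I2 (g m) \<omega> - I2 f \<omega>) < e"
    by (rule order_tendstoD(2)[OF limI e])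
  ultimately have "\<forall>\<^sub>F m in sequentially. (\<forall>r\<in>{2..R}. \<bar>cumulant M (I2 f) r - 2 ^ (r - 1) * fact (r - 1) * psum (d m) (l m) r\<bar> < e)
      \<and> L2_norm M (\<lambda>\<omega>. I2 (g m) \<omega> - I2 f \<omega>) < e" by (rule eventually_conj)
  then obtain m where m: "\<forall>r\<in>{2..R}. \<bar>cumulant M (I2 f) r - 2 ^ (r - 1) * fact (r - 1) * psum (d m) (l m) r\<bar> < e"
    "L2_norm M (\<lambda>\<omega>. I2 (g m) \<omega> - I2 f \<omega>) < e" using eventually_happens'[OF sequentially_bot] by blast
  have "cmod (cf M (I2 f) t - exp (log_cf (d m) (l m) t)) \<le> \<bar>t\<bar> * e" for t
  proof -
    have "cmod (cf M (I2 f) t - exp (log_cf (d m) (l m) t)) \<le> \<bar>t\<bar> * L2_norm M (\<lambda>\<omega>. I2 f \<omega> - I2 (g m) \<omega>)"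
      unfolding cfg[symmetric] by (rule cf_close[OF IL IgL])
    also have "\<dots> \<le> \<bar>t\<bar> * e" using m(2) by (intro mult_left_mono) (auto simp: L2_norm_minus_commute[of M "I2 f"])
    finally show ?thesis .
  qed
  then show ?thesis using m(1) by (intro exI[of _ "d m"] exI[of _ "l m"]) (auto intro: less_imp_le)
qed

lemma cumulant_I2_spectral:
  assumes s: "spectral f d l u" and r: "2 \<le> r"
  shows "cumulant M (I2 f) r = 2 ^ (r - 1) * fact (r - 1) * psum d l r"
proof -
  have "I2 f \<in> borel_measurable M" using s by (intro L2_measurable[OF I2_L2]) (simp add: spectral_def)
  moreover have "cf M (I2 f) = (\<lambda>t. exp (log_cf d l t - of_real (0 * t\<^sup>2) / 2))"
    by (simp add: cf_I2_spectral[OF s] fun_eq_iff)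
  ultimately show ?thesis using kappa_spectral[OF r, of d l 0] by (simp add: cumulant_eq_kappa)
qed

end

lemma weak_conv_iff_cf:
  assumes "prob_space M" "prob_space M'" "\<And>n. F n \<in> borel_measurable M" "Z \<in> borel_measurable M'"
  shows "weak_conv_m (\<lambda>n. distr M borel (F n)) (distr M' borel Z) \<longleftrightarrow> (\<forall>t. (\<lambda>n. cf M (F n) t) \<longlonglongrightarrow> cf M' Z t)"
proof -
  have 1: "real_distribution (distr M borel (F n))" for n
    by (rule prob_space.real_distribution_distr[OF assms(1,3)])
  have 2: "real_distribution (distr M' borel Z)"
    by (rule prob_space.real_distribution_distr[OF assms(2,4)])
  show ?thesis
    using levy_continuity1[where M = "\<lambda>n. distr M borel (F n)", OF 1 2]
      levy_continuity[where M = "\<lambda>n. distr M borel (F n)", OF 1 2]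
    unfolding char_distr_eq_cf[OF assms(3)] char_distr_eq_cf[OF assms(4)] by blast
qed

lemma tendsto_cong_diff:
  fixes u v :: "nat \<Rightarrow> 'a::real_normed_vector"
  assumes "(\<lambda>n. u n - v n) \<longlonglongrightarrow> 0"
  shows "u \<longlonglongrightarrow> z \<longleftrightarrow> v \<longlonglongrightarrow> z"
  using tendsto_diff[OF _ assms, of u z] tendsto_add[OF _ assms, of v z] by auto

section \<open>The equivalence of convergence in law with the conditions on cumulants\<close>

context independent_gaussian
begin

lemma chaos_convergence:
  assumes f: "f \<in> L2_sym" and rank: "kernel_rank f < \<infinity>" and v\<mu>: "v = \<mu>\<^sup>2" and fn: "\<And>n. fn n \<in> L2_sym"
  defines "Q \<equiv> Q_poly f \<mu>" and "Z \<equiv> \<lambda>\<omega>. N \<omega> + I2 f (pr \<omega>)"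
  shows "cumulant M' Z 2 = \<mu>\<^sup>2 + 2 * (L2_norm Rplus2 f)\<^sup>2 \<and>
    (weak_conv_m (\<lambda>n. distr M borel (I2 (fn n))) (distr M' borel Z) \<longleftrightarrow>
      (\<lambda>n. cumulant M (I2 (fn n)) 2) \<longlonglongrightarrow> cumulant M' Z 2 \<and>
      (\<lambda>n. \<Sum>r=3..degree Q. poly ((pderiv ^^ r) Q) 0 / fact r *
              (cumulant M (I2 (fn n)) r / (fact (r - 1) * 2 ^ (r - 1))))
        \<longlonglongrightarrow> (\<Sum>r=3..degree Q. poly ((pderiv ^^ r) Q) 0 / fact r *
              (cumulant M (I2 f) r / (fact (r - 1) * 2 ^ (r - 1)))) \<and>
      (\<exists>r\<^sub>0\<ge>2 * (1 + of_bool (\<mu> \<noteq> 0)).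
         \<forall>r\<in>{r\<^sub>0..<r\<^sub>0 + card (nonzero_eigenvalues f)}.
           (\<lambda>n. cumulant M (I2 (fn n)) r) \<longlonglongrightarrow> cumulant M (I2 f) r))"
    (is "?var \<and> (?conv \<longleftrightarrow> ?a \<and> ?b \<and> ?c)")
proof -
  obtain D L u where s: "spectral f D L u" and L: "\<And>i. i < D \<Longrightarrow> L i \<noteq> 0"
    using finite_rank_spectral[OF f rank] by blast
  have E: "nonzero_eigenvalues f = L ` {..<D}" by (rule nonzero_eigenvalues_spectral[OF s L])
  define K where "K r = (2 ^ (r - 1) * fact (r - 1) :: real)" for r
  have K0: "K r \<noteq> 0" for r by (simp add: K_def)
  have Fm: "I2 (fn n) \<in> borel_measurable M" for n using I2_L2[OF fn] by (rule L2_measurable)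
  have Zm: "Z \<in> borel_measurable M'"
    unfolding Z_def using N measurable_pr[OF L2_measurable[OF I2_L2[OF f]]] by measurable
  have cfZ: "cf M' Z = (\<lambda>t. exp (log_cf D L t - of_real (v * t\<^sup>2) / 2))"
    unfolding Z_def by (simp add: cf_sum_spectral[OF s] fun_eq_iff)
  have cumZ: "cumulant M' Z r = K r * psum D L r + of_bool (r = 2) * v" if "2 \<le> r" for r
    unfolding cumulant_eq_kappa[OF Zm] cfZ K_def by (rule kappa_spectral[OF that])
  have cumf: "cumulant M (I2 f) r = K r * psum D L r" if "2 \<le> r" for r
    unfolding K_def by (rule cumulant_I2_spectral[OF s that])
  have var: ?var
    using cumZ[of 2] spectral_norm[OF s] by (simp add: K_def v\<mu>)
  \<comment> \<open>The range of orders grows with \<open>n\<close>, so every fixed cumulant is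
    eventually approximated, with error tending to 0.\<close>
  have "\<exists>d l. (\<forall>t. cmod (cf M (I2 (fn n)) t - exp (log_cf d l t)) \<le> \<bar>t\<bar> * inverse (real (Suc n))) \<and>
    (\<forall>r\<in>{2..n}. \<bar>cumulant M (I2 (fn n)) r - K r * psum d l r\<bar> \<le> inverse (real (Suc n)))" for n
    unfolding K_def by (rule chaos_approximation[OF fn]) simp
  then obtain d l where
    dcf: "\<And>n t. cmod (cf M (I2 (fn n)) t - exp (log_cf (d n) (l n) t)) \<le> \<bar>t\<bar> * inverse (real (Suc n))"
    and dcum: "\<And>n r. r \<in> {2..n} \<Longrightarrow> \<bar>cumulant M (I2 (fn n)) r - K r * psum (d n) (l n) r\<bar> \<le> inverse (real (Suc n))"
    by metis
  have cf_iff: "(\<lambda>n. cf M (I2 (fn n)) t) \<longlonglongrightarrow> z \<longleftrightarrow> (\<lambda>n. exp (log_cf (d n) (l n) t)) \<longlonglongrightarrow> z" for t z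
  proof (rule tendsto_cong_diff, rule Lim_null_comparison)
    show "\<forall>\<^sub>F n in sequentially. norm (cf M (I2 (fn n)) t - exp (log_cf (d n) (l n) t)) \<le> \<bar>t\<bar> * inverse (real (Suc n))"
      using dcf by (intro always_eventually allI)
    show "(\<lambda>n. \<bar>t\<bar> * inverse (real (Suc n))) \<longlonglongrightarrow> 0"
      by (rule tendsto_mult_right_zero[OF LIMSEQ_inverse_real_of_nat])
  qed
  have cum_iff: "(\<lambda>n. cumulant M (I2 (fn n)) r) \<longlonglongrightarrow> K r * z \<longleftrightarrow> (\<lambda>n. psum (d n) (l n) r) \<longlonglongrightarrow> z" if "2 \<le> r" for r z
  proof -
    have "(\<lambda>n. cumulant M (I2 (fn n)) r) \<longlonglongrightarrow> K r * z \<longleftrightarrow> (\<lambda>n. K r * psum (d n) (l n) r) \<longlonglongrightarrow> K r * z"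
    proof (rule tendsto_cong_diff, rule Lim_null_comparison[OF _ LIMSEQ_inverse_real_of_nat])
      show "\<forall>\<^sub>F n in sequentially. norm (cumulant M (I2 (fn n)) r - K r * psum (d n) (l n) r) \<le> inverse (real (Suc n))"
        using eventually_ge_at_top[of r] by eventually_elim (use dcum that in \<open>simp del: of_nat_Suc\<close>)
    qed
    also have "\<dots> \<longleftrightarrow> (\<lambda>n. psum (d n) (l n) r) \<longlonglongrightarrow> z" by (rule tendsto_mult_left_iff[OF K0])
    finally show ?thesis .
  qed
  have conv_iff: "?conv \<longleftrightarrow> (\<forall>t. (\<lambda>n. exp (log_cf (d n) (l n) t)) \<longlonglongrightarrow> cf M' Z t)"
    unfolding weak_conv_iff_cf[OF prob_space_axioms prob_M' Fm Zm] cf_iff ..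
  define e :: nat where "e = 1 + of_bool (\<mu> \<noteq> 0)"
  have e: "1 \<le> e" "e \<le> 2" by (auto simp: e_def)
  define p where "p = (\<Prod>x\<in>nonzero_eigenvalues f. [:- x, 1:])"
  have Q: "Q = ([:0, 1:] ^ e * p)\<^sup>2" unfolding Q_def e_def p_def by (rule Q_poly_eq_square)
  have Qc: "coeff Q r = 0" if "r < 2 * e" for r unfolding Q by (rule coeff_square_X_power[OF that])
  have finE: "finite (nonzero_eigenvalues f)" by (simp add: E)
  have degp: "degree p = card (nonzero_eigenvalues f)"
    unfolding p_def by (subst degree_prod_eq_sum_degree) auto
  have lead: "lead_coeff p = 1" unfolding p_def by (simp add: lead_coeff_prod)
  have const: "coeff p 0 \<noteq> 0"
    unfolding p_def poly_0_coeff_0[symmetric] poly_prod using finE L by (auto simp: E)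
  have roots: "poly p (L i) = 0" if "i < D" for i
    unfolding p_def poly_prod using finE that by (auto simp: E)
  have b_iff: "?b \<longleftrightarrow> (\<lambda>n. \<Sum>r=3..degree Q. coeff Q r * (cumulant M (I2 (fn n)) r / K r)) \<longlonglongrightarrow>
      (\<Sum>r=3..degree Q. coeff Q r * psum D L r)"
  proof -
    have "(\<Sum>r=3..degree Q. coeff Q r * (cumulant M (I2 f) r / K r)) = (\<Sum>r=3..degree Q. coeff Q r * psum D L r)"
      by (intro sum.cong refl) (simp add: cumf K0)
    then show ?thesis unfolding coeff_eq_higher_pderiv K_def by (simp only: mult.commute[of "fact _"])
  qed
  have e2: "2 * (1 + of_bool (\<mu> \<noteq> 0)) = 2 * e" by (simp add: e_def)
  show ?thesis
  proof (intro conjI iffI)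
    show ?var by (rule var)
  next
    assume ?conv
    then have lim: "(\<lambda>n. exp (log_cf (d n) (l n) t)) \<longlonglongrightarrow> cf M' Z t" for t using conv_iff by blast
    \<comment> \<open>A nonzero limit at \<open>t = 1\<close> is what bounds the second power
      sums.\<close>
    have "cf M' Z 1 \<noteq> 0" by (simp add: cfZ)
    then obtain B where B: "B > 0" "\<And>n. psum (d n) (l n) 2 \<le> B\<^sup>2"
      using psum_bounded_of_limit[OF lim] by blast
    have cum: "(\<lambda>n. cumulant M (I2 (fn n)) r) \<longlonglongrightarrow> cumulant M' Z r" if r: "2 \<le> r" for r
    proof -
      have "(\<lambda>n. K r * psum (d n) (l n) r) \<longlonglongrightarrow> cumulant M' Z r"
        unfolding K_def cumulant_eq_kappa[OF Zm] by (rule psum_limit_kappa[OF B(2,1) lim r])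
      then have "(\<lambda>n. K r * psum (d n) (l n) r) \<longlonglongrightarrow> K r * (cumulant M' Z r / K r)" using K0 by simp
      then have "(\<lambda>n. psum (d n) (l n) r) \<longlonglongrightarrow> cumulant M' Z r / K r" by (simp only: tendsto_mult_left_iff[OF K0])
      then show ?thesis using cum_iff[OF r, of "cumulant M' Z r / K r"] K0 by simp
    qed
    show ?a by (rule cum) simp
    show ?b unfolding b_iff
    proof (intro tendsto_sum tendsto_mult tendsto_const)
      fix r assume "r \<in> {3..degree Q}"
      then have r: "3 \<le> r" by simp
      have "(\<lambda>n. cumulant M (I2 (fn n)) r / K r) \<longlonglongrightarrow> cumulant M' Z r / K r"
        using r K0 by (intro tendsto_divide cum tendsto_const) auto
      then show "(\<lambda>n. cumulant M (I2 (fn n)) r / K r) \<longlonglongrightarrow> psum D L r"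
        using cumZ[of r] r K0 by simp
    qed
    show ?c
    proof (intro exI conjI ballI)
      show "2 * (1 + of_bool (\<mu> \<noteq> 0)) \<le> 2 * e" by (simp add: e_def)
      fix r assume "r \<in> {2 * e..<2 * e + card (nonzero_eigenvalues f)}"
      then have r: "2 * e \<le> r" by simp
      then have r2: "2 \<le> r" using e by linarith
      \<comment> \<open>\<open>N\<close> contributes to order 2 only; if it contributes at all, then
        \<open>e = 2\<close> and \<open>r \<ge> 4\<close>.\<close>
      have "cumulant M' Z r = cumulant M (I2 f) r"
        using cumZ[OF r2] cumf[OF r2] r by (auto simp: e_def v\<mu> of_bool_def split: if_splits)
      then show "(\<lambda>n. cumulant M (I2 (fn n)) r) \<longlonglongrightarrow> cumulant M (I2 f) r" using cum[OF r2] by simp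
    qed
  next
    assume abc: "?a \<and> ?b \<and> ?c"
    have "cumulant M' Z 2 = K 2 * (psum D L 2 + v / 2)" using cumZ[of 2] by (simp add: K_def)
    then have p2: "(\<lambda>n. psum (d n) (l n) 2) \<longlonglongrightarrow> psum D L 2 + v / 2"
      using abc cum_iff[of 2 "psum D L 2 + v / 2"] by simp
    then have "Bseq (\<lambda>n. psum (d n) (l n) 2)" by (rule convergent_imp_Bseq[OF convergentI])
    then obtain C where C: "C > 0" "\<And>n. \<bar>psum (d n) (l n) 2\<bar> \<le> C" unfolding Bseq_def by auto
    \<comment> \<open>One radius for all lists and for the limit, positive because of
      \<open>C\<close>.\<close>
    define B where "B = sqrt (C + psum D L 2)"
    have pD: "0 \<le> psum D L 2" by (simp add: psum_def sum_nonneg)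
    have B: "B > 0" "B\<^sup>2 = C + psum D L 2" using C(1) pD by (auto simp: B_def)
    have bound: "psum (d n) (l n) 2 \<le> B\<^sup>2" for n using C(2)[of n] pD B(2) by linarith
    have boundD: "psum D L 2 \<le> B\<^sup>2" using C(1) B(2) by linarith
    \<comment> \<open>Order 2 is split off because (ii-b) begins at 3.\<close>
    have sumQ: "(\<Sum>i<D'. poly Q (L' i)) = coeff Q 2 * psum D' L' 2 + (\<Sum>r=3..degree Q. coeff Q r * psum D' L' r)"
      for D' and L' :: "nat \<Rightarrow> real"
    proof -
      have "(\<Sum>i<D'. poly Q (L' i)) = (\<Sum>r\<le>degree Q. coeff Q r * psum D' L' r)"
        using sum_poly_eq_psum[of L' 0 Q D'] by simp
      also have "\<dots> = (\<Sum>r\<in>{2} \<union> {3..degree Q}. coeff Q r * psum D' L' r)"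
      proof (rule sum.mono_neutral_cong)
        fix r assume "r \<in> {..degree Q} - ({2} \<union> {3..degree Q})"
        then have "r < 2" by auto
        then show "coeff Q r * psum D' L' r = 0" using Qc[of r] e by simp
      next
        fix r assume "r \<in> {2} \<union> {3..degree Q} - {..degree Q}"
        then have "degree Q < r" by auto
        then show "coeff Q r * psum D' L' r = 0" by (simp add: coeff_eq_0)
      qed auto
      also have "\<dots> = coeff Q 2 * psum D' L' 2 + (\<Sum>r=3..degree Q. coeff Q r * psum D' L' r)" by simp
      finally show ?thesis .
    qed
    have b': "(\<lambda>n. \<Sum>r=3..degree Q. coeff Q r * psum (d n) (l n) r) \<longlonglongrightarrow> (\<Sum>r=3..degree Q. coeff Q r * psum D L r)"
    proof -
      have diff: "(\<lambda>n. (\<Sum>r=3..degree Q. coeff Q r * (cumulant M (I2 (fn n)) r / K r)) -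
          (\<Sum>r=3..degree Q. coeff Q r * psum (d n) (l n) r)) \<longlonglongrightarrow> (\<Sum>r=3..degree Q. coeff Q r * (0 / K r))"
        unfolding sum_subtractf[symmetric] right_diff_distrib[symmetric]
      proof (intro tendsto_sum tendsto_mult tendsto_const)
        fix r assume "r \<in> {3..degree Q}"
        then have r: "2 \<le> r" by simp
        have "(\<lambda>n. cumulant M (I2 (fn n)) r - K r * psum (d n) (l n) r) \<longlonglongrightarrow> 0"
        proof (rule Lim_null_comparison[OF _ LIMSEQ_inverse_real_of_nat])
          show "\<forall>\<^sub>F n in sequentially. norm (cumulant M (I2 (fn n)) r - K r * psum (d n) (l n) r) \<le> inverse (real (Suc n))"
            using eventually_ge_at_top[of r] by eventually_elim (use dcum r in \<open>simp del: of_nat_Suc\<close>)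
        qed
        then have "(\<lambda>n. (cumulant M (I2 (fn n)) r - K r * psum (d n) (l n) r) / K r) \<longlonglongrightarrow> 0 / K r"
          by (intro tendsto_divide tendsto_const K0)
        then show "(\<lambda>n. cumulant M (I2 (fn n)) r / K r - psum (d n) (l n) r) \<longlonglongrightarrow> 0 / K r"
          using K0 by (simp add: diff_divide_distrib)
      qed
      have "(\<Sum>r=3..degree Q. coeff Q r * (0 / K r)) = 0" by simp
      note zero = diff[unfolded this]
      have b1: "(\<lambda>n. \<Sum>r=3..degree Q. coeff Q r * (cumulant M (I2 (fn n)) r / K r)) \<longlonglongrightarrow>
          (\<Sum>r=3..degree Q. coeff Q r * psum D L r)"
        using abc b_iff by blast
      show ?thesis by (rule iffD1[OF tendsto_cong_diff[OF zero] b1])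
    qed
    \<comment> \<open>For \<open>\<mu> = 0\<close> the second power sums converge to
      \<open>psum D L 2\<close>; otherwise they converge to it plus \<open>v / 2\<close>, but
      \<open>coeff Q 2\<close> is 0.\<close>
    have "(\<lambda>n. coeff Q 2 * psum (d n) (l n) 2) \<longlonglongrightarrow> coeff Q 2 * psum D L 2"
    proof (cases "\<mu> = 0")
      case True
      then show ?thesis using p2 by (intro tendsto_mult tendsto_const) (simp add: v\<mu>)
    next
      case False
      then have "coeff Q 2 = 0" by (intro Qc) (simp add: e_def)
      then show ?thesis by simp
    qed
    then have "(\<lambda>n. \<Sum>i<d n. poly Q (l n i)) \<longlonglongrightarrow> (\<Sum>i<D. poly Q (L i))"
      unfolding sumQ by (intro tendsto_add b')
    moreover have "(\<Sum>i<D. poly Q (L i)) = 0" unfolding Q using roots by simp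
    ultimately have S: "(\<lambda>n. \<Sum>i<d n. poly (([:0, 1:] ^ e * p)\<^sup>2) (l n i)) \<longlonglongrightarrow> 0" by (simp only: Q)
    obtain r0 where r0: "2 * e \<le> r0" and c: "\<And>r. r \<in> {r0..<r0 + card (nonzero_eigenvalues f)} \<Longrightarrow>
        (\<lambda>n. cumulant M (I2 (fn n)) r) \<longlonglongrightarrow> cumulant M (I2 f) r"
      using abc unfolding e2 by blast
    \<comment> \<open>\<open>e + 1\<close> is 2 or 3, so the recurrence reaches every order from 3
      on; order 2 has its own limit \<open>p2\<close>.\<close>
    have pr: "(\<lambda>n. psum (d n) (l n) r) \<longlonglongrightarrow> psum D L r" if "3 \<le> r" for r
    proof (rule psum_recurrence[OF bound B(1) lead const roots S])
      show "e + 1 \<le> r0" using r0 e by linarith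
      show "e + 1 \<le> r" using that e by linarith
      fix r assume "r0 \<le> r" "r < r0 + degree p"
      then have "(\<lambda>n. cumulant M (I2 (fn n)) r) \<longlonglongrightarrow> cumulant M (I2 f) r" "2 \<le> r"
        using c[of r] r0 e by (auto simp: degp)
      then show "(\<lambda>n. psum (d n) (l n) r) \<longlonglongrightarrow> psum D L r" using cum_iff[of r "psum D L r"] by (simp add: cumf)
    qed
    show ?conv unfolding conv_iff cfZ
    proof
      fix t
      show "(\<lambda>n. exp (log_cf (d n) (l n) t)) \<longlonglongrightarrow> exp (log_cf D L t - of_real (v * t\<^sup>2) / 2)"
        by (intro tendsto_exp log_cf_limit[OF bound boundD B(1) v p2 pr])
    qed
  qed
qed

end

theorem theorem3p4:
  fixes M :: "'a measure" and W :: "real \<Rightarrow> 'a \<Rightarrow> real"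
    and M' :: "'b measure" and \<pi> :: "'b \<Rightarrow> 'a" and N :: "'b \<Rightarrow> real"
    and f :: "real \<times> real \<Rightarrow> real" and \<mu>\<^sub>0 :: real
    and fn :: "nat \<Rightarrow> real \<times> real \<Rightarrow> real" and F :: "nat \<Rightarrow> 'a \<Rightarrow> real"
    and Q :: "real poly" and I\<^sub>2 :: "(real \<times> real \<Rightarrow> real) \<Rightarrow> 'a \<Rightarrow> real" and Z :: "'b \<Rightarrow> real"
  assumes "brownian_motion M W"
    \<comment> \<open>\<open>M'\<close> is an enlargement of the probability space \<open>M\<close>, with projection \<open>\<pi>\<close>\<close>
    and "prob_space M'" and "\<pi> \<in> M' \<rightarrow>\<^sub>M M" and "distr M' M \<pi> = M"
    and "f \<in> L2_sym" and "kernel_rank f < \<infinity>"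
    and "N \<in> borel_measurable M'" and "distr M' borel N = normal_law 0 (\<mu>\<^sub>0\<^sup>2)"
    and "indep_of_process M' N (\<lambda>t \<omega>. W t (\<pi> \<omega>))"
    and "\<bar>\<mu>\<^sub>0\<bar> + L2_norm Rplus2 f > 0"
  defines "I\<^sub>2 \<equiv> double_wiener_integral M W"
    and "Q \<equiv> Q_poly f \<mu>\<^sub>0"
    and "Z \<equiv> \<lambda>\<omega>. N \<omega> + I\<^sub>2 f (\<pi> \<omega>)"
  assumes "\<And>n. fn n \<in> L2_sym" and "\<And>n. F n = I\<^sub>2 (fn n)"
  shows "cumulant M' Z 2 = \<mu>\<^sub>0\<^sup>2 + 2 * (L2_norm Rplus2 f)\<^sup>2 \<and>
    (weak_conv_m (\<lambda>n. distr M borel (F n)) (distr M' borel Z) \<longleftrightarrow>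
      (\<lambda>n. cumulant M (F n) 2) \<longlonglongrightarrow> cumulant M' Z 2 \<and>
      (\<lambda>n. \<Sum>r=3..degree Q. poly ((pderiv ^^ r) Q) 0 / fact r *
              (cumulant M (F n) r / (fact (r - 1) * 2 ^ (r - 1))))
        \<longlonglongrightarrow> (\<Sum>r=3..degree Q. poly ((pderiv ^^ r) Q) 0 / fact r *
              (cumulant M (I\<^sub>2 f) r / (fact (r - 1) * 2 ^ (r - 1)))) \<and>
      (\<exists>r\<^sub>0\<ge>2 * (1 + of_bool (\<mu>\<^sub>0 \<noteq> 0)).
         \<forall>r\<in>{r\<^sub>0..<r\<^sub>0 + card (nonzero_eigenvalues f)}.
           (\<lambda>n. cumulant M (F n) r) \<longlonglongrightarrow> cumulant M (I\<^sub>2 f) r))"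
proof -
  interpret independent_gaussian M W M' \<pi> N "\<mu>\<^sub>0\<^sup>2"
    by (intro independent_gaussian.intro brownian.intro independent_gaussian_axioms.intro) (use assms in auto)
  show ?thesis
    unfolding assms(15) Z_def Q_def I\<^sub>2_def by (rule chaos_convergence[OF assms(5,6) refl assms(14)])
qed

end
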